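(* Let $P$ be a finite dimensional Poisson algebra over a field $k$. Then the category $\mathrm{CoactHopf}_P$ of all commutative Hopf algebras coacting on $P$ has an initial object $(\mathcal{H}(P),\lambda_P)$.
   Context: All vector spaces, algebras and tensor products are over an arbitrary field $k$. A Poisson algebra is a vector space $P$ which is both an associative commutative (not necessarily unital) algebra and a Lie algebra such that $[x, yz] = [x,y]z + y[x,z]$ for all $x,y,z$. Morphisms of Poisson algebras are linear maps that are both algebra and Lie algebra homomorphisms. If $A$ is a unital commutative associative algebra, $P\otimes A$ is a Poisson algebra with $(x\otimes a)(y\otimes b) = xy \otimes ab$, $[x \otimes a, y\otimes b] = [x,y]\otimes ab$. For a commutative Hopf algebra $H$, a right Poisson $H$-comodule algebra is a Poisson algebra $P$ with a Poisson algebra map $\rho_P\colon P\to P\otimes H$ that is also a right $H$-comodule structure on $P$; one says that $H$ coacts on $P$. $\mathrm{CoactHopf}_P$ is the category whose objects are pairs $(H,\rho_P)$ with $H$ a commutative Hopf algebra and $\rho_P\colon P\to P\otimes H$ a right Poisson $H$-comodule algebra structure on $P$; morphisms $(H,\rho_P)\to(H',\rho_P')$ are bialgebra maps $f\colon H\to H'$ with $(\mathrm{Id}_P\otimes f)\circ\rho_P=\rho_P'$. *)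

theory Defs
  imports "HOL.Hull" "HOL-Library.Multiset" "HOL-Algebra.AbelCoset" "HOL-Algebra.Module"
begin

section \<open>Linear maps and finite dimension\<close>

text \<open>
  A \<open>K\<close>-vector space is a structure \<open>V\<close> with \<^prop>\<open>module K V\<close>, where \<^prop>\<open>field K\<close>. The
  record type of modules extends that of rings; the fields \<^const>\<open>mult\<close> and \<^const>\<open>one\<close> are
  irrelevant for a mere vector space, and \<^const>\<open>one\<close> is irrelevant for a non-unital algebra.
\<close>

definition linear_maps ::
  "('k, 'm) ring_scheme \<Rightarrow> ('k, 'v, 'r) module_scheme \<Rightarrow> ('k, 'w, 's) module_scheme \<Rightarrow> ('v \<Rightarrow> 'w) set"
  where "linear_maps K V W =
    {f \<in> carrier V \<rightarrow> carrier W.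
      (\<forall>x \<in> carrier V. \<forall>y \<in> carrier V. f (x \<oplus>\<^bsub>V\<^esub> y) = f x \<oplus>\<^bsub>W\<^esub> f y) \<and>
      (\<forall>a \<in> carrier K. \<forall>x \<in> carrier V. f (a \<odot>\<^bsub>V\<^esub> x) = a \<odot>\<^bsub>W\<^esub> f x)}"

definition finite_dimensional ::
  "('k, 'm) ring_scheme \<Rightarrow> ('k, 'v, 'r) module_scheme \<Rightarrow> bool"
  where "finite_dimensional K V \<longleftrightarrow>
    (\<exists>B. finite B \<and> B \<subseteq> carrier V \<and>
      (\<forall>v \<in> carrier V. \<exists>c \<in> B \<rightarrow> carrier K. v = (\<Oplus>\<^bsub>V\<^esub>b\<in>B. c b \<odot>\<^bsub>V\<^esub> b)))"


section \<open>Tensor products\<close>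

definition free_module :: "('k, 'm) ring_scheme \<Rightarrow> 'x set \<Rightarrow> ('k, 'x \<Rightarrow> 'k) module"
  where "free_module K X =
    \<lparr>carrier = {c. range c \<subseteq> carrier K \<and> finite {x. c x \<noteq> \<zero>\<^bsub>K\<^esub>} \<and> {x. c x \<noteq> \<zero>\<^bsub>K\<^esub>} \<subseteq> X},
     mult = undefined, one = undefined,
     zero = (\<lambda>_. \<zero>\<^bsub>K\<^esub>), add = (\<lambda>c d x. c x \<oplus>\<^bsub>K\<^esub> d x),
     smult = (\<lambda>a c x. a \<otimes>\<^bsub>K\<^esub> c x)\<rparr>"

definition free_gen :: "('k, 'm) ring_scheme \<Rightarrow> 'x \<Rightarrow> ('x \<Rightarrow> 'k)"
  where "free_gen K x = (\<lambda>y. if y = x then \<one>\<^bsub>K\<^esub> else \<zero>\<^bsub>K\<^esub>)"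

definition quotient_module ::
  "('k, 'v, 'r) module_scheme \<Rightarrow> 'v set \<Rightarrow> ('k, 'v set) module"
  where "quotient_module M N =
    \<lparr>carrier = a_rcosets\<^bsub>M\<^esub> N, mult = undefined, one = undefined,
     zero = N, add = set_add M,
     smult = (\<lambda>a X. \<Union>x\<in>X. N +>\<^bsub>M\<^esub> (a \<odot>\<^bsub>M\<^esub> x))\<rparr>"

definition tensor_relators ::
  "('k, 'm) ring_scheme \<Rightarrow> ('k, 'v, 'r) module_scheme \<Rightarrow> ('k, 'w, 's) module_scheme \<Rightarrow>
    ('v \<times> 'w \<Rightarrow> 'k) set"
  where "tensor_relators K V W =
    (let F = free_module K (carrier V \<times> carrier W); g = (\<lambda>v w. free_gen K (v, w)) in
      {g (v \<oplus>\<^bsub>V\<^esub> v') w \<ominus>\<^bsub>F\<^esub> (g v w \<oplus>\<^bsub>F\<^esub> g v' w) | v v' w.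
         v \<in> carrier V \<and> v' \<in> carrier V \<and> w \<in> carrier W} \<union>
      {g v (w \<oplus>\<^bsub>W\<^esub> w') \<ominus>\<^bsub>F\<^esub> (g v w \<oplus>\<^bsub>F\<^esub> g v w') | v w w'.
         v \<in> carrier V \<and> w \<in> carrier W \<and> w' \<in> carrier W} \<union>
      {g (a \<odot>\<^bsub>V\<^esub> v) w \<ominus>\<^bsub>F\<^esub> a \<odot>\<^bsub>F\<^esub> g v w | a v w.
         a \<in> carrier K \<and> v \<in> carrier V \<and> w \<in> carrier W} \<union>
      {g v (a \<odot>\<^bsub>W\<^esub> w) \<ominus>\<^bsub>F\<^esub> a \<odot>\<^bsub>F\<^esub> g v w | a v w.
         a \<in> carrier K \<and> v \<in> carrier V \<and> w \<in> carrier W})"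

definition tensor_kernel ::
  "('k, 'm) ring_scheme \<Rightarrow> ('k, 'v, 'r) module_scheme \<Rightarrow> ('k, 'w, 's) module_scheme \<Rightarrow>
    ('v \<times> 'w \<Rightarrow> 'k) set"
  where "tensor_kernel K V W =
    (\<lambda>N. submodule N K (free_module K (carrier V \<times> carrier W))) hull tensor_relators K V W"

definition tensor_space ::
  "('k, 'm) ring_scheme \<Rightarrow> ('k, 'v, 'r) module_scheme \<Rightarrow> ('k, 'w, 's) module_scheme \<Rightarrow>
    ('k, ('v \<times> 'w \<Rightarrow> 'k) set) module"
  where "tensor_space K V W =
    quotient_module (free_module K (carrier V \<times> carrier W)) (tensor_kernel K V W)"

definition pure_tensor ::
  "('k, 'm) ring_scheme \<Rightarrow> ('k, 'v, 'r) module_scheme \<Rightarrow> ('k, 'w, 's) module_scheme \<Rightarrow>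
    'v \<Rightarrow> 'w \<Rightarrow> ('v \<times> 'w \<Rightarrow> 'k) set"
  where "pure_tensor K V W v w =
    tensor_kernel K V W +>\<^bsub>free_module K (carrier V \<times> carrier W)\<^esub> free_gen K (v, w)"

text \<open>
  The linear map \<open>V \<otimes> W \<rightarrow> U\<close> induced by a bilinear map \<open>f\<close> on \<open>V \<times> W\<close>: the coset of
  \<open>\<Sum> c (v, w) (v, w)\<close> is sent to \<open>\<Sum> c (v, w) f v w\<close>. For bilinear \<open>f\<close> all representatives
  of a coset have the same image, so \<^const>\<open>the_elem\<close> is applied to a singleton.
\<close>

definition tensor_lift ::
  "('k, 'm) ring_scheme \<Rightarrow> ('k, 'v, 'r) module_scheme \<Rightarrow> ('k, 'w, 's) module_scheme \<Rightarrow>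
    ('k, 'u, 't) module_scheme \<Rightarrow> ('v \<Rightarrow> 'w \<Rightarrow> 'u) \<Rightarrow> ('v \<times> 'w \<Rightarrow> 'k) set \<Rightarrow> 'u"
  where "tensor_lift K V W U f t =
    the_elem ((\<lambda>c. \<Oplus>\<^bsub>U\<^esub>p\<in>{p. c p \<noteq> \<zero>\<^bsub>K\<^esub>}. c p \<odot>\<^bsub>U\<^esub> f (fst p) (snd p)) ` t)"

text \<open>
  For bilinear operations \<open>b\<close> on \<open>V\<close> and \<open>d\<close> on \<open>W\<close>, the bilinear operation on \<open>V \<otimes> W\<close> with
  \<open>(v \<otimes> w, v' \<otimes> w') \<mapsto> b v v' \<otimes> d w w'\<close>.
\<close>

definition tensor_op ::
  "('k, 'm) ring_scheme \<Rightarrow> ('k, 'v, 'r) module_scheme \<Rightarrow> ('k, 'w, 's) module_scheme \<Rightarrow>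
    ('v \<Rightarrow> 'v \<Rightarrow> 'v) \<Rightarrow> ('w \<Rightarrow> 'w \<Rightarrow> 'w) \<Rightarrow>
    ('v \<times> 'w \<Rightarrow> 'k) set \<Rightarrow> ('v \<times> 'w \<Rightarrow> 'k) set \<Rightarrow> ('v \<times> 'w \<Rightarrow> 'k) set"
  where "tensor_op K V W b d s t =
    (let T = tensor_space K V W in
      tensor_lift K V W T
        (\<lambda>v w. tensor_lift K V W T (\<lambda>v' w'. pure_tensor K V W (b v v') (d w w')) t) s)"

definition tensor ::
  "('k, 'm) ring_scheme \<Rightarrow> ('k, 'v, 'r) module_scheme \<Rightarrow> ('k, 'w, 's) module_scheme \<Rightarrow>
    ('k, ('v \<times> 'w \<Rightarrow> 'k) set) module"
  where "tensor K V W =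
    (tensor_space K V W)
      \<lparr>mult := tensor_op K V W (mult V) (mult W),
       one := pure_tensor K V W \<one>\<^bsub>V\<^esub> \<one>\<^bsub>W\<^esub>\<rparr>"

definition tensor_map ::
  "('k, 'm) ring_scheme \<Rightarrow> ('k, 'v, 'r) module_scheme \<Rightarrow> ('k, 'w, 's) module_scheme \<Rightarrow>
    ('k, 'v2, 'r2) module_scheme \<Rightarrow> ('k, 'w2, 's2) module_scheme \<Rightarrow>
    ('v \<Rightarrow> 'v2) \<Rightarrow> ('w \<Rightarrow> 'w2) \<Rightarrow> ('v \<times> 'w \<Rightarrow> 'k) set \<Rightarrow> ('v2 \<times> 'w2 \<Rightarrow> 'k) set"
  where "tensor_map K V W V' W' f g =
    tensor_lift K V W (tensor K V' W') (\<lambda>v w. pure_tensor K V' W' (f v) (g w))"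

text \<open>The canonical map \<open>(U \<otimes> V) \<otimes> W \<rightarrow> U \<otimes> (V \<otimes> W)\<close>.\<close>

definition tensor_assoc ::
  "('k, 'm) ring_scheme \<Rightarrow> ('k, 'u, 'q) module_scheme \<Rightarrow> ('k, 'v, 'r) module_scheme \<Rightarrow>
    ('k, 'w, 's) module_scheme \<Rightarrow>
    (('u \<times> 'v \<Rightarrow> 'k) set \<times> 'w \<Rightarrow> 'k) set \<Rightarrow> ('u \<times> ('v \<times> 'w \<Rightarrow> 'k) set \<Rightarrow> 'k) set"
  where "tensor_assoc K U V W =
    (let T = tensor K U (tensor K V W) in
      tensor_lift K (tensor K U V) W T
        (\<lambda>t w. tensor_lift K U V T
          (\<lambda>u v. pure_tensor K U (tensor K V W) u (pure_tensor K V W v w)) t))"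


section \<open>Poisson algebras\<close>

record ('k, 'p) poisson = "('k, 'p) module" +
  bracket :: "'p \<Rightarrow> 'p \<Rightarrow> 'p" (\<open>(\<lbrace>_,/ _\<rbrace>\<index>)\<close>)

locale poisson_algebra = field K + module K P for K (structure) and P (structure) +
  assumes mult_closed:
      "\<lbrakk>x \<in> carrier P; y \<in> carrier P\<rbrakk> \<Longrightarrow> x \<otimes>\<^bsub>P\<^esub> y \<in> carrier P"
    and mult_assoc:
      "\<lbrakk>x \<in> carrier P; y \<in> carrier P; z \<in> carrier P\<rbrakk> \<Longrightarrow>
        (x \<otimes>\<^bsub>P\<^esub> y) \<otimes>\<^bsub>P\<^esub> z = x \<otimes>\<^bsub>P\<^esub> (y \<otimes>\<^bsub>P\<^esub> z)"
    and mult_comm: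
      "\<lbrakk>x \<in> carrier P; y \<in> carrier P\<rbrakk> \<Longrightarrow> x \<otimes>\<^bsub>P\<^esub> y = y \<otimes>\<^bsub>P\<^esub> x"
    and mult_add_left:
      "\<lbrakk>x \<in> carrier P; y \<in> carrier P; z \<in> carrier P\<rbrakk> \<Longrightarrow>
        (x \<oplus>\<^bsub>P\<^esub> y) \<otimes>\<^bsub>P\<^esub> z = x \<otimes>\<^bsub>P\<^esub> z \<oplus>\<^bsub>P\<^esub> y \<otimes>\<^bsub>P\<^esub> z"
    and mult_smult_left:
      "\<lbrakk>a \<in> carrier K; x \<in> carrier P; y \<in> carrier P\<rbrakk> \<Longrightarrow>
        (a \<odot>\<^bsub>P\<^esub> x) \<otimes>\<^bsub>P\<^esub> y = a \<odot>\<^bsub>P\<^esub> (x \<otimes>\<^bsub>P\<^esub> y)"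
    and bracket_closed:
      "\<lbrakk>x \<in> carrier P; y \<in> carrier P\<rbrakk> \<Longrightarrow> \<lbrace>x, y\<rbrace>\<^bsub>P\<^esub> \<in> carrier P"
    and bracket_add_left:
      "\<lbrakk>x \<in> carrier P; y \<in> carrier P; z \<in> carrier P\<rbrakk> \<Longrightarrow>
        \<lbrace>x \<oplus>\<^bsub>P\<^esub> y, z\<rbrace>\<^bsub>P\<^esub> = \<lbrace>x, z\<rbrace>\<^bsub>P\<^esub> \<oplus>\<^bsub>P\<^esub> \<lbrace>y, z\<rbrace>\<^bsub>P\<^esub>"
    and bracket_add_right:
      "\<lbrakk>x \<in> carrier P; y \<in> carrier P; z \<in> carrier P\<rbrakk> \<Longrightarrow>
        \<lbrace>x, y \<oplus>\<^bsub>P\<^esub> z\<rbrace>\<^bsub>P\<^esub> = \<lbrace>x, y\<rbrace>\<^bsub>P\<^esub> \<oplus>\<^bsub>P\<^esub> \<lbrace>x, z\<rbrace>\<^bsub>P\<^esub>"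
    and bracket_smult_left:
      "\<lbrakk>a \<in> carrier K; x \<in> carrier P; y \<in> carrier P\<rbrakk> \<Longrightarrow>
        \<lbrace>a \<odot>\<^bsub>P\<^esub> x, y\<rbrace>\<^bsub>P\<^esub> = a \<odot>\<^bsub>P\<^esub> \<lbrace>x, y\<rbrace>\<^bsub>P\<^esub>"
    and bracket_smult_right:
      "\<lbrakk>a \<in> carrier K; x \<in> carrier P; y \<in> carrier P\<rbrakk> \<Longrightarrow>
        \<lbrace>x, a \<odot>\<^bsub>P\<^esub> y\<rbrace>\<^bsub>P\<^esub> = a \<odot>\<^bsub>P\<^esub> \<lbrace>x, y\<rbrace>\<^bsub>P\<^esub>"
    and bracket_self: "x \<in> carrier P \<Longrightarrow> \<lbrace>x, x\<rbrace>\<^bsub>P\<^esub> = \<zero>\<^bsub>P\<^esub>"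
    and jacobi:
      "\<lbrakk>x \<in> carrier P; y \<in> carrier P; z \<in> carrier P\<rbrakk> \<Longrightarrow>
        \<lbrace>x, \<lbrace>y, z\<rbrace>\<^bsub>P\<^esub>\<rbrace>\<^bsub>P\<^esub> \<oplus>\<^bsub>P\<^esub> \<lbrace>y, \<lbrace>z, x\<rbrace>\<^bsub>P\<^esub>\<rbrace>\<^bsub>P\<^esub> \<oplus>\<^bsub>P\<^esub> \<lbrace>z, \<lbrace>x, y\<rbrace>\<^bsub>P\<^esub>\<rbrace>\<^bsub>P\<^esub> = \<zero>\<^bsub>P\<^esub>"
    and leibniz:
      "\<lbrakk>x \<in> carrier P; y \<in> carrier P; z \<in> carrier P\<rbrakk> \<Longrightarrow>
        \<lbrace>x, y \<otimes>\<^bsub>P\<^esub> z\<rbrace>\<^bsub>P\<^esub> = \<lbrace>x, y\<rbrace>\<^bsub>P\<^esub> \<otimes>\<^bsub>P\<^esub> z \<oplus>\<^bsub>P\<^esub> y \<otimes>\<^bsub>P\<^esub> \<lbrace>x, z\<rbrace>\<^bsub>P\<^esub>"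

definition poisson_hom ::
  "('k, 'm) ring_scheme \<Rightarrow> ('k, 'p, 'r) poisson_scheme \<Rightarrow> ('k, 'q, 's) poisson_scheme \<Rightarrow> ('p \<Rightarrow> 'q) set"
  where "poisson_hom K P Q =
    {f \<in> linear_maps K P Q. \<forall>x \<in> carrier P. \<forall>y \<in> carrier P.
      f (x \<otimes>\<^bsub>P\<^esub> y) = f x \<otimes>\<^bsub>Q\<^esub> f y \<and> f \<lbrace>x, y\<rbrace>\<^bsub>P\<^esub> = \<lbrace>f x, f y\<rbrace>\<^bsub>Q\<^esub>}"

definition poisson_tensor ::
  "('k, 'm) ring_scheme \<Rightarrow> ('k, 'p, 'r) poisson_scheme \<Rightarrow> ('k, 'h, 's) module_scheme \<Rightarrow>
    ('k, ('p \<times> 'h \<Rightarrow> 'k) set) poisson"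
  where "poisson_tensor K P A =
    module.extend (tensor K P A)
      (poisson.fields (tensor_op K P A (bracket P) (mult A)))"


section \<open>Commutative Hopf algebras\<close>

record ('k, 'h) hopf = "('k, 'h) module" +
  comult :: "'h \<Rightarrow> ('h \<times> 'h \<Rightarrow> 'k) set"
  counit :: "'h \<Rightarrow> 'k"
  antipode :: "'h \<Rightarrow> 'h"

definition base_algebra :: "('k, 'm) ring_scheme \<Rightarrow> ('k, 'k) module"
  where "base_algebra K =
    \<lparr>carrier = carrier K, mult = mult K, one = \<one>\<^bsub>K\<^esub>, zero = \<zero>\<^bsub>K\<^esub>, add = add K,
     smult = mult K\<rparr>"

definition algebra_hom ::
  "('k, 'm) ring_scheme \<Rightarrow> ('k, 'a, 'r) module_scheme \<Rightarrow> ('k, 'b, 's) module_scheme \<Rightarrow> ('a \<Rightarrow> 'b) set"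
  where "algebra_hom K A B = ring_hom A B \<inter> linear_maps K A B"

locale comm_hopf_algebra = field K + algebra K H for K (structure) and H (structure) +
  assumes comult_hom: "comult H \<in> algebra_hom K H (tensor K H H)"
    and counit_hom: "counit H \<in> algebra_hom K H (base_algebra K)"
    and antipode_linear: "antipode H \<in> linear_maps K H H"
    and coassoc:
      "h \<in> carrier H \<Longrightarrow>
        tensor_assoc K H H H (tensor_map K H H (tensor K H H) H (comult H) id (comult H h)) =
        tensor_map K H H H (tensor K H H) id (comult H) (comult H h)"
    and counit_left:
      "h \<in> carrier H \<Longrightarrow>
        tensor_lift K H H H (\<lambda>x y. counit H x \<odot>\<^bsub>H\<^esub> y) (comult H h) = h"
    and counit_right:
      "h \<in> carrier H \<Longrightarrow>
        tensor_lift K H H H (\<lambda>x y. counit H y \<odot>\<^bsub>H\<^esub> x) (comult H h) = h"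
    and antipode_left:
      "h \<in> carrier H \<Longrightarrow>
        tensor_lift K H H H (\<lambda>x y. antipode H x \<otimes>\<^bsub>H\<^esub> y) (comult H h) = counit H h \<odot>\<^bsub>H\<^esub> \<one>\<^bsub>H\<^esub>"
    and antipode_right:
      "h \<in> carrier H \<Longrightarrow>
        tensor_lift K H H H (\<lambda>x y. x \<otimes>\<^bsub>H\<^esub> antipode H y) (comult H h) = counit H h \<odot>\<^bsub>H\<^esub> \<one>\<^bsub>H\<^esub>"

definition bialgebra_hom ::
  "('k, 'm) ring_scheme \<Rightarrow> ('k, 'h, 'r) hopf_scheme \<Rightarrow> ('k, 'g, 's) hopf_scheme \<Rightarrow> ('h \<Rightarrow> 'g) set"
  where "bialgebra_hom K H G =
    {f \<in> algebra_hom K H G. \<forall>h \<in> carrier H.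
      comult G (f h) = tensor_map K H H G G f f (comult H h) \<and> counit G (f h) = counit H h}"


section \<open>Hopf algebras coacting on a Poisson algebra\<close>

locale poisson_comodule_algebra =
  poisson_algebra K P + comm_hopf_algebra K H
  for K (structure) and P (structure) and H (structure) +
  fixes \<rho> :: "'b \<Rightarrow> ('b \<times> 'd \<Rightarrow> 'a) set"
  assumes coaction_hom: "\<rho> \<in> poisson_hom K P (poisson_tensor K P H)"
    and coaction_coassoc:
      "p \<in> carrier P \<Longrightarrow>
        tensor_assoc K P H H (tensor_map K P H (tensor K P H) H \<rho> id (\<rho> p)) =
        tensor_map K P H P (tensor K H H) id (comult H) (\<rho> p)"
    and coaction_counit:
      "p \<in> carrier P \<Longrightarrow> tensor_lift K P H P (\<lambda>q h. counit H h \<odot>\<^bsub>P\<^esub> q) (\<rho> p) = p"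

type_synonym ('k, 'p, 'h) coaction = "('k, 'h) hopf \<times> ('p \<Rightarrow> ('p \<times> 'h \<Rightarrow> 'k) set)"

definition CoactHopf_obj ::
  "('k, 'm) ring_scheme \<Rightarrow> ('k, 'p, 'r) poisson_scheme \<Rightarrow> ('k, 'p, 'h) coaction set"
  where "CoactHopf_obj K P = {(H, \<rho>). poisson_comodule_algebra K P H \<rho>}"

text \<open>
  Morphisms are made extensional, so that two morphisms are equal iff they agree on the carrier
  of their domain.
\<close>

definition CoactHopf_hom ::
  "('k, 'm) ring_scheme \<Rightarrow> ('k, 'p, 'r) poisson_scheme \<Rightarrow>
    ('k, 'p, 'h) coaction \<Rightarrow> ('k, 'p, 'g) coaction \<Rightarrow> ('h \<Rightarrow> 'g) set"
  where "CoactHopf_hom K P = (\<lambda>(H, \<rho>) (H', \<rho>').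
    {f \<in> bialgebra_hom K H H' \<inter> extensional (carrier H).
      \<forall>p \<in> carrier P. tensor_map K P H P H' id f (\<rho> p) = \<rho>' p})"

text \<open>
  \<open>I\<close> is an object of \<open>CoactHopf\<^sub>P\<close> with exactly one morphism to every object whose Hopf algebra
  has its carrier in the type \<^typ>\<open>'h\<close>; the carrier of \<open>I\<close> may lie in another type.
\<close>

definition CoactHopf_initial ::
  "'h itself \<Rightarrow> ('k, 'm) ring_scheme \<Rightarrow> ('k, 'p, 'r) poisson_scheme \<Rightarrow>
    ('k, 'p, 'i) coaction \<Rightarrow> bool"
  where "CoactHopf_initial (_ :: 'h itself) K P I \<longleftrightarrow>
    I \<in> CoactHopf_obj K P \<and>
    (\<forall>X :: ('k, 'p, 'h) coaction. X \<in> CoactHopf_obj K P \<longrightarrow> (\<exists>!f. f \<in> CoactHopf_hom K P I X))"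

text \<open>
  A type large enough to hold an initial object: the cosets of polynomials in countably many
  indeterminates over \<open>'k\<close>, a polynomial being a function from monomials (multisets of
  indeterminates) to coefficients. Every countably generated commutative algebra over a field
  with carrier in \<open>'k\<close> is isomorphic to one with carrier in this type.
\<close>

type_synonym 'k poly_cosets = "(nat multiset \<Rightarrow> 'k) set"

end

theory Submission
  imports Defs "HOL-Algebra.QuotRing"
begin

text \<open>
  The initial object is the coordinate ring of the automorphism group scheme of \<open>P\<close>. For a
  commutative algebra \<open>A\<close>, a linear map \<open>\<phi>: P \<rightarrow> P \<otimes> A\<close> extends to an \<open>A\<close>-linear endomorphism of
  \<open>P \<otimes> A\<close>, and \<open>A \<mapsto> Aut\<^sub>A (P \<otimes> A)\<close> is a group-valued functor. Since \<open>P\<close> has a finite basis, it is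
  represented by the quotient of a polynomial ring in the entries of a generic matrix and of its
  inverse. By the Yoneda principle the group structure makes the representing algebra a Hopf
  algebra, whose axioms hold because two algebra maps out of it agree as soon as they transport the
  universal automorphism to the same one. Conversely, a coaction of \<open>H\<close> on \<open>P\<close> is an automorphism
  over \<open>H\<close> (the antipode supplies the inverse), so it is classified by a unique algebra map, which
  is compatible with the comultiplications again by uniqueness.
\<close>

section \<open>Modules and linear maps\<close>

text \<open>Everything rests on one dictionary, \<open>tassoc_ext\<close>: the left side of the
  coassociativity law of a coaction is a product, over \<open>H \<boxtimes> H\<close>, of its base
  changes along \<open>h \<mapsto> h \<otimes> 1\<close> and
  \<open>h \<mapsto> 1 \<otimes> h\<close>. Hence \<open>comult\<close> must classify the product of
  two points, \<open>counit\<close> the neutral point and \<open>antipode\<close> the inverse; this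
  also dictates the order of the two factors. Invertibility becomes representable by adjoining a
  second generic matrix with the relations of a two-sided inverse, instead of inverting a
  determinant: the multiplicativity and inverse conditions are then all equations between tensors
  and are compared coordinatewise. Two obstacles come from the encoding. Tensor products are
  concrete sets of cosets, so identities are checked on pure tensors through the universal property.
  A Hopf algebra is a record that contains its own operations, so these are built on a bare copy
  \<open>H0\<close> of the algebra and carried over by literal equality of the tensor products.
  Indeterminates are coded by natural numbers, so that the type of the initial object does not
  involve the type of \<open>P\<close>.\<close>

locale base_ring = cring K for K (structure)
begin

abbreviation lin where "lin \<equiv> linear_maps K"

lemma module_closed:
  assumes "module K V"
  shows "\<zero>\<^bsub>V\<^esub> \<in> carrier V"
    and "x \<in> carrier V \<Longrightarrow> y \<in> carrier V \<Longrightarrow> x \<oplus>\<^bsub>V\<^esub> y \<in> carrier V"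
    and "x \<in> carrier V \<Longrightarrow> y \<in> carrier V \<Longrightarrow> x \<ominus>\<^bsub>V\<^esub> y \<in> carrier V"
    and "a \<in> carrier K \<Longrightarrow> x \<in> carrier V \<Longrightarrow> a \<odot>\<^bsub>V\<^esub> x \<in> carrier V"
  using assms module.axioms(2)[OF assms]
  by (simp_all add: abelian_groupE(1,2) abelian_group.minus_closed module.smult_closed)

lemma module_simps:
  assumes "module K V"
  shows "x \<in> carrier V \<Longrightarrow> \<one> \<odot>\<^bsub>V\<^esub> x = x"
    and "x \<in> carrier V \<Longrightarrow> \<zero> \<odot>\<^bsub>V\<^esub> x = \<zero>\<^bsub>V\<^esub>"
    and "a \<in> carrier K \<Longrightarrow> a \<odot>\<^bsub>V\<^esub> \<zero>\<^bsub>V\<^esub> = \<zero>\<^bsub>V\<^esub>"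
    and "x \<in> carrier V \<Longrightarrow> \<zero>\<^bsub>V\<^esub> \<oplus>\<^bsub>V\<^esub> x = x"
    and "x \<in> carrier V \<Longrightarrow> x \<oplus>\<^bsub>V\<^esub> \<zero>\<^bsub>V\<^esub> = x"
    and "a \<in> carrier K \<Longrightarrow> x \<in> carrier V \<Longrightarrow> y \<in> carrier V \<Longrightarrow>
      a \<odot>\<^bsub>V\<^esub> (x \<oplus>\<^bsub>V\<^esub> y) = a \<odot>\<^bsub>V\<^esub> x \<oplus>\<^bsub>V\<^esub> a \<odot>\<^bsub>V\<^esub> y"
    and "a \<in> carrier K \<Longrightarrow> b \<in> carrier K \<Longrightarrow> x \<in> carrier V \<Longrightarrow>
      (a \<oplus> b) \<odot>\<^bsub>V\<^esub> x = a \<odot>\<^bsub>V\<^esub> x \<oplus>\<^bsub>V\<^esub> b \<odot>\<^bsub>V\<^esub> x"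
    and "a \<in> carrier K \<Longrightarrow> b \<in> carrier K \<Longrightarrow> x \<in> carrier V \<Longrightarrow>
      (a \<otimes> b) \<odot>\<^bsub>V\<^esub> x = a \<odot>\<^bsub>V\<^esub> (b \<odot>\<^bsub>V\<^esub> x)"
  using assms abelian_groupE(1,2,4,5)[OF module.axioms(2)[OF assms]]
  by (simp_all add: module.smult_one module.smult_l_null module.smult_r_null module.smult_r_distr
      module.smult_l_distr module.smult_assoc1)

lemma linI:
  assumes "\<And>x. x \<in> carrier V \<Longrightarrow> f x \<in> carrier W"
    and "\<And>x y. x \<in> carrier V \<Longrightarrow> y \<in> carrier V \<Longrightarrow> f (x \<oplus>\<^bsub>V\<^esub> y) = f x \<oplus>\<^bsub>W\<^esub> f y"
    and "\<And>a x. a \<in> carrier K \<Longrightarrow> x \<in> carrier V \<Longrightarrow> f (a \<odot>\<^bsub>V\<^esub> x) = a \<odot>\<^bsub>W\<^esub> f x"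
  shows "f \<in> lin V W"
  using assms unfolding linear_maps_def by auto

lemma lin_closed: "f \<in> lin V W \<Longrightarrow> x \<in> carrier V \<Longrightarrow> f x \<in> carrier W"
  and lin_add: "f \<in> lin V W \<Longrightarrow> x \<in> carrier V \<Longrightarrow> y \<in> carrier V \<Longrightarrow> f (x \<oplus>\<^bsub>V\<^esub> y) = f x \<oplus>\<^bsub>W\<^esub> f y"
  and lin_smult: "f \<in> lin V W \<Longrightarrow> a \<in> carrier K \<Longrightarrow> x \<in> carrier V \<Longrightarrow> f (a \<odot>\<^bsub>V\<^esub> x) = a \<odot>\<^bsub>W\<^esub> f x"
  unfolding linear_maps_def by auto

lemma lin_id: "(\<lambda>x. x) \<in> lin V V" "id \<in> lin V V"
  by (auto intro: linI)

lemma lin_comp: "g \<in> lin V W \<Longrightarrow> f \<in> lin U V \<Longrightarrow> (\<lambda>x. g (f x)) \<in> lin U W"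
  by (auto simp: linear_maps_def Pi_iff)

lemma lin_cong:
  assumes "f \<in> lin V W" "module K V" and eq: "\<And>x. x \<in> carrier V \<Longrightarrow> f x = g x"
  shows "g \<in> lin V W"
  by (rule linI) (simp_all add: eq[symmetric] lin_closed[OF assms(1)] lin_add[OF assms(1)]
      lin_smult[OF assms(1)] module_closed[OF assms(2)])

lemma lin_zero:
  assumes "f \<in> lin V W" "module K V" "module K W"
  shows "f \<zero>\<^bsub>V\<^esub> = \<zero>\<^bsub>W\<^esub>"
  using lin_smult[OF assms(1) zero_closed module_closed(1)[OF assms(2)]]
  by (simp add: module_simps[OF assms(2)] module_simps[OF assms(3)] module_closed[OF assms(2)]
      lin_closed[OF assms(1)])

lemma lin_diff:
  assumes "f \<in> lin V W" "module K V" "module K W" "x \<in> carrier V" "y \<in> carrier V"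
  shows "f (x \<ominus>\<^bsub>V\<^esub> y) = f x \<ominus>\<^bsub>W\<^esub> f y"
proof -
  interpret V: module K V by fact
  interpret W: module K W by fact
  have "f (x \<ominus>\<^bsub>V\<^esub> y) \<oplus>\<^bsub>W\<^esub> f y = f x"
    using assms by (simp add: lin_add[OF assms(1), symmetric] a_minus_def V.a_assoc V.l_neg)
  then show ?thesis
    using assms by (metis V.minus_closed W.add.inv_solve_right a_minus_def lin_closed)
qed

lemma lin_finsum:
  assumes "f \<in> lin V W" "module K V" "module K W" "g \<in> S \<rightarrow> carrier V"
  shows "f (\<Oplus>\<^bsub>V\<^esub>i\<in>S. g i) = (\<Oplus>\<^bsub>W\<^esub>i\<in>S. f (g i))"
proof -
  interpret V: module K V by fact
  interpret W: module K W by fact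
  show ?thesis using assms(4)
  proof (induction S rule: infinite_finite_induct)
    case (infinite S)
    then show ?case by (simp add: lin_zero[OF assms(1-3)])
  next
    case empty
    then show ?case by (simp add: lin_zero[OF assms(1-3)])
  next
    case (insert i S)
    then have "g \<in> S \<rightarrow> carrier V" "(\<lambda>i. f (g i)) \<in> S \<rightarrow> carrier W" "f (g i) \<in> carrier W"
      using lin_closed[OF assms(1)] by auto
    then show ?case using insert by (simp add: lin_add[OF assms(1)])
  qed
qed

lemma lin_plus:
  assumes "f \<in> lin V W" "g \<in> lin V W" "module K W"
  shows "(\<lambda>x. f x \<oplus>\<^bsub>W\<^esub> g x) \<in> lin V W"
proof -
  interpret W: module K W by fact
  show ?thesis using assms
    by (auto intro!: linI simp: linear_maps_def Pi_iff W.smult_r_distr W.a_ac)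
qed

lemma lin_scale:
  assumes "f \<in> lin V W" "a \<in> carrier K" "module K W"
  shows "(\<lambda>x. a \<odot>\<^bsub>W\<^esub> f x) \<in> lin V W"
proof -
  interpret W: module K W by fact
  show ?thesis using assms
    by (auto intro!: linI simp: linear_maps_def Pi_iff W.smult_r_distr W.smult_assoc1[symmetric] m_comm)
qed

lemma lin_scale_left:
  assumes "f \<in> lin V (base_algebra K)" "x \<in> carrier W" "module K W"
  shows "(\<lambda>v. f v \<odot>\<^bsub>W\<^esub> x) \<in> lin V W"
proof -
  interpret W: module K W by fact
  show ?thesis using assms
    by (auto intro!: linI simp: linear_maps_def Pi_iff base_algebra_def W.smult_l_distr W.smult_assoc1)
qed

lemma lin_const_zero: "module K W \<Longrightarrow> (\<lambda>_. \<zero>\<^bsub>W\<^esub>) \<in> lin V W"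
  by (rule linI) (simp_all add: module_closed module_simps)

lemma lin_sum:
  assumes "\<And>i. i \<in> S \<Longrightarrow> f i \<in> lin V W" "module K V" "module K W"
  shows "(\<lambda>x. \<Oplus>\<^bsub>W\<^esub>i\<in>S. f i x) \<in> lin V W"
proof -
  interpret W: module K W by fact
  show ?thesis using assms(1)
  proof (induction S rule: infinite_finite_induct)
    case (insert i S)
    then have eq: "x \<in> carrier V \<Longrightarrow> (\<Oplus>\<^bsub>W\<^esub>i\<in>insert i S. f i x) = f i x \<oplus>\<^bsub>W\<^esub> (\<Oplus>\<^bsub>W\<^esub>i\<in>S. f i x)" for x
      by (subst W.finsum_insert) (auto simp: linear_maps_def Pi_iff)
    have "(\<lambda>x. f i x \<oplus>\<^bsub>W\<^esub> (\<Oplus>\<^bsub>W\<^esub>i\<in>S. f i x)) \<in> lin V W"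
      using insert by (intro lin_plus assms(3)) auto
    then show ?case
      by (rule lin_cong[OF _ assms(2)]) (simp only: eq)
  next
    case (infinite S)
    then have "(\<lambda>x. \<Oplus>\<^bsub>W\<^esub>i\<in>S. f i x) = (\<lambda>_. \<zero>\<^bsub>W\<^esub>)" by (simp add: W.finsum_infinite)
    then show ?case by (simp only: lin_const_zero[OF assms(3)])
  next
    case empty
    have "(\<lambda>x. \<Oplus>\<^bsub>W\<^esub>i\<in>{}. f i x) = (\<lambda>_. \<zero>\<^bsub>W\<^esub>)" by (simp only: W.finsum_empty)
    then show ?case by (simp only: lin_const_zero[OF assms(3)])
  qed
qed

section \<open>Free modules and maps out of them\<close>

definition free_lift where
  "free_lift U g c = (\<Oplus>\<^bsub>U\<^esub>x\<in>{x. c x \<noteq> \<zero>}. c x \<odot>\<^bsub>U\<^esub> g x)"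

abbreviation FM where "FM \<equiv> free_module K"

lemma free_carrier:
  "c \<in> carrier (FM X) \<longleftrightarrow> (\<forall>x. c x \<in> carrier K) \<and> finite {x. c x \<noteq> \<zero>} \<and> {x. c x \<noteq> \<zero>} \<subseteq> X"
  unfolding free_module_def by auto

lemma free_simps:
  "\<zero>\<^bsub>FM X\<^esub> = (\<lambda>_. \<zero>)" "c \<oplus>\<^bsub>FM X\<^esub> d = (\<lambda>x. c x \<oplus> d x)" "a \<odot>\<^bsub>FM X\<^esub> c = (\<lambda>x. a \<otimes> c x)"
  unfolding free_module_def by auto

lemma free_mod: "module K (FM X)"
proof (intro moduleI abelian_groupI)
  show "cring K" by (rule is_cring)
next
  fix c d assume "c \<in> carrier (FM X)" "d \<in> carrier (FM X)"
  moreover have "{x. c x \<oplus> d x \<noteq> \<zero>} \<subseteq> {x. c x \<noteq> \<zero>} \<union> {x. d x \<noteq> \<zero>}" by auto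
  ultimately show "c \<oplus>\<^bsub>FM X\<^esub> d \<in> carrier (FM X)"
    by (auto simp: free_carrier free_simps elim: finite_subset)
next
  fix c assume c: "c \<in> carrier (FM X)"
  then have "(\<lambda>x. \<ominus> c x) \<in> carrier (FM X)"
    by (auto simp: free_carrier elim!: rev_finite_subset)
  moreover have "(\<lambda>x. \<ominus> c x) \<oplus>\<^bsub>FM X\<^esub> c = \<zero>\<^bsub>FM X\<^esub>"
    using c by (auto simp: free_carrier free_simps l_neg)
  ultimately show "\<exists>d\<in>carrier (FM X). d \<oplus>\<^bsub>FM X\<^esub> c = \<zero>\<^bsub>FM X\<^esub>" by blast
next
  fix a c assume "a \<in> carrier K" "c \<in> carrier (FM X)"
  moreover then have "{x. a \<otimes> c x \<noteq> \<zero>} \<subseteq> {x. c x \<noteq> \<zero>}" by auto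
  ultimately show "a \<odot>\<^bsub>FM X\<^esub> c \<in> carrier (FM X)"
    by (auto simp: free_carrier free_simps elim: finite_subset)
qed (auto simp: free_carrier free_simps a_ac l_distr r_distr m_assoc)

lemma free_gen_closed: "x \<in> X \<Longrightarrow> free_gen K x \<in> carrier (FM X)"
  by (auto simp: free_carrier free_gen_def)

text \<open>Terms outside the support vanish, so any finite set containing it may serve as index
  set. This lets sums with different supports be compared termwise.\<close>

lemma free_lift_eq:
  assumes "module K U" "finite S" "{x. c x \<noteq> \<zero>} \<subseteq> S" "S \<subseteq> X" "c \<in> carrier (FM X)"
    "\<And>x. x \<in> X \<Longrightarrow> g x \<in> carrier U"
  shows "free_lift U g c = (\<Oplus>\<^bsub>U\<^esub>x\<in>S. c x \<odot>\<^bsub>U\<^esub> g x)"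
proof -
  interpret U: module K U by fact
  have g: "x \<in> S \<Longrightarrow> g x \<in> carrier U" for x using assms by auto
  show ?thesis unfolding free_lift_def
    using assms(2-5) g
    by (intro U.add.finprod_mono_neutral_cong_left) (auto simp: free_carrier)
qed

text \<open>Scaling and adding can shrink the support, so the sums are first rewritten over a common
  index set: the support of \<open>c\<close>, or the union of the supports of \<open>c\<close> and
  \<open>d\<close>.\<close>

lemma free_lift_lin:
  assumes "module K U" "\<And>x. x \<in> X \<Longrightarrow> g x \<in> carrier U"
  shows "free_lift U g \<in> lin (FM X) U"
proof (rule linI)
  interpret U: module K U by fact
  interpret F: module K "FM X" by (rule free_mod)
  fix c assume c: "c \<in> carrier (FM X)"
  then show "free_lift U g c \<in> carrier U"
    unfolding free_lift_def using assms(2)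
    by (intro U.finsum_closed) (auto simp: free_carrier intro!: U.smult_closed)
  let ?S = "{x. c x \<noteq> \<zero>}"
  have S: "finite ?S" "?S \<subseteq> X" using c by (auto simp: free_carrier)
  show "free_lift U g (a \<odot>\<^bsub>FM X\<^esub> c) = a \<odot>\<^bsub>U\<^esub> free_lift U g c" if a: "a \<in> carrier K" for a
  proof -
    have ac: "a \<odot>\<^bsub>FM X\<^esub> c \<in> carrier (FM X)" using a c by simp
    have "free_lift U g (a \<odot>\<^bsub>FM X\<^esub> c) = (\<Oplus>\<^bsub>U\<^esub>x\<in>?S. (a \<odot>\<^bsub>FM X\<^esub> c) x \<odot>\<^bsub>U\<^esub> g x)"
      using S ac a by (intro free_lift_eq assms) (auto simp: free_simps)
    also have "\<dots> = (\<Oplus>\<^bsub>U\<^esub>x\<in>?S. a \<odot>\<^bsub>U\<^esub> (c x \<odot>\<^bsub>U\<^esub> g x))"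
      using S a c assms(2) 
      by (intro U.finsum_cong') (auto simp: free_simps free_carrier U.smult_assoc1 subset_iff)
    also have "\<dots> = a \<odot>\<^bsub>U\<^esub> (\<Oplus>\<^bsub>U\<^esub>x\<in>?S. (c x \<odot>\<^bsub>U\<^esub> g x))"
      using S a c assms(2)
      by (intro U.finsum_smult_ldistr[symmetric]) (auto simp: free_carrier subset_iff)
    finally show ?thesis unfolding free_lift_def .
  qed
  fix d assume d: "d \<in> carrier (FM X)"
  let ?T = "?S \<union> {x. d x \<noteq> \<zero>}"
  have T: "finite ?T" "?T \<subseteq> X" using c d by (auto simp: free_carrier)
  have cd: "c \<oplus>\<^bsub>FM X\<^esub> d \<in> carrier (FM X)" using c d by simp
  have "free_lift U g (c \<oplus>\<^bsub>FM X\<^esub> d) = (\<Oplus>\<^bsub>U\<^esub>x\<in>?T. (c \<oplus>\<^bsub>FM X\<^esub> d) x \<odot>\<^bsub>U\<^esub> g x)"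
    using T cd by (intro free_lift_eq assms) (auto simp: free_simps)
  also have "\<dots> = (\<Oplus>\<^bsub>U\<^esub>x\<in>?T. c x \<odot>\<^bsub>U\<^esub> g x \<oplus>\<^bsub>U\<^esub> d x \<odot>\<^bsub>U\<^esub> g x)"
    using T c d assms(2)
    by (intro U.finsum_cong') (auto simp: free_simps free_carrier U.smult_l_distr subset_iff)
  also have "\<dots> = (\<Oplus>\<^bsub>U\<^esub>x\<in>?T. c x \<odot>\<^bsub>U\<^esub> g x) \<oplus>\<^bsub>U\<^esub> (\<Oplus>\<^bsub>U\<^esub>x\<in>?T. d x \<odot>\<^bsub>U\<^esub> g x)"
    using T c d assms(2)
    by (intro U.finsum_addf) (auto simp: free_carrier subset_iff intro!: U.smult_closed)
  also have "\<dots> = free_lift U g c \<oplus>\<^bsub>U\<^esub> free_lift U g d"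
    using T c d free_lift_eq[OF assms(1) T(1) _ T(2) c assms(2)] free_lift_eq[OF assms(1) T(1) _ T(2) d assms(2)]
    by auto
  finally show "free_lift U g (c \<oplus>\<^bsub>FM X\<^esub> d) = free_lift U g c \<oplus>\<^bsub>U\<^esub> free_lift U g d" .
qed

lemma free_lift_gen:
  assumes "module K U" "x \<in> X" "\<And>x. x \<in> X \<Longrightarrow> g x \<in> carrier U"
  shows "free_lift U g (free_gen K x) = g x"
proof -
  interpret U: module K U by fact
  have "free_lift U g (free_gen K x) = (\<Oplus>\<^bsub>U\<^esub>y\<in>{x}. free_gen K x y \<odot>\<^bsub>U\<^esub> g y)"
    using assms free_gen_closed[OF assms(2)] by (intro free_lift_eq) (auto simp: free_gen_def)
  then show ?thesis using assms by (simp add: free_gen_def)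
qed

text \<open>Well-founded induction on the support: resetting one nonzero coefficient to zero makes
  it strictly smaller, and what is split off is a multiple of a generator.\<close>

lemma free_induct [consumes 1, case_names zero gen add]:
  assumes "c \<in> carrier (FM X)"
    and "Q \<zero>\<^bsub>FM X\<^esub>"
    and "\<And>a x. a \<in> carrier K \<Longrightarrow> x \<in> X \<Longrightarrow> Q (a \<odot>\<^bsub>FM X\<^esub> free_gen K x)"
    and "\<And>c d. c \<in> carrier (FM X) \<Longrightarrow> d \<in> carrier (FM X) \<Longrightarrow> Q c \<Longrightarrow> Q d \<Longrightarrow> Q (c \<oplus>\<^bsub>FM X\<^esub> d)"
  shows "Q c"
proof -
  have "finite {x. c x \<noteq> \<zero>}" using assms(1) by (simp add: free_carrier)
  then show ?thesis using assms(1)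
  proof (induction "{x. c x \<noteq> \<zero>}" arbitrary: c rule: finite_psubset_induct)
    case (psubset c)
    show ?case
    proof (cases "{x. c x \<noteq> \<zero>} = {}")
      case True
      then have "c = \<zero>\<^bsub>FM X\<^esub>" by (auto simp: free_simps)
      then show ?thesis using assms(2) by simp
    next
      case False
      then obtain x where x: "c x \<noteq> \<zero>" by auto
      define d where "d = c(x := \<zero>)"
      have d: "d \<in> carrier (FM X)"
        using psubset.prems by (auto simp: d_def free_carrier intro: rev_finite_subset)
      have "{y. d y \<noteq> \<zero>} \<subset> {y. c y \<noteq> \<zero>}" using x by (auto simp: d_def)
      then have "Q d" using psubset.hyps(2) d by blast
      moreover have cx: "c x \<in> carrier K" "x \<in> X" using psubset.prems x by (auto simp: free_carrier)
      moreover have "c = d \<oplus>\<^bsub>FM X\<^esub> (c x \<odot>\<^bsub>FM X\<^esub> free_gen K x)"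
        using psubset.prems by (auto simp: free_simps d_def free_gen_def free_carrier)
      moreover have "c x \<odot>\<^bsub>FM X\<^esub> free_gen K x \<in> carrier (FM X)"
        using cx by (intro module_closed free_mod free_gen_closed)
      ultimately show ?thesis using assms(3,4) d by metis
    qed
  qed
qed

lemma free_eqI:
  assumes "f \<in> lin (FM X) U" "g \<in> lin (FM X) U" "module K U"
    and "\<And>x. x \<in> X \<Longrightarrow> f (free_gen K x) = g (free_gen K x)" and "c \<in> carrier (FM X)"
  shows "f c = g c"
  using assms(5)
  by (induction rule: free_induct)
    (simp_all add: lin_zero[OF assms(1) free_mod assms(3)] lin_zero[OF assms(2) free_mod assms(3)]
      lin_add[OF assms(1)] lin_add[OF assms(2)] lin_smult[OF assms(1)] lin_smult[OF assms(2)]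
      free_gen_closed assms(4))

section \<open>Submodules and quotient modules\<close>

lemma submodule_abelian_subgroup:
  assumes "module K M" "submodule N K M"
  shows "abelian_subgroup N M"
  using assms by (simp add: abelian_subgroupI3 additive_subgroupI module.axioms(2) submodule.axioms(1))

text \<open>The submodules and ideals divided out below are given as smallest ones containing some
  relations. A map kills them once its kernel is a submodule or ideal containing the
  relations.\<close>

lemma submodule_kernel:
  assumes "f \<in> lin V W" "module K V" "module K W"
  shows "submodule {x \<in> carrier V. f x = \<zero>\<^bsub>W\<^esub>} K V"
proof -
  interpret V: module K V by fact
  interpret W: module K W by fact
  have neg: "f (\<ominus>\<^bsub>V\<^esub> x) = \<ominus>\<^bsub>W\<^esub> f x" if "x \<in> carrier V" for x
    using lin_diff[OF assms V.zero_closed that] that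
    by (simp add: a_minus_def lin_zero[OF assms] lin_closed[OF assms(1)])
  show ?thesis
    by (rule V.submoduleI) (auto simp: lin_zero[OF assms] lin_add[OF assms(1)] lin_smult[OF assms(1)] neg)
qed

context
  fixes M :: "('a, 'c, 'd) module_scheme" and N
  assumes M: "module K M" and N: "submodule N K M"
begin

interpretation M: module K M by (rule M)
interpretation N: abelian_subgroup N M by (rule submodule_abelian_subgroup[OF M N])

lemma quotient_carrier: "carrier (quotient_module M N) = (\<lambda>x. N +>\<^bsub>M\<^esub> x) ` carrier M"
  by (auto simp: quotient_module_def A_RCOSETS_def')

lemma quotient_add:
  "x \<in> carrier M \<Longrightarrow> y \<in> carrier M \<Longrightarrow>
    (N +>\<^bsub>M\<^esub> x) \<oplus>\<^bsub>quotient_module M N\<^esub> (N +>\<^bsub>M\<^esub> y) = N +>\<^bsub>M\<^esub> (x \<oplus>\<^bsub>M\<^esub> y)"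
  by (simp add: quotient_module_def N.a_rcos_sum)

lemma quotient_zero: "\<zero>\<^bsub>quotient_module M N\<^esub> = N +>\<^bsub>M\<^esub> \<zero>\<^bsub>M\<^esub>"
  by (simp add: quotient_module_def N.a_subset)

lemma coset_eq_iff:
  assumes "x \<in> carrier M" "y \<in> carrier M"
  shows "N +>\<^bsub>M\<^esub> x = N +>\<^bsub>M\<^esub> y \<longleftrightarrow> x \<ominus>\<^bsub>M\<^esub> y \<in> N"
  using assms N.a_rcos_module[OF assms(2,1)] N.a_repr_independence'[of x y] N.a_rcos_self[OF assms(1)]
  by (auto simp: a_minus_def)

text \<open>Scalar multiplication of cosets is a union over all representatives. Representatives
  differ by elements of \<open>N\<close>, which is closed under scalars, so all members of the union
  are the same coset.\<close>

lemma quotient_smult: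
  assumes "a \<in> carrier K" "x \<in> carrier M"
  shows "a \<odot>\<^bsub>quotient_module M N\<^esub> (N +>\<^bsub>M\<^esub> x) = N +>\<^bsub>M\<^esub> (a \<odot>\<^bsub>M\<^esub> x)"
proof -
  have "N +>\<^bsub>M\<^esub> (a \<odot>\<^bsub>M\<^esub> y) = N +>\<^bsub>M\<^esub> (a \<odot>\<^bsub>M\<^esub> x)" if y: "y \<in> N +>\<^bsub>M\<^esub> x" for y
  proof -
    have yM: "y \<in> carrier M" using N.a_elemrcos_carrier assms(2) y by auto
    have "y \<ominus>\<^bsub>M\<^esub> x \<in> N" using N.a_rcos_module_imp[OF assms(2) y] by (simp add: a_minus_def)
    then have "a \<odot>\<^bsub>M\<^esub> (y \<ominus>\<^bsub>M\<^esub> x) \<in> N" using N assms(1) by (simp add: submodule.smult_closed)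
    moreover have "a \<odot>\<^bsub>M\<^esub> (y \<ominus>\<^bsub>M\<^esub> x) = a \<odot>\<^bsub>M\<^esub> y \<ominus>\<^bsub>M\<^esub> a \<odot>\<^bsub>M\<^esub> x"
      using assms yM by (simp add: a_minus_def M.smult_r_distr M.smult_r_minus)
    ultimately show ?thesis using assms yM by (subst coset_eq_iff) auto
  qed
  then have "(\<Union>y\<in>N +>\<^bsub>M\<^esub> x. N +>\<^bsub>M\<^esub> (a \<odot>\<^bsub>M\<^esub> y)) = (\<Union>y\<in>N +>\<^bsub>M\<^esub> x. N +>\<^bsub>M\<^esub> (a \<odot>\<^bsub>M\<^esub> x))"
    by (rule SUP_cong[OF refl])
  also have "\<dots> = N +>\<^bsub>M\<^esub> (a \<odot>\<^bsub>M\<^esub> x)"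
    using N.a_rcos_self[OF assms(2)] by (rule UN_constant_eq) (rule ballI, rule refl)
  finally show ?thesis
    by (simp add: quotient_module_def)
qed

lemmas quotient_simps = quotient_add quotient_zero quotient_smult

lemma quotient_cases:
  assumes "X \<in> carrier (quotient_module M N)"
  obtains x where "x \<in> carrier M" "X = N +>\<^bsub>M\<^esub> x"
  using assms by (auto simp: quotient_carrier)

lemma quotient_mem: "x \<in> carrier M \<Longrightarrow> N +>\<^bsub>M\<^esub> x \<in> carrier (quotient_module M N)"
  by (auto simp: quotient_carrier)

lemma quotient_mod: "module K (quotient_module M N)"
proof (intro moduleI abelian_groupI)
  let ?Q = "quotient_module M N"
  show "cring K" by (rule is_cring)
  show "\<zero>\<^bsub>?Q\<^esub> \<in> carrier ?Q" by (simp only: quotient_zero quotient_mem M.zero_closed)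
  fix X assume "X \<in> carrier ?Q"
  then obtain x where x: "x \<in> carrier M" "X = N +>\<^bsub>M\<^esub> x" by (rule quotient_cases)
  show "\<exists>Y\<in>carrier ?Q. Y \<oplus>\<^bsub>?Q\<^esub> X = \<zero>\<^bsub>?Q\<^esub>"
    by (rule bexI[of _ "N +>\<^bsub>M\<^esub> (\<ominus>\<^bsub>M\<^esub> x)"])
      (simp_all only: x quotient_simps quotient_mem M.a_inv_closed M.l_neg)
  show "\<zero>\<^bsub>?Q\<^esub> \<oplus>\<^bsub>?Q\<^esub> X = X" "\<one> \<odot>\<^bsub>?Q\<^esub> X = X"
    by (simp_all only: x quotient_simps M.zero_closed M.l_zero one_closed M.smult_one)
  show "a \<odot>\<^bsub>?Q\<^esub> X \<in> carrier ?Q" if "a \<in> carrier K" for a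
    by (simp only: x that quotient_simps quotient_mem M.smult_closed)
  show "(a \<oplus> b) \<odot>\<^bsub>?Q\<^esub> X = a \<odot>\<^bsub>?Q\<^esub> X \<oplus>\<^bsub>?Q\<^esub> b \<odot>\<^bsub>?Q\<^esub> X"
    "(a \<otimes> b) \<odot>\<^bsub>?Q\<^esub> X = a \<odot>\<^bsub>?Q\<^esub> (b \<odot>\<^bsub>?Q\<^esub> X)" if "a \<in> carrier K" "b \<in> carrier K" for a b
    by (simp_all only: x that quotient_simps M.smult_closed M.smult_l_distr M.smult_assoc1 a_closed m_closed)
  fix Y assume "Y \<in> carrier ?Q"
  then obtain y where y: "y \<in> carrier M" "Y = N +>\<^bsub>M\<^esub> y" by (rule quotient_cases)
  show "X \<oplus>\<^bsub>?Q\<^esub> Y \<in> carrier ?Q" by (simp only: x y quotient_simps quotient_mem M.a_closed)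
  show "X \<oplus>\<^bsub>?Q\<^esub> Y = Y \<oplus>\<^bsub>?Q\<^esub> X" by (simp only: x y quotient_simps M.a_comm[of x y])
  show "a \<odot>\<^bsub>?Q\<^esub> (X \<oplus>\<^bsub>?Q\<^esub> Y) = a \<odot>\<^bsub>?Q\<^esub> X \<oplus>\<^bsub>?Q\<^esub> a \<odot>\<^bsub>?Q\<^esub> Y" if "a \<in> carrier K" for a
    by (simp only: x y that quotient_simps M.a_closed M.smult_closed M.smult_r_distr)
  fix Z assume "Z \<in> carrier ?Q"
  then obtain z where z: "z \<in> carrier M" "Z = N +>\<^bsub>M\<^esub> z" by (rule quotient_cases)
  show "X \<oplus>\<^bsub>?Q\<^esub> Y \<oplus>\<^bsub>?Q\<^esub> Z = X \<oplus>\<^bsub>?Q\<^esub> (Y \<oplus>\<^bsub>?Q\<^esub> Z)"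
    by (simp only: x y z quotient_simps M.a_closed M.a_assoc)
qed

lemma quotient_proj: "(\<lambda>x. N +>\<^bsub>M\<^esub> x) \<in> lin M (quotient_module M N)"
  by (rule linI) (auto simp: quotient_carrier quotient_simps)

text \<open>Two representatives of a coset differ by an element of \<open>N\<close>, on which
  \<open>f\<close> vanishes; the image of the coset is therefore a singleton and
  \<open>the_elem\<close> is meaningful.\<close>

lemma quotient_lift:
  assumes "f \<in> lin M U" "module K U" "\<And>x. x \<in> N \<Longrightarrow> f x = \<zero>\<^bsub>U\<^esub>" "x \<in> carrier M"
  shows "the_elem (f ` (N +>\<^bsub>M\<^esub> x)) = f x"
proof -
  interpret U: module K U by fact
  have "f y = f x" if y: "y \<in> N +>\<^bsub>M\<^esub> x" for y
  proof -
    have yM: "y \<in> carrier M" using N.a_elemrcos_carrier assms(4) y by auto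
    have "y \<ominus>\<^bsub>M\<^esub> x \<in> N" using N.a_rcos_module_imp[OF assms(4) y] by (simp add: a_minus_def)
    then have "f y \<ominus>\<^bsub>U\<^esub> f x = \<zero>\<^bsub>U\<^esub>"
      using assms yM by (simp add: lin_diff[OF assms(1) M assms(2), symmetric])
    then show ?thesis
      using lin_closed[OF assms(1)] assms(4) yM
      by (metis U.add.inv_closed U.add.inv_inv U.minus_equality a_minus_def)
  qed
  then have "f ` (N +>\<^bsub>M\<^esub> x) = (\<lambda>_. f x) ` (N +>\<^bsub>M\<^esub> x)"
    by (rule image_cong[OF refl])
  also have "\<dots> = {f x}" using N.a_rcos_self[OF assms(4)] by (rule image_constant)
  finally show ?thesis by simp
qed

lemma quotient_lift_lin:
  assumes "f \<in> lin M U" "module K U" "\<And>x. x \<in> N \<Longrightarrow> f x = \<zero>\<^bsub>U\<^esub>"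
  shows "(\<lambda>X. the_elem (f ` X)) \<in> lin (quotient_module M N) U"
proof (rule linI)
  let ?Q = "quotient_module M N"
  fix X assume "X \<in> carrier ?Q"
  then obtain x where x: "x \<in> carrier M" "X = N +>\<^bsub>M\<^esub> x" by (rule quotient_cases)
  show "the_elem (f ` X) \<in> carrier U"
    by (simp only: x quotient_lift[OF assms] lin_closed[OF assms(1)])
  show "the_elem (f ` (a \<odot>\<^bsub>?Q\<^esub> X)) = a \<odot>\<^bsub>U\<^esub> the_elem (f ` X)" if "a \<in> carrier K" for a
    by (simp only: x that quotient_simps quotient_lift[OF assms] lin_smult[OF assms(1)] M.smult_closed)
  fix Y assume "Y \<in> carrier ?Q"
  then obtain y where y: "y \<in> carrier M" "Y = N +>\<^bsub>M\<^esub> y" by (rule quotient_cases)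
  show "the_elem (f ` (X \<oplus>\<^bsub>?Q\<^esub> Y)) = the_elem (f ` X) \<oplus>\<^bsub>U\<^esub> the_elem (f ` Y)"
    by (simp only: x y quotient_simps quotient_lift[OF assms] lin_add[OF assms(1)] M.a_closed)
qed

end

end

section \<open>Tensor products of modules\<close>

context base_ring
begin

abbreviation tens (infixl \<open>\<boxtimes>\<close> 75) where "V \<boxtimes> W \<equiv> tensor K V W"
abbreviation pt where "pt \<equiv> pure_tensor K"
abbreviation tlift where "tlift \<equiv> tensor_lift K"
abbreviation tmap where "tmap \<equiv> tensor_map K"

text \<open>The module axioms never look at \<open>mult\<close>, \<open>one\<close> or record
  extensions. This transfers them to \<open>tensor\<close>, \<open>polys\<close> and
  \<open>quotient_algebra\<close>, which override exactly those fields.\<close>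

lemma module_cong:
  assumes "module K M" "carrier M' = carrier M" "add M' = add M" "zero M' = zero M" "smult M' = smult M"
  shows "module K M'"
proof (intro moduleI abelian_groupI)
  interpret M: module K M by fact
  show "cring K" by (rule is_cring)
  fix x assume x: "x \<in> carrier M'"
  then show "\<exists>y\<in>carrier M'. y \<oplus>\<^bsub>M'\<^esub> x = \<zero>\<^bsub>M'\<^esub>"
    by (intro bexI[of _ "\<ominus>\<^bsub>M\<^esub> x"]) (simp_all add: assms M.l_neg)
  fix y assume y: "y \<in> carrier M'"
  show "x \<oplus>\<^bsub>M'\<^esub> y = y \<oplus>\<^bsub>M'\<^esub> x" using x y by (simp add: assms M.a_comm[of x y])
qed (simp_all add: assms(2-5) module_closed[OF assms(1)] module_simps[OF assms(1)]
       abelian_groupE(3)[OF module.axioms(2)[OF assms(1)]])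

definition bil where
  "bil V W U f \<longleftrightarrow> (\<forall>v\<in>carrier V. f v \<in> lin W U) \<and> (\<forall>w\<in>carrier W. (\<lambda>v. f v w) \<in> lin V U)"

lemma bilD: "bil V W U f \<Longrightarrow> v \<in> carrier V \<Longrightarrow> f v \<in> lin W U"
  "bil V W U f \<Longrightarrow> w \<in> carrier W \<Longrightarrow> (\<lambda>v. f v w) \<in> lin V U"
  unfolding bil_def by auto

lemma bilI:
  assumes "\<And>v. v \<in> carrier V \<Longrightarrow> f v \<in> lin W U" "\<And>w. w \<in> carrier W \<Longrightarrow> (\<lambda>v. f v w) \<in> lin V U"
  shows "bil V W U f"
  using assms unfolding bil_def by auto

lemma bil_closed: "bil V W U f \<Longrightarrow> v \<in> carrier V \<Longrightarrow> w \<in> carrier W \<Longrightarrow> f v w \<in> carrier U"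
  by (rule lin_closed[OF bilD(1)])

lemma bil_post: "bil V W U f \<Longrightarrow> g \<in> lin U X \<Longrightarrow> bil V W X (\<lambda>v w. g (f v w))"
  by (rule bilI; rule lin_comp[OF _ bilD(1)] lin_comp[OF _ bilD(2)]; assumption)

lemma bil_pre:
  assumes "bil V W U b" "f \<in> lin V' V" "g \<in> lin W' W"
  shows "bil V' W' U (\<lambda>v w. b (f v) (g w))"
  by (rule bilI lin_comp[OF bilD(1)[OF assms(1) lin_closed[OF assms(2)]] assms(3)]
      lin_comp[OF bilD(2)[OF assms(1) lin_closed[OF assms(3)]] assms(2)] | assumption)+

lemma bil_flip: "bil V W U f \<Longrightarrow> bil W V U (\<lambda>w v. f v w)"
  unfolding bil_def by auto

lemma bil_smult: "module K V \<Longrightarrow> bil (base_algebra K) V V (smult V)"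
  by (rule bilI; rule linI)
    (simp_all add: base_algebra_def module_closed module_simps m_comm flip: module_simps(8))

lemma tensor_simps:
  "carrier (V \<boxtimes> W) = carrier (tensor_space K V W)" "add (V \<boxtimes> W) = add (tensor_space K V W)"
  "zero (V \<boxtimes> W) = zero (tensor_space K V W)" "smult (V \<boxtimes> W) = smult (tensor_space K V W)"
  by (simp_all add: tensor_def)

text \<open>\<open>tensor_op\<close> is defined with values in \<open>tensor_space\<close>, all else
  uses \<open>tensor\<close>. Linearity and sums cannot tell the two apart, which this lemma and the
  next one record.\<close>

lemma lin_tensor_space: "lin (tensor_space K V W) U = lin (V \<boxtimes> W) U" "lin U (tensor_space K V W) = lin U (V \<boxtimes> W)"
  by (simp_all add: linear_maps_def tensor_simps)

lemma tlift_tensor_space: "tlift V W (tensor_space K V' W') = tlift V W (V' \<boxtimes> W')"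
  by (intro ext) (simp add: tensor_lift_def finsum_def tensor_simps)

context
  fixes V :: "('a, 'v, 'r) module_scheme" and W :: "('a, 'w, 's) module_scheme"
  assumes V: "module K V" and W: "module K W"
begin

interpretation V: module K V by (rule V)
interpretation W: module K W by (rule W)

private abbreviation "F \<equiv> FM (carrier V \<times> carrier W)"
private abbreviation "N \<equiv> tensor_kernel K V W"
private abbreviation "gen v w \<equiv> free_gen K (v, w)"

interpretation F: module K F by (rule free_mod)

private lemma gen_closed: "v \<in> carrier V \<Longrightarrow> w \<in> carrier W \<Longrightarrow> gen v w \<in> carrier F"
  by (simp add: free_gen_closed)

private lemma tensor_relators_closed: "tensor_relators K V W \<subseteq> carrier F"
  unfolding tensor_relators_def Let_def
  by (intro Un_least; safe) (simp_all add: gen_closed)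

text \<open>An intersection of submodules is a submodule; the family intersected is nonempty because
  the whole free module contains the relators.\<close>

lemma tensor_kernel_submodule: "submodule N K F"
proof (rule F.submoduleI)
  have *: "N = \<Inter>{S. submodule S K F \<and> tensor_relators K V W \<subseteq> S}"
    by (simp add: tensor_kernel_def hull_def)
  show "N \<subseteq> carrier F"
    unfolding * using F.carrier_is_submodule tensor_relators_closed by blast
  show "\<zero>\<^bsub>F\<^esub> \<in> N" unfolding *
    by (metis (no_types, lifting) CollectD F.module_axioms InterI submodule_abelian_subgroup
        abelian_subgroup.axioms(1) additive_subgroup.zero_closed)
qed (auto simp: tensor_kernel_def hull_def dest: F.submoduleE)

lemma tensor_mod: "module K (V \<boxtimes> W)"
  by (rule module_cong[OF quotient_mod[OF free_mod tensor_kernel_submodule]])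
    (simp_all add: tensor_simps tensor_space_def)

private lemma pt_eq: "pt V W v w = N +>\<^bsub>F\<^esub> gen v w"
  by (simp add: pure_tensor_def)

private lemma proj_lin: "(\<lambda>x. N +>\<^bsub>F\<^esub> x) \<in> lin F (V \<boxtimes> W)"
  using quotient_proj[OF free_mod tensor_kernel_submodule]
  by (simp add: lin_tensor_space[symmetric] tensor_space_def)

private lemma relator: "x \<in> tensor_relators K V W \<Longrightarrow> x \<in> N"
  unfolding tensor_kernel_def by (rule hull_inc)

text \<open>Each of the four bilinearity laws is the vanishing of one of the four families of
  relators in the quotient.\<close>

lemma pt_bil: "bil V W (V \<boxtimes> W) (pt V W)"
proof (intro bilI linI)
  note eqI = coset_eq_iff[OF free_mod tensor_kernel_submodule, THEN iffD2]
  fix v w assume v: "v \<in> carrier V" and w: "w \<in> carrier W"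
  show cl: "pt V W v w \<in> carrier (V \<boxtimes> W)" "pt V W v w \<in> carrier (V \<boxtimes> W)"
    using lin_closed[OF proj_lin] v w by (simp_all add: pt_eq gen_closed)
  show "pt V W v (w \<oplus>\<^bsub>W\<^esub> w') = pt V W v w \<oplus>\<^bsub>V \<boxtimes> W\<^esub> pt V W v w'" if w': "w' \<in> carrier W" for w'
  proof -
    have "pt V W v (w \<oplus>\<^bsub>W\<^esub> w') = N +>\<^bsub>F\<^esub> (gen v w \<oplus>\<^bsub>F\<^esub> gen v w')"
      unfolding pt_eq using v w w'
      by (intro eqI relator) (simp_all add: gen_closed tensor_relators_def Let_def, blast)
    then show ?thesis using v w w' by (simp add: pt_eq lin_add[OF proj_lin] gen_closed)
  qed
  show "pt V W (v \<oplus>\<^bsub>V\<^esub> v') w = pt V W v w \<oplus>\<^bsub>V \<boxtimes> W\<^esub> pt V W v' w" if v': "v' \<in> carrier V" for v'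
  proof -
    have "pt V W (v \<oplus>\<^bsub>V\<^esub> v') w = N +>\<^bsub>F\<^esub> (gen v w \<oplus>\<^bsub>F\<^esub> gen v' w)"
      unfolding pt_eq using v w v'
      by (intro eqI relator) (simp_all add: gen_closed tensor_relators_def Let_def, blast)
    then show ?thesis using v w v' by (simp add: pt_eq lin_add[OF proj_lin] gen_closed)
  qed
  fix a assume a: "a \<in> carrier K"
  have "pt V W v (a \<odot>\<^bsub>W\<^esub> w) = N +>\<^bsub>F\<^esub> (a \<odot>\<^bsub>F\<^esub> gen v w)"
    unfolding pt_eq using v w a
    by (intro eqI relator) (simp_all add: gen_closed tensor_relators_def Let_def, blast)
  then show "pt V W v (a \<odot>\<^bsub>W\<^esub> w) = a \<odot>\<^bsub>V \<boxtimes> W\<^esub> pt V W v w"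
    using v w a by (simp add: pt_eq lin_smult[OF proj_lin] gen_closed)
  have "pt V W (a \<odot>\<^bsub>V\<^esub> v) w = N +>\<^bsub>F\<^esub> (a \<odot>\<^bsub>F\<^esub> gen v w)"
    unfolding pt_eq using v w a
    by (intro eqI relator) (simp_all add: gen_closed tensor_relators_def Let_def, blast)
  then show "pt V W (a \<odot>\<^bsub>V\<^esub> v) w = a \<odot>\<^bsub>V \<boxtimes> W\<^esub> pt V W v w"
    using v w a by (simp add: pt_eq lin_smult[OF proj_lin] gen_closed)
qed

lemma pt_closed: "v \<in> carrier V \<Longrightarrow> w \<in> carrier W \<Longrightarrow> pt V W v w \<in> carrier (V \<boxtimes> W)"
  by (rule bil_closed[OF pt_bil])

context
  fixes U :: "('a, 'u, 't) module_scheme" and f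
  assumes U: "module K U" and f: "bil V W U f"
begin

interpretation U: module K U by (rule U)

private abbreviation "L \<equiv> free_lift U (\<lambda>p. f (fst p) (snd p))"

private lemma tlift_eq: "tlift V W U f = (\<lambda>X. the_elem (L ` X))"
  by (intro ext) (simp add: tensor_lift_def free_lift_def)

private lemma L_lin: "L \<in> lin F U"
  by (rule free_lift_lin[OF U]) (auto intro: bil_closed[OF f])

private lemma L_gen: "v \<in> carrier V \<Longrightarrow> w \<in> carrier W \<Longrightarrow> L (gen v w) = f v w"
  by (subst free_lift_gen[OF U]) (auto intro: bil_closed[OF f])

text \<open>Bilinearity of \<open>f\<close> says that the linear extension \<open>L\<close> kills
  every relator. Its kernel is a submodule, hence contains the hull.\<close>

private lemma L_kernel:
  assumes "x \<in> N" shows "L x = \<zero>\<^bsub>U\<^esub>"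
proof -
  have zero: "x \<in> carrier F \<Longrightarrow> y \<in> carrier F \<Longrightarrow> L x = L y \<Longrightarrow> L (x \<ominus>\<^bsub>F\<^esub> y) = \<zero>\<^bsub>U\<^esub>" for x y
    using lin_closed[OF L_lin] by (simp only: lin_diff[OF L_lin free_mod U] a_minus_def[of U] U.r_neg)
  have "tensor_relators K V W \<subseteq> {x \<in> carrier F. L x = \<zero>\<^bsub>U\<^esub>}"
    unfolding tensor_relators_def Let_def
    by (intro Un_least; safe; (rule zero)?)
      (simp_all add: gen_closed lin_add[OF L_lin] lin_smult[OF L_lin] L_gen
        lin_add[OF bilD(1)[OF f]] lin_smult[OF bilD(1)[OF f]]
        lin_add[OF bilD(2)[OF f]] lin_smult[OF bilD(2)[OF f]])
  then have "N \<subseteq> {x \<in> carrier F. L x = \<zero>\<^bsub>U\<^esub>}"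
    unfolding tensor_kernel_def by (rule hull_minimal) (rule submodule_kernel[OF L_lin free_mod U])
  then show ?thesis using assms by auto
qed

lemma tlift_lin: "tlift V W U f \<in> lin (V \<boxtimes> W) U"
  unfolding tlift_eq
  using quotient_lift_lin[OF free_mod tensor_kernel_submodule L_lin U L_kernel]
  by (simp add: lin_tensor_space[symmetric] tensor_space_def)

lemma tlift_pt: "v \<in> carrier V \<Longrightarrow> w \<in> carrier W \<Longrightarrow> tlift V W U f (pt V W v w) = f v w"
  unfolding tlift_eq pt_eq
  by (subst quotient_lift[OF free_mod tensor_kernel_submodule L_lin U L_kernel])
    (simp_all add: gen_closed L_gen)

end

text \<open>Uniqueness in the universal property: a coset has a representative that is a combination
  of generators, and these project to pure tensors. Most identities below are proved by this
  rule.\<close>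

lemma tensor_eqI:
  assumes "f \<in> lin (V \<boxtimes> W) U" "g \<in> lin (V \<boxtimes> W) U" "module K U"
    and eq: "\<And>v w. v \<in> carrier V \<Longrightarrow> w \<in> carrier W \<Longrightarrow> f (pt V W v w) = g (pt V W v w)"
    and "t \<in> carrier (V \<boxtimes> W)"
  shows "f t = g t"
proof -
  have "t \<in> carrier (quotient_module F N)" using assms(5) by (simp add: tensor_simps tensor_space_def)
  then obtain x where x: "x \<in> carrier F" "t = N +>\<^bsub>F\<^esub> x"
    by (rule quotient_cases[OF free_mod tensor_kernel_submodule])
  have "f (N +>\<^bsub>F\<^esub> x) = g (N +>\<^bsub>F\<^esub> x)"
    by (rule free_eqI[OF lin_comp[OF assms(1) proj_lin] lin_comp[OF assms(2) proj_lin] assms(3) _ x(1)])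
      (auto simp: pt_eq[symmetric] eq)
  then show ?thesis using x by simp
qed

end

text \<open>Nested lifts, as in \<open>tensor_op\<close> and \<open>tensor_assoc\<close>, require
  the inner lift to depend linearly on a parameter. Both sides of that claim are linear in
  \<open>t\<close>, so it reduces to pure tensors, where it is the hypothesis
  \<open>lin\<close>.\<close>

lemma tlift_param:
  assumes V: "module K V" and W: "module K W" and U: "module K U"
    and bil: "\<And>y. y \<in> carrier Y \<Longrightarrow> bil V W U (f y)"
    and lin: "\<And>v w. v \<in> carrier V \<Longrightarrow> w \<in> carrier W \<Longrightarrow> (\<lambda>y. f y v w) \<in> lin Y U"
    and Y: "module K Y" and t: "t \<in> carrier (V \<boxtimes> W)"
  shows "(\<lambda>y. tlift V W U (f y) t) \<in> lin Y U"
proof (rule linI)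
  fix y assume y: "y \<in> carrier Y"
  show "tlift V W U (f y) t \<in> carrier U"
    using lin_closed[OF tlift_lin[OF V W U bil[OF y]] t] .
  fix y' assume y': "y' \<in> carrier Y"
  have yy: "y \<oplus>\<^bsub>Y\<^esub> y' \<in> carrier Y" by (rule module_closed(2)[OF Y y y'])
  show "tlift V W U (f (y \<oplus>\<^bsub>Y\<^esub> y')) t = tlift V W U (f y) t \<oplus>\<^bsub>U\<^esub> tlift V W U (f y') t"
    by (rule tensor_eqI[OF V W tlift_lin[OF V W U bil[OF yy]]
        lin_plus[OF tlift_lin[OF V W U bil[OF y]] tlift_lin[OF V W U bil[OF y']] U] U _ t])
      (simp add: tlift_pt[OF V W U] bil y y' yy lin_add[OF lin])
next
  fix a y assume a: "a \<in> carrier K" and y: "y \<in> carrier Y"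
  have ay: "a \<odot>\<^bsub>Y\<^esub> y \<in> carrier Y" by (rule module_closed(4)[OF Y a y])
  show "tlift V W U (f (a \<odot>\<^bsub>Y\<^esub> y)) t = a \<odot>\<^bsub>U\<^esub> tlift V W U (f y) t"
    by (rule tensor_eqI[OF V W tlift_lin[OF V W U bil[OF ay]]
        lin_scale[OF tlift_lin[OF V W U bil[OF y]] a U] U _ t])
      (simp add: tlift_pt[OF V W U] bil y ay a lin_smult[OF lin])
qed

lemma tlift_cong:
  assumes V: "module K V" and W: "module K W" and U: "module K U"
    and f: "bil V W U f"
    and eq: "\<And>v w. v \<in> carrier V \<Longrightarrow> w \<in> carrier W \<Longrightarrow> f v w = g v w"
    and t: "t \<in> carrier (V \<boxtimes> W)"
  shows "tlift V W U f t = tlift V W U g t"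
proof -
  have "bil V W U g"
    using eq
    by (intro bilI lin_cong[OF bilD(1)[OF f] W] lin_cong[OF bilD(2)[OF f] V]) auto
  then show ?thesis
    by (intro tensor_eqI[OF V W tlift_lin[OF V W U f] tlift_lin[OF V W U] U _ t])
      (simp_all add: tlift_pt[OF V W U] f eq)
qed

end

section \<open>Tensor products of commutative algebras\<close>

context base_ring
begin

abbreviation op where "op \<equiv> tensor_op K"
abbreviation alg where "alg \<equiv> algebra K"
abbreviation alghom where "alghom \<equiv> algebra_hom K"
abbreviation tassoc where "tassoc \<equiv> tensor_assoc K"

text \<open>The form of \<open>tensor_eqI\<close> used for multiplicativity: the two tensor
  arguments are replaced by pure tensors one after the other.\<close>

lemma tensor_eqI2:
  assumes "module K V" "module K W" "module K V'" "module K W'" "module K U"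
    and f: "bil (V \<boxtimes> W) (V' \<boxtimes> W') U f" and g: "bil (V \<boxtimes> W) (V' \<boxtimes> W') U g"
    and eq: "\<And>v w v' w'. v \<in> carrier V \<Longrightarrow> w \<in> carrier W \<Longrightarrow> v' \<in> carrier V' \<Longrightarrow> w' \<in> carrier W' \<Longrightarrow>
      f (pt V W v w) (pt V' W' v' w') = g (pt V W v w) (pt V' W' v' w')"
    and s: "s \<in> carrier (V \<boxtimes> W)" and t: "t \<in> carrier (V' \<boxtimes> W')"
  shows "f s t = g s t"
proof (rule tensor_eqI[OF assms(1,2) bilD(2)[OF f t] bilD(2)[OF g t] assms(5) _ s])
  fix v w assume vw: "v \<in> carrier V" "w \<in> carrier W"
  show "f (pt V W v w) t = g (pt V W v w) t"
    by (rule tensor_eqI[OF assms(3,4) bilD(1)[OF f] bilD(1)[OF g] assms(5) eq[OF vw] t])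
      (simp_all add: pt_closed assms vw)
qed

context
  fixes V :: "('a, 'v, 'r) module_scheme" and W :: "('a, 'w, 's) module_scheme" and b d
  assumes V: "module K V" and W: "module K W" and b: "bil V V V b" and d: "bil W W W d"
begin

private lemma op_eq: "op V W b d s t =
  tlift V W (V \<boxtimes> W) (\<lambda>v w. tlift V W (V \<boxtimes> W) (\<lambda>v' w'. pt V W (b v v') (d w w')) t) s"
  by (simp add: tensor_op_def tlift_tensor_space)

private lemma op_inner: "v \<in> carrier V \<Longrightarrow> w \<in> carrier W \<Longrightarrow>
    bil V W (V \<boxtimes> W) (\<lambda>v' w'. pt V W (b v v') (d w w'))"
  by (rule bil_pre[OF pt_bil[OF V W] bilD(1)[OF b] bilD(1)[OF d]])

private lemma op_outer:
  assumes t: "t \<in> carrier (V \<boxtimes> W)"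
  shows "bil V W (V \<boxtimes> W) (\<lambda>v w. tlift V W (V \<boxtimes> W) (\<lambda>v' w'. pt V W (b v v') (d w w')) t)"
proof (rule bilI)
  fix v assume v: "v \<in> carrier V"
  show "(\<lambda>w. tlift V W (V \<boxtimes> W) (\<lambda>v' w'. pt V W (b v v') (d w w')) t) \<in> lin W (V \<boxtimes> W)"
    by (rule tlift_param[OF V W tensor_mod[OF V W] op_inner[OF v]
          lin_comp[OF bilD(1)[OF pt_bil[OF V W] bil_closed[OF b v]] bilD(2)[OF d]] W t])
next
  fix w assume w: "w \<in> carrier W"
  show "(\<lambda>v. tlift V W (V \<boxtimes> W) (\<lambda>v' w'. pt V W (b v v') (d w w')) t) \<in> lin V (V \<boxtimes> W)"
    by (rule tlift_param[OF V W tensor_mod[OF V W] op_inner[OF _ w]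
          lin_comp[OF bilD(2)[OF pt_bil[OF V W] bil_closed[OF d w]] bilD(2)[OF b]] V t])
qed

lemma op_bil: "bil (V \<boxtimes> W) (V \<boxtimes> W) (V \<boxtimes> W) (op V W b d)"
proof (rule bilI)
  fix t assume t: "t \<in> carrier (V \<boxtimes> W)"
  show "(\<lambda>s. op V W b d s t) \<in> lin (V \<boxtimes> W) (V \<boxtimes> W)"
    unfolding op_eq by (rule tlift_lin[OF V W tensor_mod[OF V W] op_outer[OF t]])
  show "op V W b d t \<in> lin (V \<boxtimes> W) (V \<boxtimes> W)"
    unfolding op_eq
    by (rule tlift_param[OF V W tensor_mod[OF V W] op_outer
          tlift_lin[OF V W tensor_mod[OF V W] op_inner] tensor_mod[OF V W] t])
qed

lemma op_pt:
  assumes "v \<in> carrier V" "w \<in> carrier W" "v' \<in> carrier V" "w' \<in> carrier W"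
  shows "op V W b d (pt V W v w) (pt V W v' w') = pt V W (b v v') (d w w')"
  using assms
  by (simp add: op_eq tlift_pt[OF V W tensor_mod[OF V W]] op_outer op_inner pt_closed[OF V W])

end

context
  fixes V :: "('a, 'v, 'r) module_scheme" and W :: "('a, 'w, 's) module_scheme"
    and V' :: "('a, 'v2, 'r2) module_scheme" and W' :: "('a, 'w2, 's2) module_scheme" and f g
  assumes V: "module K V" and W: "module K W" and V': "module K V'" and W': "module K W'"
    and f: "f \<in> lin V V'" and g: "g \<in> lin W W'"
begin

lemma tmap_lin: "tmap V W V' W' f g \<in> lin (V \<boxtimes> W) (V' \<boxtimes> W')"
  unfolding tensor_map_def
  by (rule tlift_lin[OF V W tensor_mod[OF V' W'] bil_pre[OF pt_bil[OF V' W'] f g]])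

lemma tmap_pt: "v \<in> carrier V \<Longrightarrow> w \<in> carrier W \<Longrightarrow> tmap V W V' W' f g (pt V W v w) = pt V' W' (f v) (g w)"
  unfolding tensor_map_def
  by (rule tlift_pt[OF V W tensor_mod[OF V' W'] bil_pre[OF pt_bil[OF V' W'] f g]])

lemma tmap_cong:
  assumes "\<And>v. v \<in> carrier V \<Longrightarrow> f v = f' v" "\<And>w. w \<in> carrier W \<Longrightarrow> g w = g' w" "t \<in> carrier (V \<boxtimes> W)"
  shows "tmap V W V' W' f g t = tmap V W V' W' f' g' t"
  unfolding tensor_map_def
  by (rule tlift_cong[OF V W tensor_mod[OF V' W'] bil_pre[OF pt_bil[OF V' W'] f g] _ assms(3)])
    (simp add: assms)

text \<open>Stated for arbitrary bilinear operations on the factors, so that one proof serves the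
  product and the bracket of a Poisson algebra.\<close>

lemma tmap_op:
  assumes b: "bil V V V b" "bil V' V' V' b'" and d: "bil W W W d" "bil W' W' W' d'"
    and fb: "\<And>x y. x \<in> carrier V \<Longrightarrow> y \<in> carrier V \<Longrightarrow> f (b x y) = b' (f x) (f y)"
    and gd: "\<And>x y. x \<in> carrier W \<Longrightarrow> y \<in> carrier W \<Longrightarrow> g (d x y) = d' (g x) (g y)"
    and s: "s \<in> carrier (V \<boxtimes> W)" and t: "t \<in> carrier (V \<boxtimes> W)"
  shows "tmap V W V' W' f g (op V W b d s t) = op V' W' b' d' (tmap V W V' W' f g s) (tmap V W V' W' f g t)"
  by (rule tensor_eqI2[OF V W V W tensor_mod[OF V' W'] bil_post[OF op_bil[OF V W b(1) d(1)] tmap_lin]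
        bil_pre[OF op_bil[OF V' W' b(2) d(2)] tmap_lin tmap_lin] _ s t])
    (simp add: op_pt[OF V W b(1) d(1)] op_pt[OF V' W' b(2) d(2)] tmap_pt fb gd
      bil_closed[OF b(1)] bil_closed[OF d(1)] lin_closed[OF f] lin_closed[OF g])

end

lemma tmap_comp:
  assumes "module K V" "module K W" "module K V'" "module K W'" "module K V''" "module K W''"
    and "f \<in> lin V V'" "g \<in> lin W W'" "f' \<in> lin V' V''" "g' \<in> lin W' W''" "t \<in> carrier (V \<boxtimes> W)"
  shows "tmap V' W' V'' W'' f' g' (tmap V W V' W' f g t) = tmap V W V'' W'' (\<lambda>x. f' (f x)) (\<lambda>x. g' (g x)) t"
  by (rule tensor_eqI[OF assms(1,2) lin_comp[OF tmap_lin[OF assms(3-6,9,10)] tmap_lin[OF assms(1-4,7,8)]]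
        tmap_lin[OF assms(1,2,5,6) lin_comp[OF assms(9,7)] lin_comp[OF assms(10,8)]] tensor_mod[OF assms(5,6)] _ assms(11)])
    (simp add: tmap_pt[OF assms(3-6,9,10)] tmap_pt[OF assms(1-4,7,8)]
      tmap_pt[OF assms(1,2,5,6) lin_comp[OF assms(9,7)] lin_comp[OF assms(10,8)]]
      lin_closed[OF assms(7)] lin_closed[OF assms(8)])

lemma tmap_id:
  assumes "module K V" "module K W" "t \<in> carrier (V \<boxtimes> W)"
  shows "tmap V W V W (\<lambda>x. x) (\<lambda>x. x) t = t"
  by (rule tensor_eqI[OF assms(1,2) tmap_lin[OF assms(1,2,1,2) lin_id(1) lin_id(1)] lin_id(1)
        tensor_mod[OF assms(1,2)] _ assms(3)])
    (simp add: tmap_pt[OF assms(1,2,1,2) lin_id(1) lin_id(1)])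

context
  fixes U :: "('a, 'u, 'q) module_scheme" and V :: "('a, 'v, 'r) module_scheme"
    and W :: "('a, 'w, 's) module_scheme"
  assumes U: "module K U" and V: "module K V" and W: "module K W"
begin


private lemma tassoc_inner: "w \<in> carrier W \<Longrightarrow> bil U V (U \<boxtimes> (V \<boxtimes> W)) (\<lambda>u v. pt U (V \<boxtimes> W) u (pt V W v w))"
  by (rule bilI lin_comp[OF bilD(1)[OF pt_bil[OF U tensor_mod[OF V W]]] bilD(2)[OF pt_bil[OF V W]]]
      bilD(2)[OF pt_bil[OF U tensor_mod[OF V W]]] pt_closed[OF V W] | assumption)+

private lemma tassoc_bil: "bil (U \<boxtimes> V) W (U \<boxtimes> (V \<boxtimes> W)) (\<lambda>t w. tlift U V (U \<boxtimes> (V \<boxtimes> W))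
          (\<lambda>u v. pt U (V \<boxtimes> W) u (pt V W v w)) t)"
proof (rule bilI)
  fix t assume t: "t \<in> carrier (U \<boxtimes> V)"
  show "(\<lambda>w. tlift U V (U \<boxtimes> (V \<boxtimes> W)) (\<lambda>u v. pt U (V \<boxtimes> W) u (pt V W v w)) t) \<in> lin W (U \<boxtimes> (V \<boxtimes> W))"
    by (rule tlift_param[OF U V tensor_mod[OF U tensor_mod[OF V W]] tassoc_inner
          lin_comp[OF bilD(1)[OF pt_bil[OF U tensor_mod[OF V W]]] bilD(1)[OF pt_bil[OF V W]]] W t])
qed (rule tlift_lin[OF U V tensor_mod[OF U tensor_mod[OF V W]] tassoc_inner])

lemma tassoc_lin: "tassoc U V W \<in> lin (U \<boxtimes> V \<boxtimes> W) (U \<boxtimes> (V \<boxtimes> W))"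
  unfolding tensor_assoc_def Let_def
  by (rule tlift_lin[OF tensor_mod[OF U V] W tensor_mod[OF U tensor_mod[OF V W]] tassoc_bil])

lemma tassoc_pt: "u \<in> carrier U \<Longrightarrow> v \<in> carrier V \<Longrightarrow> w \<in> carrier W \<Longrightarrow>
    tassoc U V W (pt (U \<boxtimes> V) W (pt U V u v) w) = pt U (V \<boxtimes> W) u (pt V W v w)"
  unfolding tensor_assoc_def Let_def
  by (simp add: tlift_pt[OF tensor_mod[OF U V] W tensor_mod[OF U tensor_mod[OF V W]] tassoc_bil]
      tlift_pt[OF U V tensor_mod[OF U tensor_mod[OF V W]] tassoc_inner] pt_closed[OF U V])

end

section \<open>Commutative algebras and their homomorphisms\<close>

lemma alg_mod: "alg A \<Longrightarrow> module K A"
  by (rule algebra.module)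

text \<open>The algebra axioms move scalars out of the left factor only; commutativity gives the
  right factor.\<close>

lemma alg_bil: assumes "alg A" shows "bil A A A (mult A)"
proof -
  interpret A: algebra K A by fact
  have "x \<in> carrier A \<Longrightarrow> y \<in> carrier A \<Longrightarrow> a \<in> carrier K \<Longrightarrow> x \<otimes>\<^bsub>A\<^esub> (a \<odot>\<^bsub>A\<^esub> y) = a \<odot>\<^bsub>A\<^esub> (x \<otimes>\<^bsub>A\<^esub> y)" for a x y
    by (metis A.smult_assoc2 A.smult_closed A.m_comm)
  then show ?thesis
    by (intro bilI linI) (simp_all add: A.l_distr A.r_distr A.smult_assoc2)
qed

lemma alg_simps:
  assumes "alg A"
  shows "\<one>\<^bsub>A\<^esub> \<in> carrier A"
    and "x \<in> carrier A \<Longrightarrow> y \<in> carrier A \<Longrightarrow> x \<otimes>\<^bsub>A\<^esub> y \<in> carrier A"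
    and "x \<in> carrier A \<Longrightarrow> \<one>\<^bsub>A\<^esub> \<otimes>\<^bsub>A\<^esub> x = x"
    and "x \<in> carrier A \<Longrightarrow> x \<otimes>\<^bsub>A\<^esub> \<one>\<^bsub>A\<^esub> = x"
    and "x \<in> carrier A \<Longrightarrow> y \<in> carrier A \<Longrightarrow> z \<in> carrier A \<Longrightarrow> x \<otimes>\<^bsub>A\<^esub> y \<otimes>\<^bsub>A\<^esub> z = x \<otimes>\<^bsub>A\<^esub> (y \<otimes>\<^bsub>A\<^esub> z)"
    and "x \<in> carrier A \<Longrightarrow> y \<in> carrier A \<Longrightarrow> z \<in> carrier A \<Longrightarrow> x \<otimes>\<^bsub>A\<^esub> (y \<otimes>\<^bsub>A\<^esub> z) = y \<otimes>\<^bsub>A\<^esub> (x \<otimes>\<^bsub>A\<^esub> z)"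
proof -
  interpret A: algebra K A by fact
  show "\<one>\<^bsub>A\<^esub> \<in> carrier A"
    and "x \<in> carrier A \<Longrightarrow> y \<in> carrier A \<Longrightarrow> x \<otimes>\<^bsub>A\<^esub> y \<in> carrier A"
    and "x \<in> carrier A \<Longrightarrow> \<one>\<^bsub>A\<^esub> \<otimes>\<^bsub>A\<^esub> x = x"
    and "x \<in> carrier A \<Longrightarrow> x \<otimes>\<^bsub>A\<^esub> \<one>\<^bsub>A\<^esub> = x" by simp_all
  show "x \<in> carrier A \<Longrightarrow> y \<in> carrier A \<Longrightarrow> z \<in> carrier A \<Longrightarrow> x \<otimes>\<^bsub>A\<^esub> y \<otimes>\<^bsub>A\<^esub> z = x \<otimes>\<^bsub>A\<^esub> (y \<otimes>\<^bsub>A\<^esub> z)"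
    by (rule A.m_assoc)
  show "x \<in> carrier A \<Longrightarrow> y \<in> carrier A \<Longrightarrow> z \<in> carrier A \<Longrightarrow> x \<otimes>\<^bsub>A\<^esub> (y \<otimes>\<^bsub>A\<^esub> z) = y \<otimes>\<^bsub>A\<^esub> (x \<otimes>\<^bsub>A\<^esub> z)"
    by (rule A.m_lcomm)
qed

lemma alg_comm: "alg A \<Longrightarrow> x \<in> carrier A \<Longrightarrow> y \<in> carrier A \<Longrightarrow> x \<otimes>\<^bsub>A\<^esub> y = y \<otimes>\<^bsub>A\<^esub> x"
  by (simp add: algebra.M_cring comm_monoid.m_comm cring.axioms(2))

lemma algI:
  assumes "module K A" "\<one>\<^bsub>A\<^esub> \<in> carrier A"
    and lin: "\<And>y. y \<in> carrier A \<Longrightarrow> (\<lambda>x. x \<otimes>\<^bsub>A\<^esub> y) \<in> lin A A"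
    and comm: "\<And>x y. x \<in> carrier A \<Longrightarrow> y \<in> carrier A \<Longrightarrow> x \<otimes>\<^bsub>A\<^esub> y = y \<otimes>\<^bsub>A\<^esub> x"
    and assoc: "\<And>x y z. x \<in> carrier A \<Longrightarrow> y \<in> carrier A \<Longrightarrow> z \<in> carrier A \<Longrightarrow>
      x \<otimes>\<^bsub>A\<^esub> y \<otimes>\<^bsub>A\<^esub> z = x \<otimes>\<^bsub>A\<^esub> (y \<otimes>\<^bsub>A\<^esub> z)"
    and one: "\<And>x. x \<in> carrier A \<Longrightarrow> \<one>\<^bsub>A\<^esub> \<otimes>\<^bsub>A\<^esub> x = x"
  shows "alg A"
proof (rule algebraI)
  show "cring K" by (rule is_cring)
  show "cring A"
  proof (rule cringI)
    show "abelian_group A" by (rule module.axioms(2)[OF assms(1)])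
    show "comm_monoid A"
      by (rule comm_monoidI) (simp_all add: lin_closed[OF lin] assms(2) assoc one, rule comm)
  qed (rule lin_add[OF lin])
qed (simp_all add: module_closed[OF assms(1)] module_simps[OF assms(1)] lin_smult[OF lin])

lemma tensor_mult: "mult (A \<boxtimes> B) = op A B (mult A) (mult B)" "\<one>\<^bsub>A \<boxtimes> B\<^esub> = pt A B \<one>\<^bsub>A\<^esub> \<one>\<^bsub>B\<^esub>"
  by (simp_all add: tensor_def)

lemma tensor_mult_pt:
  assumes "alg A" "alg B" "a \<in> carrier A" "b \<in> carrier B" "a' \<in> carrier A" "b' \<in> carrier B"
  shows "pt A B a b \<otimes>\<^bsub>A \<boxtimes> B\<^esub> pt A B a' b' = pt A B (a \<otimes>\<^bsub>A\<^esub> a') (b \<otimes>\<^bsub>B\<^esub> b')"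
  unfolding tensor_mult by (rule op_pt[OF alg_mod alg_mod alg_bil alg_bil]) fact+

lemma tensor_mult_bil:
  assumes "alg A" "alg B" shows "bil (A \<boxtimes> B) (A \<boxtimes> B) (A \<boxtimes> B) (mult (A \<boxtimes> B))"
  unfolding tensor_mult by (rule op_bil[OF alg_mod alg_mod alg_bil alg_bil]) fact+

lemma tensor_alg:
  assumes A: "alg A" and B: "alg B"
  shows "alg (A \<boxtimes> B)"
proof (rule algI)
  let ?T = "A \<boxtimes> B"
  note mA = alg_mod[OF A] and mB = alg_mod[OF B]
  note T = tensor_mod[OF mA mB] and b = tensor_mult_bil[OF A B] and pm = tensor_mult_pt[OF A B]
  note cl = alg_simps[OF A] alg_simps[OF B] pt_closed[OF mA mB]
  show "module K ?T" by (rule T)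
  show "(\<lambda>s. s \<otimes>\<^bsub>?T\<^esub> t) \<in> lin ?T ?T" if "t \<in> carrier ?T" for t by (rule bilD(2)[OF b that])
  show one: "\<one>\<^bsub>?T\<^esub> \<in> carrier ?T" by (simp add: tensor_mult cl)
  fix s assume s: "s \<in> carrier ?T"
  show "\<one>\<^bsub>?T\<^esub> \<otimes>\<^bsub>?T\<^esub> s = s"
    by (rule tensor_eqI[OF mA mB bilD(1)[OF b one] lin_id(1) T _ s]) (simp add: tensor_mult(2) pm cl)
  fix t assume t: "t \<in> carrier ?T"
  show "s \<otimes>\<^bsub>?T\<^esub> t = t \<otimes>\<^bsub>?T\<^esub> s"
    by (rule tensor_eqI2[OF mA mB mA mB T b bil_flip[OF b] _ s t])
      (simp add: pm cl, simp only: alg_comm[OF A] alg_comm[OF B])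
  fix u assume u: "u \<in> carrier ?T"
  show "s \<otimes>\<^bsub>?T\<^esub> t \<otimes>\<^bsub>?T\<^esub> u = s \<otimes>\<^bsub>?T\<^esub> (t \<otimes>\<^bsub>?T\<^esub> u)"
  \<comment> \<open>Three tensors occur: \<open>s\<close> is made pure here, \<open>t\<close> and
    \<open>u\<close> by \<open>tensor_eqI2\<close> inside.\<close>
  proof (rule tensor_eqI[OF mA mB lin_comp[OF bilD(2)[OF b u] bilD(2)[OF b t]]
        bilD(2)[OF b bil_closed[OF b t u]] T _ s])
    fix x y assume xy: "x \<in> carrier A" "y \<in> carrier B"
    then have p: "pt A B x y \<in> carrier ?T" by (simp add: cl)
    show "pt A B x y \<otimes>\<^bsub>?T\<^esub> t \<otimes>\<^bsub>?T\<^esub> u = pt A B x y \<otimes>\<^bsub>?T\<^esub> (t \<otimes>\<^bsub>?T\<^esub> u)"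
      by (rule tensor_eqI2[OF mA mB mA mB T bil_pre[OF b bilD(1)[OF b p] lin_id(1)]
            bil_post[OF b bilD(1)[OF b p]] _ t u])
        (simp add: pm cl xy)
  qed
qed

lemma alghomI:
  assumes "f \<in> lin A B"
    and "\<And>x y. x \<in> carrier A \<Longrightarrow> y \<in> carrier A \<Longrightarrow> f (x \<otimes>\<^bsub>A\<^esub> y) = f x \<otimes>\<^bsub>B\<^esub> f y"
    and "f \<one>\<^bsub>A\<^esub> = \<one>\<^bsub>B\<^esub>"
  shows "f \<in> alghom A B"
  using assms by (auto simp: algebra_hom_def ring_hom_def linear_maps_def)

lemma alghom_lin: "f \<in> alghom A B \<Longrightarrow> f \<in> lin A B"
  and alghom_mult: "f \<in> alghom A B \<Longrightarrow> x \<in> carrier A \<Longrightarrow> y \<in> carrier A \<Longrightarrow> f (x \<otimes>\<^bsub>A\<^esub> y) = f x \<otimes>\<^bsub>B\<^esub> f y"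
  and alghom_one: "f \<in> alghom A B \<Longrightarrow> f \<one>\<^bsub>A\<^esub> = \<one>\<^bsub>B\<^esub>"
  by (auto simp: algebra_hom_def ring_hom_def)

lemma alghom_closed: "f \<in> alghom A B \<Longrightarrow> x \<in> carrier A \<Longrightarrow> f x \<in> carrier B"
  by (rule lin_closed[OF alghom_lin])

lemma alghom_id: "(\<lambda>x. x) \<in> alghom A A"
  by (rule alghomI) (simp_all add: lin_id)

lemma alghom_comp: "g \<in> alghom B C \<Longrightarrow> f \<in> alghom A B \<Longrightarrow> (\<lambda>x. g (f x)) \<in> alghom A C"
  by (rule alghomI[OF lin_comp[OF alghom_lin alghom_lin]])
    (simp_all add: alghom_mult[of f] alghom_mult[of g] alghom_one[of f] alghom_one[of g] alghom_closed[of f])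

lemma alghom_cong:
  assumes "f \<in> alghom A B" "alg A" "\<And>x. x \<in> carrier A \<Longrightarrow> f x = g x"
  shows "g \<in> alghom A B"
  using lin_cong[OF alghom_lin[OF assms(1)] alg_mod[OF assms(2)] assms(3)]
  by (rule alghomI)
    (simp_all add: assms(3)[symmetric] alg_simps[OF assms(2)] alghom_mult[OF assms(1)] alghom_one[OF assms(1)])

lemma tlift_alghom:
  assumes A: "alg A" and B: "alg B" and C: "alg C" and f: "bil A B C f"
    and mult: "\<And>a b a' b'. a \<in> carrier A \<Longrightarrow> b \<in> carrier B \<Longrightarrow> a' \<in> carrier A \<Longrightarrow> b' \<in> carrier B \<Longrightarrow>
      f (a \<otimes>\<^bsub>A\<^esub> a') (b \<otimes>\<^bsub>B\<^esub> b') = f a b \<otimes>\<^bsub>C\<^esub> f a' b'"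
    and one: "f \<one>\<^bsub>A\<^esub> \<one>\<^bsub>B\<^esub> = \<one>\<^bsub>C\<^esub>"
  shows "tlift A B C f \<in> alghom (A \<boxtimes> B) C"
proof (rule alghomI)
  note mA = alg_mod[OF A] and mB = alg_mod[OF B] and mC = alg_mod[OF C]
  note L = tlift_lin[OF mA mB mC f] and Lp = tlift_pt[OF mA mB mC f]
  show "tlift A B C f \<in> lin (A \<boxtimes> B) C" by (rule L)
  show "tlift A B C f \<one>\<^bsub>A \<boxtimes> B\<^esub> = \<one>\<^bsub>C\<^esub>"
    by (simp add: tensor_mult Lp alg_simps[OF A] alg_simps[OF B] one)
  fix s t assume s: "s \<in> carrier (A \<boxtimes> B)" and t: "t \<in> carrier (A \<boxtimes> B)"
  show "tlift A B C f (s \<otimes>\<^bsub>A \<boxtimes> B\<^esub> t) = tlift A B C f s \<otimes>\<^bsub>C\<^esub> tlift A B C f t"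
    by (rule tensor_eqI2[OF mA mB mA mB mC bil_post[OF tensor_mult_bil[OF A B] L]
          bil_pre[OF alg_bil[OF C] L L] _ s t])
      (simp add: tensor_mult_pt[OF A B] Lp alg_simps[OF A] alg_simps[OF B] mult)
qed

lemma tmap_alghom:
  assumes A: "alg A" and B: "alg B" and A': "alg A'" and B': "alg B'"
    and f: "f \<in> alghom A A'" and g: "g \<in> alghom B B'"
  shows "tmap A B A' B' f g \<in> alghom (A \<boxtimes> B) (A' \<boxtimes> B')"
  unfolding tensor_map_def
  by (rule tlift_alghom[OF A B tensor_alg[OF A' B'] bil_pre[OF pt_bil alghom_lin alghom_lin]])
    (simp_all add: alg_mod assms tensor_mult_pt[OF A' B'] alghom_closed[OF f] alghom_closed[OF g]
      alghom_mult[OF f] alghom_mult[OF g] alghom_one[OF f] alghom_one[OF g] tensor_mult(2))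

lemma tassoc_alghom:
  assumes A: "alg A" and B: "alg B" and C: "alg C"
  shows "tensor_assoc K A B C \<in> alghom (A \<boxtimes> B \<boxtimes> C) (A \<boxtimes> (B \<boxtimes> C))"
proof (rule alghomI)
  note mA = alg_mod[OF A] and mB = alg_mod[OF B] and mC = alg_mod[OF C]
  note AB = tensor_alg[OF A B] and BC = tensor_alg[OF B C]
  note T = alg_mod[OF tensor_alg[OF A BC]]
  note L = tassoc_lin[OF mA mB mC] and Lp = tassoc_pt[OF mA mB mC]
  note cl = alg_simps[OF A] alg_simps[OF B] alg_simps[OF C] alg_simps[OF AB] alg_simps[OF BC]
    pt_closed[OF mA mB] pt_closed[OF mB mC]
  show "tensor_assoc K A B C \<in> lin (A \<boxtimes> B \<boxtimes> C) (A \<boxtimes> (B \<boxtimes> C))" by (rule L)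
  show "tensor_assoc K A B C \<one>\<^bsub>A \<boxtimes> B \<boxtimes> C\<^esub> = \<one>\<^bsub>A \<boxtimes> (B \<boxtimes> C)\<^esub>"
    by (simp add: tensor_mult Lp cl)
  let ?L = "tensor_assoc K A B C"
  have lin1: "c \<in> carrier C \<Longrightarrow> (\<lambda>t. pt (A \<boxtimes> B) C t c) \<in> lin (A \<boxtimes> B) (A \<boxtimes> B \<boxtimes> C)" for c
    by (rule bilD(2)[OF pt_bil[OF alg_mod[OF AB] mC]])
  fix s t assume s: "s \<in> carrier (A \<boxtimes> B \<boxtimes> C)" and t: "t \<in> carrier (A \<boxtimes> B \<boxtimes> C)"
  show "?L (s \<otimes>\<^bsub>A \<boxtimes> B \<boxtimes> C\<^esub> t) = ?L s \<otimes>\<^bsub>A \<boxtimes> (B \<boxtimes> C)\<^esub> ?L t"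
  proof (rule tensor_eqI2[OF alg_mod[OF AB] mC alg_mod[OF AB] mC T bil_post[OF tensor_mult_bil[OF AB C] L]
          bil_pre[OF tensor_mult_bil[OF A BC] L L] _ s t])
    fix x c y d assume xc: "x \<in> carrier (A \<boxtimes> B)" "c \<in> carrier C" "y \<in> carrier (A \<boxtimes> B)" "d \<in> carrier C"
    \<comment> \<open>The factors \<open>x\<close> and \<open>y\<close> are still arbitrary tensors
      over \<open>A\<close> and \<open>B\<close>, so a second reduction to pure tensors is
      required.\<close>
    have "?L (pt (A \<boxtimes> B) C (x \<otimes>\<^bsub>A \<boxtimes> B\<^esub> y) (c \<otimes>\<^bsub>C\<^esub> d)) =
        ?L (pt (A \<boxtimes> B) C x c) \<otimes>\<^bsub>A \<boxtimes> (B \<boxtimes> C)\<^esub> ?L (pt (A \<boxtimes> B) C y d)"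
      by (rule tensor_eqI2[OF mA mB mA mB T
            bil_post[OF tensor_mult_bil[OF A B] lin_comp[OF L lin1[OF cl(14)[OF xc(2,4)]]]]
            bil_pre[OF tensor_mult_bil[OF A BC] lin_comp[OF L lin1[OF xc(2)]] lin_comp[OF L lin1[OF xc(4)]]]
            _ xc(1,3)])
        (simp add: tensor_mult_pt[OF A B] tensor_mult_pt[OF A BC] tensor_mult_pt[OF B C] Lp cl xc)
    then show "?L (pt (A \<boxtimes> B) C x c \<otimes>\<^bsub>A \<boxtimes> B \<boxtimes> C\<^esub> pt (A \<boxtimes> B) C y d) =
        ?L (pt (A \<boxtimes> B) C x c) \<otimes>\<^bsub>A \<boxtimes> (B \<boxtimes> C)\<^esub> ?L (pt (A \<boxtimes> B) C y d)"
      by (simp add: tensor_mult_pt[OF AB C] xc)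
  qed
qed

lemma incl_left_alghom:
  assumes A: "alg A" and B: "alg B"
  shows "(\<lambda>a. pt A B a \<one>\<^bsub>B\<^esub>) \<in> alghom A (A \<boxtimes> B)"
  by (rule alghomI[OF bilD(2)[OF pt_bil]])
    (simp_all add: alg_mod assms tensor_mult_pt alg_simps[OF B] tensor_mult(2))

lemma incl_right_alghom:
  assumes A: "alg A" and B: "alg B"
  shows "(\<lambda>b. pt A B \<one>\<^bsub>A\<^esub> b) \<in> alghom B (A \<boxtimes> B)"
  by (rule alghomI[OF bilD(1)[OF pt_bil]])
    (simp_all add: alg_mod assms tensor_mult_pt alg_simps[OF A] tensor_mult(2))

lemma base_algebra_alg: "alg (base_algebra K)"
  by (rule algebraI)
    (auto simp: base_algebra_def l_distr r_distr intro!: cringI abelian_groupI comm_monoidI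
      simp: a_ac m_ac intro: add.l_inv_ex)

lemma unit_alghom:
  assumes A: "alg A" shows "(\<lambda>a. a \<odot>\<^bsub>A\<^esub> \<one>\<^bsub>A\<^esub>) \<in> alghom (base_algebra K) A"
proof (rule alghomI[OF bilD(2)[OF bil_smult]])
  interpret A: algebra K A by fact
  show "(x \<otimes>\<^bsub>base_algebra K\<^esub> y) \<odot>\<^bsub>A\<^esub> \<one>\<^bsub>A\<^esub> = (x \<odot>\<^bsub>A\<^esub> \<one>\<^bsub>A\<^esub>) \<otimes>\<^bsub>A\<^esub> (y \<odot>\<^bsub>A\<^esub> \<one>\<^bsub>A\<^esub>)"
    if "x \<in> carrier (base_algebra K)" "y \<in> carrier (base_algebra K)" for x y
    using that by (simp add: base_algebra_def A.smult_assoc2 A.smult_assoc1)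
qed (simp_all add: alg_mod[OF A] alg_simps[OF A] base_algebra_def module_simps)

end

section \<open>The automorphism functor\<close>

text \<open>
  The product and the bracket of \<open>P\<close> play the same role below, so \<open>P\<close> carries a set \<open>Ops\<close> of
  bilinear operations.
\<close>

locale base_space = base_ring K for K (structure) +
  fixes P :: "('a, 'p, 'r) module_scheme" and Ops :: "('p \<Rightarrow> 'p \<Rightarrow> 'p) set"
  assumes P: "module K P" and Ops: "\<beta> \<in> Ops \<Longrightarrow> bil P P P \<beta>"
begin

text \<open>These are the ingredients of a functor of points, expressed by \<open>K\<close>-linear
  maps only: \<open>push\<close> is base change along \<open>f\<close>, \<open>act\<close> the
  \<open>A\<close>-module structure of \<open>P \<boxtimes> A\<close>, \<open>ext\<close> the
  \<open>A\<close>-linear extension of a map defined on \<open>P\<close>, and \<open>iota\<close>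
  the inclusion of \<open>P\<close>, that is, the identity automorphism.\<close>

definition push where "push A B f = tmap P A P B id f"
definition act where "act A a = push A A (\<lambda>x. a \<otimes>\<^bsub>A\<^esub> x)"
definition ext where "ext A \<phi> = tlift P A (P \<boxtimes> A) (\<lambda>p a. act A a (\<phi> p))"
definition iota where "iota A p = pt P A p \<one>\<^bsub>A\<^esub>"

lemma push_lin: "module K A \<Longrightarrow> module K B \<Longrightarrow> f \<in> lin A B \<Longrightarrow> push A B f \<in> lin (P \<boxtimes> A) (P \<boxtimes> B)"
  unfolding push_def by (rule tmap_lin[OF P _ P _ lin_id(2)])

lemma push_pt: "module K A \<Longrightarrow> module K B \<Longrightarrow> f \<in> lin A B \<Longrightarrow> p \<in> carrier P \<Longrightarrow> a \<in> carrier A \<Longrightarrow>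
    push A B f (pt P A p a) = pt P B p (f a)"
  unfolding push_def by (simp add: tmap_pt[OF P _ P _ lin_id(2)])

lemma push_push:
  assumes "module K A" "module K B" "module K C" "f \<in> lin A B" "g \<in> lin B C" "t \<in> carrier (P \<boxtimes> A)"
  shows "push B C g (push A B f t) = push A C (\<lambda>x. g (f x)) t"
  by (rule tensor_eqI[OF P assms(1) lin_comp[OF push_lin[OF assms(2,3,5)] push_lin[OF assms(1,2,4)]]
        push_lin[OF assms(1,3) lin_comp[OF assms(5,4)]] tensor_mod[OF P assms(3)] _ assms(6)])
    (simp add: push_pt assms lin_comp[OF assms(5,4)] lin_closed[OF assms(4)])

lemma push_cong:
  assumes "module K A" "module K B" "f \<in> lin A B" "\<And>a. a \<in> carrier A \<Longrightarrow> f a = g a" "t \<in> carrier (P \<boxtimes> A)"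
  shows "push A B f t = push A B g t"
  unfolding push_def by (rule tmap_cong[OF P assms(1) P assms(2) lin_id(2) assms(3) refl assms(4,5)])

lemma push_id:
  assumes "module K A" "t \<in> carrier (P \<boxtimes> A)" shows "push A A (\<lambda>x. x) t = t"
  unfolding push_def id_def by (rule tmap_id[OF P assms])

context
  fixes A :: "('a, 'x, 's) module_scheme"
  assumes A: "alg A"
begin

private lemmas mA = alg_mod[OF A]
private lemmas T = tensor_mod[OF P mA]

lemma act_lin: "a \<in> carrier A \<Longrightarrow> act A a \<in> lin (P \<boxtimes> A) (P \<boxtimes> A)"
  unfolding act_def by (rule push_lin[OF mA mA bilD(1)[OF alg_bil[OF A]]])

lemma act_pt: "a \<in> carrier A \<Longrightarrow> p \<in> carrier P \<Longrightarrow> x \<in> carrier A \<Longrightarrow> act A a (pt P A p x) = pt P A p (a \<otimes>\<^bsub>A\<^esub> x)"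
  unfolding act_def by (rule push_pt[OF mA mA bilD(1)[OF alg_bil[OF A]]])

lemma act_bil: "bil A (P \<boxtimes> A) (P \<boxtimes> A) (act A)"
proof (rule bilI[OF act_lin])
  fix t assume t: "t \<in> carrier (P \<boxtimes> A)"
  show "(\<lambda>a. act A a t) \<in> lin A (P \<boxtimes> A)"
    unfolding act_def push_def tensor_map_def id_def
    by (rule tlift_param[OF P mA T bil_pre[OF pt_bil[OF P mA] lin_id(1) bilD(1)[OF alg_bil[OF A]]]
          lin_comp[OF bilD(1)[OF pt_bil[OF P mA]] bilD(2)[OF alg_bil[OF A]]] mA t])
qed

lemma act_act:
  assumes a: "a \<in> carrier A" "b \<in> carrier A" and t: "t \<in> carrier (P \<boxtimes> A)"
  shows "act A a (act A b t) = act A (a \<otimes>\<^bsub>A\<^esub> b) t"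
  by (rule tensor_eqI[OF P mA lin_comp[OF act_lin[OF a(1)] act_lin[OF a(2)]] act_lin T _ t])
    (simp_all add: a act_pt alg_simps[OF A])

lemma act_one:
  assumes t: "t \<in> carrier (P \<boxtimes> A)"
  shows "act A \<one>\<^bsub>A\<^esub> t = t"
  by (rule tensor_eqI[OF P mA act_lin lin_id(1) T _ t]) (simp_all add: act_pt alg_simps[OF A])

text \<open>The operation extended to \<open>P \<boxtimes> A\<close> is bilinear over
  \<open>A\<close>, not merely over \<open>K\<close>.\<close>

lemma act_op:
  assumes a: "a \<in> carrier A" "b \<in> carrier A" and s: "s \<in> carrier (P \<boxtimes> A)" and t: "t \<in> carrier (P \<boxtimes> A)"
    and \<beta>: "\<beta> \<in> Ops"
  shows "op P A \<beta> (mult A) (act A a s) (act A b t) = act A (a \<otimes>\<^bsub>A\<^esub> b) (op P A \<beta> (mult A) s t)"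
  by (rule tensor_eqI2[OF P mA P mA T
        bil_pre[OF op_bil[OF P mA Ops[OF \<beta>] alg_bil[OF A]] act_lin[OF a(1)] act_lin[OF a(2)]]
        bil_post[OF op_bil[OF P mA Ops[OF \<beta>] alg_bil[OF A]] act_lin] _ s t])
    (simp_all add: a act_pt op_pt[OF P mA Ops[OF \<beta>] alg_bil[OF A]] alg_simps[OF A] bil_closed[OF Ops[OF \<beta>]])

lemma iota_lin: "iota A \<in> lin P (P \<boxtimes> A)"
  unfolding iota_def by (rule bilD(2)[OF pt_bil[OF P mA] alg_simps(1)[OF A]])

lemma iota_op: "\<beta> \<in> Ops \<Longrightarrow> x \<in> carrier P \<Longrightarrow> y \<in> carrier P \<Longrightarrow>
    iota A (\<beta> x y) = op P A \<beta> (mult A) (iota A x) (iota A y)"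
  unfolding iota_def by (simp add: op_pt[OF P mA Ops alg_bil[OF A]] alg_simps[OF A])

lemma ext_bil: "\<phi> \<in> lin P (P \<boxtimes> A) \<Longrightarrow> bil P A (P \<boxtimes> A) (\<lambda>p a. act A a (\<phi> p))"
  by (rule bil_flip[OF bil_pre[OF act_bil lin_id(1)]])

lemma ext_lin: "\<phi> \<in> lin P (P \<boxtimes> A) \<Longrightarrow> ext A \<phi> \<in> lin (P \<boxtimes> A) (P \<boxtimes> A)"
  unfolding ext_def by (rule tlift_lin[OF P mA T ext_bil])

lemma ext_pt: "\<phi> \<in> lin P (P \<boxtimes> A) \<Longrightarrow> p \<in> carrier P \<Longrightarrow> a \<in> carrier A \<Longrightarrow> ext A \<phi> (pt P A p a) = act A a (\<phi> p)"
  unfolding ext_def by (rule tlift_pt[OF P mA T ext_bil])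

lemma ext_iota: "\<phi> \<in> lin P (P \<boxtimes> A) \<Longrightarrow> p \<in> carrier P \<Longrightarrow> ext A \<phi> (iota A p) = \<phi> p"
  unfolding iota_def by (simp add: ext_pt alg_simps[OF A] act_one lin_closed[of \<phi>])

lemma ext_cong:
  assumes \<phi>: "\<phi> \<in> lin P (P \<boxtimes> A)" and eq: "\<And>p. p \<in> carrier P \<Longrightarrow> \<phi> p = \<psi> p" and t: "t \<in> carrier (P \<boxtimes> A)"
  shows "ext A \<phi> t = ext A \<psi> t"
  unfolding ext_def by (rule tlift_cong[OF P mA T ext_bil[OF \<phi>] _ t]) (simp add: eq)

lemma ext_act:
  assumes \<phi>: "\<phi> \<in> lin P (P \<boxtimes> A)" and a: "a \<in> carrier A" and t: "t \<in> carrier (P \<boxtimes> A)"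
  shows "ext A \<phi> (act A a t) = act A a (ext A \<phi> t)"
  by (rule tensor_eqI[OF P mA lin_comp[OF ext_lin[OF \<phi>] act_lin[OF a]] lin_comp[OF act_lin[OF a] ext_lin[OF \<phi>]] T _ t])
    (simp add: a act_pt ext_pt[OF \<phi>] alg_simps[OF A] act_act lin_closed[OF \<phi>])

text \<open>Points are maps on \<open>P\<close>, and their product is
  \<open>p \<mapsto> ext A \<phi> (\<psi> p)\<close>. Under \<open>ext\<close> this becomes
  composition of endomorphisms, since both sides are \<open>A\<close>-linear and agree on
  \<open>P\<close>; associativity of the product follows.\<close>

lemma ext_ext:
  assumes \<phi>: "\<phi> \<in> lin P (P \<boxtimes> A)" and \<psi>: "\<psi> \<in> lin P (P \<boxtimes> A)" and t: "t \<in> carrier (P \<boxtimes> A)"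
  shows "ext A (\<lambda>p. ext A \<phi> (\<psi> p)) t = ext A \<phi> (ext A \<psi> t)"
  by (rule tensor_eqI[OF P mA ext_lin[OF lin_comp[OF ext_lin[OF \<phi>] \<psi>]] lin_comp[OF ext_lin[OF \<phi>] ext_lin[OF \<psi>]] T _ t])
    (simp add: ext_pt \<psi> lin_comp[OF ext_lin[OF \<phi>] \<psi>] ext_act[OF \<phi>] lin_closed[OF \<psi>])

lemma ext_iota_id:
  assumes t: "t \<in> carrier (P \<boxtimes> A)"
  shows "ext A (iota A) t = t"
  by (rule tensor_eqI[OF P mA ext_lin[OF iota_lin] lin_id(1) T _ t])
    (simp add: ext_pt iota_lin, simp add: iota_def act_pt alg_simps[OF A])

text \<open>Both sides are \<open>A\<close>-bilinear by \<open>ext_act\<close> and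
  \<open>act_op\<close>, so compatibility on \<open>P\<close> spreads to
  \<open>P \<boxtimes> A\<close>.\<close>

lemma ext_op:
  assumes \<beta>: "\<beta> \<in> Ops" and \<phi>: "\<phi> \<in> lin P (P \<boxtimes> A)"
    and mult: "\<And>x y. x \<in> carrier P \<Longrightarrow> y \<in> carrier P \<Longrightarrow> \<phi> (\<beta> x y) = op P A \<beta> (mult A) (\<phi> x) (\<phi> y)"
    and s: "s \<in> carrier (P \<boxtimes> A)" and t: "t \<in> carrier (P \<boxtimes> A)"
  shows "ext A \<phi> (op P A \<beta> (mult A) s t) = op P A \<beta> (mult A) (ext A \<phi> s) (ext A \<phi> t)"
  by (rule tensor_eqI2[OF P mA P mA T
        bil_post[OF op_bil[OF P mA Ops[OF \<beta>] alg_bil[OF A]] ext_lin[OF \<phi>]]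
        bil_pre[OF op_bil[OF P mA Ops[OF \<beta>] alg_bil[OF A]] ext_lin[OF \<phi>] ext_lin[OF \<phi>]] _ s t])
    (simp_all add: ext_pt[OF \<phi>] op_pt[OF P mA Ops[OF \<beta>] alg_bil[OF A]] alg_simps[OF A]
      bil_closed[OF Ops[OF \<beta>]] act_op[OF _ _ _ _ \<beta>] lin_closed[OF \<phi>] mult)

end

section \<open>Base change along an algebra homomorphism\<close>

context
  fixes A :: "('a, 'x, 's) module_scheme" and B :: "('a, 'y, 't) module_scheme" and f
  assumes A: "alg A" and B: "alg B" and f: "f \<in> alghom A B"
begin

private lemmas mA2 = alg_mod[OF A] and mB2 = alg_mod[OF B]
private lemmas TB = tensor_mod[OF P mB2]
private lemmas flin = alghom_lin[OF f]
private lemmas plin = push_lin[OF mA2 mB2 flin]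

lemma push_alghom_pt: "p \<in> carrier P \<Longrightarrow> a \<in> carrier A \<Longrightarrow> push A B f (pt P A p a) = pt P B p (f a)"
  by (rule push_pt[OF mA2 mB2 flin])

lemma push_alghom_lin: "push A B f \<in> lin (P \<boxtimes> A) (P \<boxtimes> B)" by (rule plin)

lemma push_iota: "p \<in> carrier P \<Longrightarrow> push A B f (iota A p) = iota B p"
  by (simp add: iota_def push_alghom_pt alg_simps[OF A] alghom_one[OF f])

lemma push_act:
  assumes a: "a \<in> carrier A" and t: "t \<in> carrier (P \<boxtimes> A)"
  shows "push A B f (act A a t) = act B (f a) (push A B f t)"
  by (rule tensor_eqI[OF P mA2 lin_comp[OF plin act_lin[OF A a]] lin_comp[OF act_lin[OF B] plin] TB _ t])
    (simp_all add: a act_pt[OF A] act_pt[OF B] push_alghom_pt alg_simps[OF A] alghom_closed[OF f] alghom_mult[OF f])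

lemma push_op:
  assumes \<beta>: "\<beta> \<in> Ops" and s: "s \<in> carrier (P \<boxtimes> A)" and t: "t \<in> carrier (P \<boxtimes> A)"
  shows "push A B f (op P A \<beta> (mult A) s t) = op P B \<beta> (mult B) (push A B f s) (push A B f t)"
  unfolding push_def
  by (rule tmap_op[OF P mA2 P mB2 lin_id(2) flin Ops[OF \<beta>] Ops[OF \<beta>] alg_bil[OF A] alg_bil[OF B] _ _ s t])
    (simp_all add: alghom_mult[OF f])

text \<open>Base change commutes with composition of points. This is the naturality of the group
  law, on which the Yoneda argument depends.\<close>

lemma push_ext:
  assumes \<phi>: "\<phi> \<in> lin P (P \<boxtimes> A)" and t: "t \<in> carrier (P \<boxtimes> A)"
  shows "push A B f (ext A \<phi> t) = ext B (\<lambda>p. push A B f (\<phi> p)) (push A B f t)"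
  by (rule tensor_eqI[OF P mA2 lin_comp[OF plin ext_lin[OF A \<phi>]] lin_comp[OF ext_lin[OF B lin_comp[OF plin \<phi>]] plin] TB _ t])
    (simp add: ext_pt[OF A \<phi>] ext_pt[OF B lin_comp[OF plin \<phi>]] push_alghom_pt push_act lin_closed[OF \<phi>] alghom_closed[OF f])

end

text \<open>The \<open>A\<close>-points of the automorphism group scheme of \<open>P\<close>, with their inverses.\<close>

definition autos where
  "autos A = {(\<phi>, \<psi>). \<phi> \<in> lin P (P \<boxtimes> A) \<and> \<psi> \<in> lin P (P \<boxtimes> A) \<and>
    (\<forall>\<beta>\<in>Ops. \<forall>x\<in>carrier P. \<forall>y\<in>carrier P. \<phi> (\<beta> x y) = op P A \<beta> (mult A) (\<phi> x) (\<phi> y)) \<and>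
    (\<forall>p\<in>carrier P. ext A \<phi> (\<psi> p) = iota A p \<and> ext A \<psi> (\<phi> p) = iota A p)}"

lemma autosD:
  assumes "(\<phi>, \<psi>) \<in> autos A"
  shows "\<phi> \<in> lin P (P \<boxtimes> A)" "\<psi> \<in> lin P (P \<boxtimes> A)"
    "\<beta> \<in> Ops \<Longrightarrow> x \<in> carrier P \<Longrightarrow> y \<in> carrier P \<Longrightarrow> \<phi> (\<beta> x y) = op P A \<beta> (mult A) (\<phi> x) (\<phi> y)"
    "p \<in> carrier P \<Longrightarrow> ext A \<phi> (\<psi> p) = iota A p"
    "p \<in> carrier P \<Longrightarrow> ext A \<psi> (\<phi> p) = iota A p"
  using assms unfolding autos_def by auto

lemma autosI:
  assumes "\<phi> \<in> lin P (P \<boxtimes> A)" "\<psi> \<in> lin P (P \<boxtimes> A)"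
    "\<And>\<beta> x y. \<beta> \<in> Ops \<Longrightarrow> x \<in> carrier P \<Longrightarrow> y \<in> carrier P \<Longrightarrow> \<phi> (\<beta> x y) = op P A \<beta> (mult A) (\<phi> x) (\<phi> y)"
    "\<And>p. p \<in> carrier P \<Longrightarrow> ext A \<phi> (\<psi> p) = iota A p"
    "\<And>p. p \<in> carrier P \<Longrightarrow> ext A \<psi> (\<phi> p) = iota A p"
  shows "(\<phi>, \<psi>) \<in> autos A"
  using assms unfolding autos_def by auto

text \<open>\<open>autos\<close> demands the inverse laws on \<open>P\<close> only; two
  \<open>A\<close>-linear maps agreeing there agree everywhere.\<close>

lemma ext_inverse:
  assumes A: "alg A" and au: "(\<phi>, \<psi>) \<in> autos A" and t: "t \<in> carrier (P \<boxtimes> A)"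
  shows "ext A \<phi> (ext A \<psi> t) = t" "ext A \<psi> (ext A \<phi> t) = t"
proof -
  note lin = autosD(1,2)[OF au]
  have "ext A (\<lambda>p. ext A \<phi> (\<psi> p)) t = ext A (iota A) t"
    by (rule ext_cong[OF A lin_comp[OF ext_lin[OF A lin(1)] lin(2)] autosD(4)[OF au] t])
  then show "ext A \<phi> (ext A \<psi> t) = t"
    by (simp add: ext_ext[OF A lin t] ext_iota_id[OF A t])
  have "ext A (\<lambda>p. ext A \<psi> (\<phi> p)) t = ext A (iota A) t"
    by (rule ext_cong[OF A lin_comp[OF ext_lin[OF A lin(2)] lin(1)] autosD(5)[OF au] t])
  then show "ext A \<psi> (ext A \<phi> t) = t"
    by (simp add: ext_ext[OF A lin(2,1) t] ext_iota_id[OF A t])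
qed

text \<open>The group-theoretic argument \<open>\<psi>' = \<psi> \<phi> \<psi>' = \<psi> \<phi>'
  \<psi>' = \<psi>\<close>. Because of it a point is determined by its first component, which is all
  that a coaction provides.\<close>

lemma autos_inverse_unique:
  assumes A: "alg A" and au: "(\<phi>, \<psi>) \<in> autos A" and au': "(\<phi>', \<psi>') \<in> autos A"
    and eq: "\<And>p. p \<in> carrier P \<Longrightarrow> \<phi> p = \<phi>' p" and p: "p \<in> carrier P"
  shows "\<psi> p = \<psi>' p"
proof -
  note cl = lin_closed[OF autosD(2)[OF au'] p]
  have "\<psi>' p = ext A \<psi> (ext A \<phi> (\<psi>' p))" by (rule ext_inverse(2)[OF A au cl, symmetric])
  also have "ext A \<phi> (\<psi>' p) = ext A \<phi>' (\<psi>' p)" by (rule ext_cong[OF A autosD(1)[OF au] eq cl])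
  also have "\<dots> = iota A p" by (rule autosD(4)[OF au' p])
  also have "ext A \<psi> (iota A p) = \<psi> p" by (rule ext_iota[OF A autosD(2)[OF au] p])
  finally show ?thesis by simp
qed

lemma autos_iota: "alg A \<Longrightarrow> (iota A, iota A) \<in> autos A"
  by (rule autosI) (simp_all add: iota_lin iota_op ext_iota)

text \<open>\<open>autos\<close> requires compatibility with the operations of the first component
  only. For the inverse it follows by applying \<open>\<phi>\<close> to the value of the operation
  at \<open>\<psi> x\<close> and \<open>\<psi> y\<close> and cancelling. The antipode will classify
  the swapped pair.\<close>

lemma autos_sym:
  assumes A: "alg A" and au: "(\<phi>, \<psi>) \<in> autos A"
  shows "(\<psi>, \<phi>) \<in> autos A"
proof (rule autosI[OF autosD(2,1)[OF au] _ autosD(5,4)[OF au]])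
  note lin = autosD(1,2)[OF au]
  note obil = op_bil[OF P alg_mod[OF A] Ops alg_bil[OF A]]
  fix \<beta> x y assume *: "\<beta> \<in> Ops" "x \<in> carrier P" "y \<in> carrier P"
  have cl: "\<psi> x \<in> carrier (P \<boxtimes> A)" "\<psi> y \<in> carrier (P \<boxtimes> A)" using * lin_closed[OF lin(2)] by auto
  have "ext A \<phi> (op P A \<beta> (mult A) (\<psi> x) (\<psi> y)) = op P A \<beta> (mult A) (ext A \<phi> (\<psi> x)) (ext A \<phi> (\<psi> y))"
    by (rule ext_op[OF A *(1) lin(1) autosD(3)[OF au *(1)] cl])
  also have "\<dots> = iota A (\<beta> x y)"
    using * by (simp add: autosD(4)[OF au] iota_op[OF A])
  finally have "ext A \<psi> (ext A \<phi> (op P A \<beta> (mult A) (\<psi> x) (\<psi> y))) = ext A \<psi> (iota A (\<beta> x y))"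
    by simp
  then show "\<psi> (\<beta> x y) = op P A \<beta> (mult A) (\<psi> x) (\<psi> y)"
    by (simp add: ext_inverse[OF A au] bil_closed[OF obil] * cl ext_iota[OF A lin(2)] bil_closed[OF Ops])
qed

lemma autos_mult:
  assumes A: "alg A" and au: "(\<phi>, \<psi>) \<in> autos A" and au': "(\<phi>', \<psi>') \<in> autos A"
  shows "(\<lambda>p. ext A \<phi> (\<phi>' p), \<lambda>p. ext A \<psi>' (\<psi> p)) \<in> autos A"
proof (rule autosI)
  note lin = autosD(1,2)[OF au] and lin' = autosD(1,2)[OF au']
  show l1: "(\<lambda>p. ext A \<phi> (\<phi>' p)) \<in> lin P (P \<boxtimes> A)" by (rule lin_comp[OF ext_lin[OF A lin(1)] lin'(1)])
  show l2: "(\<lambda>p. ext A \<psi>' (\<psi> p)) \<in> lin P (P \<boxtimes> A)" by (rule lin_comp[OF ext_lin[OF A lin'(2)] lin(2)])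
  note cl = lin_closed[OF lin(1)] lin_closed[OF lin(2)] lin_closed[OF lin'(1)] lin_closed[OF lin'(2)]
    lin_closed[OF ext_lin[OF A lin(1)]] lin_closed[OF ext_lin[OF A lin(2)]]
    lin_closed[OF ext_lin[OF A lin'(1)]] lin_closed[OF ext_lin[OF A lin'(2)]]
  fix p assume p: "p \<in> carrier P"
  show "ext A (\<lambda>p. ext A \<phi> (\<phi>' p)) (ext A \<psi>' (\<psi> p)) = iota A p"
    using p by (simp add: ext_ext[OF A lin(1) lin'(1)] ext_inverse[OF A au'] cl autosD(4)[OF au])
  show "ext A (\<lambda>p. ext A \<psi>' (\<psi> p)) (ext A \<phi> (\<phi>' p)) = iota A p"
    using p by (simp add: ext_ext[OF A lin'(2) lin(2)] ext_inverse[OF A au] cl autosD(5)[OF au'])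
next
  fix \<beta> x y assume *: "\<beta> \<in> Ops" "x \<in> carrier P" "y \<in> carrier P"
  show "ext A \<phi> (\<phi>' (\<beta> x y)) = op P A \<beta> (mult A) (ext A \<phi> (\<phi>' x)) (ext A \<phi> (\<phi>' y))"
    using * by (simp add: autosD(3)[OF au'] ext_op[OF A *(1) autosD(1)[OF au] autosD(3)[OF au *(1)]]
        lin_closed[OF autosD(1)[OF au']])
qed

lemma autos_push:
  assumes A: "alg A" and B: "alg B" and f: "f \<in> alghom A B" and au: "(\<phi>, \<psi>) \<in> autos A"
  shows "(\<lambda>p. push A B f (\<phi> p), \<lambda>p. push A B f (\<psi> p)) \<in> autos B"
proof (rule autosI)
  note lin = autosD(1,2)[OF au] and pl = push_alghom_lin[OF A B f]
  show "(\<lambda>p. push A B f (\<phi> p)) \<in> lin P (P \<boxtimes> B)" "(\<lambda>p. push A B f (\<psi> p)) \<in> lin P (P \<boxtimes> B)"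
    by (rule lin_comp[OF pl lin(1)] lin_comp[OF pl lin(2)])+
  fix p assume p: "p \<in> carrier P"
  show "ext B (\<lambda>p. push A B f (\<phi> p)) (push A B f (\<psi> p)) = iota B p"
    using p by (simp add: push_ext[OF A B f lin(1), symmetric] lin_closed[OF lin(2)] autosD(4)[OF au] push_iota[OF A B f])
  show "ext B (\<lambda>p. push A B f (\<psi> p)) (push A B f (\<phi> p)) = iota B p"
    using p by (simp add: push_ext[OF A B f lin(2), symmetric] lin_closed[OF lin(1)] autosD(5)[OF au] push_iota[OF A B f])
next
  fix \<beta> x y assume *: "\<beta> \<in> Ops" "x \<in> carrier P" "y \<in> carrier P"
  show "push A B f (\<phi> (\<beta> x y)) = op P B \<beta> (mult B) (push A B f (\<phi> x)) (push A B f (\<phi> y))"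
    using * by (simp add: autosD(3)[OF au] push_op[OF A B f] lin_closed[OF autosD(1)[OF au]])
qed

section \<open>Coassociativity and convolution in terms of points\<close>

context
  fixes H :: "('a, 'h, 's) module_scheme"
  assumes H: "alg H"
begin

private lemmas mH = alg_mod[OF H]
private lemmas HH = tensor_alg[OF H H]
private lemmas mHH = alg_mod[OF HH]
private lemmas tl = tmap_lin[OF P mH tensor_mod[OF P mH] mH _ lin_id(2)]
private lemmas tp = tmap_pt[OF P mH tensor_mod[OF P mH] mH _ lin_id(2)]
private lemmas al = tassoc_lin[OF P mH mH]
private lemmas ap = tassoc_pt[OF P mH mH]
private lemmas i1 = incl_left_alghom[OF H H]
private lemmas i2 = incl_right_alghom[OF H H]
private lemmas p1 = push_alghom_lin[OF H HH i1]
private lemmas p2 = push_alghom_lin[OF H HH i2]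
private lemmas ptP = bilD(2)[OF pt_bil[OF tensor_mod[OF P mH] mH]]

text \<open>If \<open>\<phi> p\<close> is the sum of \<open>q \<otimes> a\<close>, both sides send
  \<open>p \<otimes> h\<close> to the sum of \<open>q \<otimes> (a \<otimes> h)\<close>. For
  \<open>t = \<phi> p\<close> the left side is one half of the coassociativity law, while the right
  side is the product of the two base changes of \<open>\<phi>\<close>.\<close>

lemma tassoc_ext:
  assumes \<phi>: "\<phi> \<in> lin P (P \<boxtimes> H)" and t: "t \<in> carrier (P \<boxtimes> H)"
  shows "tassoc P H H (tmap P H (P \<boxtimes> H) H \<phi> id t) =
    ext (H \<boxtimes> H) (\<lambda>p. push H (H \<boxtimes> H) (\<lambda>h. pt H H h \<one>\<^bsub>H\<^esub>) (\<phi> p)) (push H (H \<boxtimes> H) (\<lambda>h. pt H H \<one>\<^bsub>H\<^esub> h) t)"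
proof (rule tensor_eqI[OF P mH lin_comp[OF al tl[OF \<phi>]]
      lin_comp[OF ext_lin[OF HH lin_comp[OF p1 \<phi>]] p2] tensor_mod[OF P mHH] _ t])
  fix p h assume p: "p \<in> carrier P" and h: "h \<in> carrier H"
  have h1: "pt H H \<one>\<^bsub>H\<^esub> h \<in> carrier (H \<boxtimes> H)" using h by (simp add: pt_closed[OF mH mH] alg_simps[OF H])
  have "tassoc P H H (pt (P \<boxtimes> H) H (\<phi> p) h) =
      act (H \<boxtimes> H) (pt H H \<one>\<^bsub>H\<^esub> h) (push H (H \<boxtimes> H) (\<lambda>h. pt H H h \<one>\<^bsub>H\<^esub>) (\<phi> p))"
    by (rule tensor_eqI[OF P mH lin_comp[OF al ptP[OF h]] lin_comp[OF act_lin[OF HH h1] p1]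
          tensor_mod[OF P mHH] _ lin_closed[OF \<phi> p]])
      (simp add: ap h h1 push_alghom_pt[OF H HH i1] act_pt[OF HH h1] pt_closed[OF mH mH] alg_simps[OF H]
        tensor_mult_pt[OF H H])
  then show "tassoc P H H (tmap P H (P \<boxtimes> H) H \<phi> id (pt P H p h)) =
    ext (H \<boxtimes> H) (\<lambda>p. push H (H \<boxtimes> H) (\<lambda>h. pt H H h \<one>\<^bsub>H\<^esub>) (\<phi> p)) (push H (H \<boxtimes> H) (\<lambda>h. pt H H \<one>\<^bsub>H\<^esub> h) (pt P H p h))"
    by (simp add: tp \<phi> p h h1 push_alghom_pt[OF H HH i2] ext_pt[OF HH lin_comp[OF p1 \<phi>]])
qed

lemma convolution_bil:
  assumes "f \<in> lin H H" "g \<in> lin H H"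
  shows "bil H H H (\<lambda>x y. f x \<otimes>\<^bsub>H\<^esub> g y)"
  by (rule bil_pre[OF alg_bil[OF H] assms])

text \<open>For \<open>f\<close> and \<open>g\<close> the identity and the antipode this turns the antipode axioms into invertibility of a coaction.\<close>

lemma ext_convolution:
  assumes f: "f \<in> lin H H" and g: "g \<in> lin H H"
    and \<phi>: "\<phi> \<in> lin P (P \<boxtimes> H)" and t: "t \<in> carrier (P \<boxtimes> H)"
  shows "ext H (\<lambda>p. push H H f (\<phi> p)) (push H H g t) =
    push (H \<boxtimes> H) H (tlift H H H (\<lambda>x y. f x \<otimes>\<^bsub>H\<^esub> g y)) (tassoc P H H (tmap P H (P \<boxtimes> H) H \<phi> id t))"
proof (rule tensor_eqI[OF P mH lin_comp[OF ext_lin[OF H lin_comp[OF push_lin[OF mH mH f] \<phi>]] push_lin[OF mH mH g]]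
      lin_comp[OF push_lin[OF mHH mH tlift_lin[OF mH mH mH convolution_bil[OF f g]]] lin_comp[OF al tl[OF \<phi>]]]
      tensor_mod[OF P mH] _ t])
  note L = tlift_lin[OF mH mH mH convolution_bil[OF f g]] and Lp = tlift_pt[OF mH mH mH convolution_bil[OF f g]]
  fix p h assume p: "p \<in> carrier P" and h: "h \<in> carrier H"
  have gh: "g h \<in> carrier H" using lin_closed[OF g h] .
  \<comment> \<open>\<open>act\<close> multiplies by \<open>g h\<close> from the left, the
    convolution from the right; commutativity of \<open>H\<close> reconciles them. As
    \<open>\<phi> p\<close> need not be pure, it is reduced to pure tensors in turn.\<close>
  have "act H (g h) (push H H f (\<phi> p)) =
    push (H \<boxtimes> H) H (tlift H H H (\<lambda>x y. f x \<otimes>\<^bsub>H\<^esub> g y)) (tassoc P H H (pt (P \<boxtimes> H) H (\<phi> p) h))"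
    by (rule tensor_eqI[OF P mH lin_comp[OF act_lin[OF H gh] push_lin[OF mH mH f]]
          lin_comp[OF push_lin[OF mHH mH L] lin_comp[OF al ptP[OF h]]] tensor_mod[OF P mH] _ lin_closed[OF \<phi> p]])
      (simp add: push_pt[OF mH mH f] push_pt[OF mHH mH L] ap Lp h gh act_pt[OF H] pt_closed[OF mH mH]
        lin_closed[OF f] alg_comm[OF H gh])
  then show "ext H (\<lambda>p. push H H f (\<phi> p)) (push H H g (pt P H p h)) =
    push (H \<boxtimes> H) H (tlift H H H (\<lambda>x y. f x \<otimes>\<^bsub>H\<^esub> g y)) (tassoc P H H (tmap P H (P \<boxtimes> H) H \<phi> id (pt P H p h)))"
    by (simp add: tp \<phi> p h gh push_pt[OF mH mH g] ext_pt[OF H lin_comp[OF push_lin[OF mH mH f] \<phi>]])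
qed

end

end

section \<open>Polynomial algebras and their quotients\<close>

context base_ring
begin

text \<open>The analogue of \<open>tlift_param\<close>, needed because multiplication of polynomials
  is a nested \<open>free_lift\<close>.\<close>

lemma free_lift_param:
  assumes U: "module K U" and Y: "module K Y"
    and lin: "\<And>x. x \<in> X \<Longrightarrow> g x \<in> lin Y U" and c: "c \<in> carrier (FM X)"
  shows "(\<lambda>y. free_lift U (\<lambda>x. g x y) c) \<in> lin Y U"
proof (rule linI)
  have cl: "x \<in> X \<Longrightarrow> y \<in> carrier Y \<Longrightarrow> g x y \<in> carrier U" for x y
    using lin_closed[OF lin] .
  note L = free_lift_lin[OF U cl] and Lg = free_lift_gen[OF U _ cl]
  fix y assume y: "y \<in> carrier Y"
  show "free_lift U (\<lambda>x. g x y) c \<in> carrier U" using lin_closed[OF L[OF _ y] c] .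
  fix y' assume y': "y' \<in> carrier Y"
  have yy: "y \<oplus>\<^bsub>Y\<^esub> y' \<in> carrier Y" by (rule module_closed(2)[OF Y y y'])
  show "free_lift U (\<lambda>x. g x (y \<oplus>\<^bsub>Y\<^esub> y')) c = free_lift U (\<lambda>x. g x y) c \<oplus>\<^bsub>U\<^esub> free_lift U (\<lambda>x. g x y') c"
    by (rule free_eqI[OF L[OF _ yy] lin_plus[OF L[OF _ y] L[OF _ y'] U] U _ c])
      (simp_all add: Lg y y' yy lin_add[OF lin])
next
  have cl: "x \<in> X \<Longrightarrow> y \<in> carrier Y \<Longrightarrow> g x y \<in> carrier U" for x y
    using lin_closed[OF lin] .
  note L = free_lift_lin[OF U cl] and Lg = free_lift_gen[OF U _ cl]
  fix a y assume a: "a \<in> carrier K" and y: "y \<in> carrier Y"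
  have ay: "a \<odot>\<^bsub>Y\<^esub> y \<in> carrier Y" by (rule module_closed(4)[OF Y a y])
  show "free_lift U (\<lambda>x. g x (a \<odot>\<^bsub>Y\<^esub> y)) c = a \<odot>\<^bsub>U\<^esub> free_lift U (\<lambda>x. g x y) c"
    by (rule free_eqI[OF L[OF _ ay] lin_scale[OF L[OF _ y] a U] U _ c])
      (simp_all add: Lg y a ay lin_smult[OF lin])
qed

text \<open>The monoid algebra of the free commutative monoid on the type of indeterminates; the
  product extends addition of multisets bilinearly. With \<open>nat\<close> as indeterminates,
  cosets of such functions are exactly of the type \<open>poly_cosets\<close>.\<close>

definition polys :: "('a, 'x multiset \<Rightarrow> 'a) module" where
  "polys = (FM UNIV)
    \<lparr>mult := \<lambda>c d. free_lift (FM UNIV) (\<lambda>m. free_lift (FM UNIV) (\<lambda>n. free_gen K (m + n)) d) c,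
     one := free_gen K {#}\<rparr>"

lemma polys_simps:
  "carrier polys = carrier (FM UNIV)" "lin polys U = lin (FM UNIV) U" "lin U polys = lin U (FM UNIV)"
  "\<one>\<^bsub>polys\<^esub> = free_gen K {#}"
  by (simp_all add: polys_def linear_maps_def)

lemma polys_mod: "module K polys"
  by (rule module_cong[OF free_mod[of UNIV]]) (simp_all add: polys_def)

lemma polys_gen: "free_gen K m \<in> carrier polys"
  by (simp add: polys_simps free_gen_closed)

lemma polys_eqI:
  assumes "f \<in> lin polys U" "g \<in> lin polys U" "module K U"
    and "\<And>m. f (free_gen K m) = g (free_gen K m)" and "c \<in> carrier polys"
  shows "f c = g c"
  using assms by (intro free_eqI[of f UNIV U g c]) (simp_all add: polys_simps)

lemma polys_bil: "bil polys polys polys (mult polys)"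
proof (rule bilI)
  have inner: "free_lift (FM UNIV) (\<lambda>n. free_gen K (m + n)) \<in> lin polys (FM UNIV)" for m :: "'x multiset"
    unfolding polys_simps by (rule free_lift_lin[OF free_mod]) (simp add: free_gen_closed)
  fix c :: "'x multiset \<Rightarrow> 'a" assume c: "c \<in> carrier polys"
  then have c': "c \<in> carrier (FM UNIV)" by (simp add: polys_simps)
  have "(\<lambda>d. free_lift (FM UNIV) (\<lambda>m. free_lift (FM UNIV) (\<lambda>n. free_gen K (m + n)) d) c) \<in> lin polys (FM UNIV)"
    by (rule free_lift_param[OF free_mod polys_mod inner c'])
  then show "mult polys c \<in> lin polys polys" by (simp add: polys_simps(3)) (simp add: polys_def)
  have "free_lift (FM UNIV) (\<lambda>m. free_lift (FM UNIV) (\<lambda>n. free_gen K (m + n)) c) \<in> lin polys (FM UNIV)"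
    unfolding polys_simps by (rule free_lift_lin[OF free_mod])
      (rule lin_closed[OF inner[unfolded polys_simps] c'])
  then show "(\<lambda>d. d \<otimes>\<^bsub>polys\<^esub> c) \<in> lin polys polys" by (simp add: polys_simps(3)) (simp add: polys_def)
qed

lemma polys_mult_gen: "free_gen K m \<otimes>\<^bsub>polys\<^esub> free_gen K n = free_gen K (m + n)"
  by (simp add: polys_def free_lift_gen[where X = UNIV] free_mod free_gen_closed)

lemma polys_alg: "alg (polys :: ('a, 'x multiset \<Rightarrow> 'a) module)"
proof (rule algI[OF polys_mod _ bilD(2)[OF polys_bil]])
  let ?R = "polys :: ('a, 'x multiset \<Rightarrow> 'a) module"
  note b = polys_bil
  show "\<one>\<^bsub>?R\<^esub> \<in> carrier ?R" by (simp add: polys_simps free_gen_closed)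
  then show "\<one>\<^bsub>?R\<^esub> \<otimes>\<^bsub>?R\<^esub> c = c" if "c \<in> carrier ?R" for c
    by (intro polys_eqI[OF bilD(1)[OF b] lin_id(1) polys_mod _ that])
      (simp_all add: polys_simps(4) polys_mult_gen)
  fix c d assume c: "c \<in> carrier ?R" and d: "d \<in> carrier ?R"
  have "free_gen K m \<otimes>\<^bsub>?R\<^esub> d = d \<otimes>\<^bsub>?R\<^esub> free_gen K m" for m
    by (rule polys_eqI[OF bilD(1)[OF b polys_gen] bilD(2)[OF b polys_gen] polys_mod _ d])
      (simp add: polys_mult_gen add.commute)
  then show "c \<otimes>\<^bsub>?R\<^esub> d = d \<otimes>\<^bsub>?R\<^esub> c"
    by (rule polys_eqI[OF bilD(2)[OF b d] bilD(1)[OF b d] polys_mod _ c])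
  fix e assume e: "e \<in> carrier ?R"
  \<comment> \<open>Associativity is reduced to monomials in one argument at a time:
    \<open>e\<close> here, then \<open>d\<close>, finally \<open>c\<close>.\<close>
  have 1: "free_gen K m \<otimes>\<^bsub>?R\<^esub> free_gen K n \<otimes>\<^bsub>?R\<^esub> e = free_gen K m \<otimes>\<^bsub>?R\<^esub> (free_gen K n \<otimes>\<^bsub>?R\<^esub> e)" for m n
    by (rule polys_eqI[OF bilD(1)[OF b] lin_comp[OF bilD(1)[OF b] bilD(1)[OF b]] polys_mod _ e])
      (simp_all add: polys_mult_gen polys_gen add.assoc)
  have 2: "free_gen K m \<otimes>\<^bsub>?R\<^esub> d \<otimes>\<^bsub>?R\<^esub> e = free_gen K m \<otimes>\<^bsub>?R\<^esub> (d \<otimes>\<^bsub>?R\<^esub> e)" for m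
    by (rule polys_eqI[OF lin_comp[OF bilD(2)[OF b e] bilD(1)[OF b polys_gen]]
          lin_comp[OF bilD(1)[OF b polys_gen] bilD(2)[OF b e]] polys_mod 1 d])
  show "c \<otimes>\<^bsub>?R\<^esub> d \<otimes>\<^bsub>?R\<^esub> e = c \<otimes>\<^bsub>?R\<^esub> (d \<otimes>\<^bsub>?R\<^esub> e)"
    by (rule polys_eqI[OF lin_comp[OF bilD(2)[OF b e] bilD(2)[OF b d]]
          bilD(2)[OF b bil_closed[OF b d e]] polys_mod 2 c])
qed

definition monomial_value where
  "monomial_value A v m = finprod A (\<lambda>x. v x [^]\<^bsub>A\<^esub> count m x) (set_mset m)"

context
  fixes A :: "('a, 'y, 's) module_scheme" and v :: "'x \<Rightarrow> 'y"
  assumes A: "alg A" and v: "\<And>x. v x \<in> carrier A"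
begin

interpretation A: algebra K A by (rule A)

lemma monomial_value_closed: "monomial_value A v m \<in> carrier A"
  unfolding monomial_value_def by (rule A.finprod_closed) (simp add: v)

lemma monomial_value_single: "monomial_value A v {#x#} = v x"
  by (simp add: monomial_value_def v)

lemma monomial_value_empty: "monomial_value A v {#} = \<one>\<^bsub>A\<^esub>"
  by (simp add: monomial_value_def)

lemma monomial_value_add: "monomial_value A v (m + n) = monomial_value A v m \<otimes>\<^bsub>A\<^esub> monomial_value A v n"
proof -
  let ?S = "set_mset m \<union> set_mset n"
  \<comment> \<open>Indeterminates absent from \<open>k\<close> contribute zeroth powers, so all
    three monomials can be evaluated over one index set.\<close>
  have *: "monomial_value A v k = finprod A (\<lambda>x. v x [^]\<^bsub>A\<^esub> count k x) ?S" if "set_mset k \<subseteq> ?S" for k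
    unfolding monomial_value_def using that
    by (intro A.finprod_mono_neutral_cong_left) (auto simp: v not_in_iff)
  have "monomial_value A v (m + n) = finprod A (\<lambda>x. v x [^]\<^bsub>A\<^esub> count m x \<otimes>\<^bsub>A\<^esub> v x [^]\<^bsub>A\<^esub> count n x) ?S"
    by (subst *) (simp_all add: v A.nat_pow_mult)
  also have "\<dots> = monomial_value A v m \<otimes>\<^bsub>A\<^esub> monomial_value A v n"
    by (simp add: * A.finprod_multf v)
  finally show ?thesis .
qed

definition poly_eval where "poly_eval = free_lift A (monomial_value A v)"

lemma poly_eval_gen: "poly_eval (free_gen K m) = monomial_value A v m"
  unfolding poly_eval_def by (rule free_lift_gen[OF alg_mod[OF A] UNIV_I monomial_value_closed])

lemma poly_eval_alghom: "poly_eval \<in> alghom polys A"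
proof (rule alghomI)
  show L: "poly_eval \<in> lin polys A"
    unfolding poly_eval_def polys_simps by (rule free_lift_lin[OF alg_mod[OF A] monomial_value_closed])
  show "poly_eval \<one>\<^bsub>polys\<^esub> = \<one>\<^bsub>A\<^esub>" by (simp add: polys_simps poly_eval_gen monomial_value_empty)
  note b = polys_bil and bA = alg_bil[OF A]
  fix c d :: "'x multiset \<Rightarrow> 'a" assume c: "c \<in> carrier polys" and d: "d \<in> carrier polys"
  have "poly_eval (free_gen K m \<otimes>\<^bsub>polys\<^esub> d) = poly_eval (free_gen K m) \<otimes>\<^bsub>A\<^esub> poly_eval d" for m
    by (rule polys_eqI[OF lin_comp[OF L bilD(1)[OF b polys_gen]]
          lin_comp[OF bilD(1)[OF bA] L] alg_mod[OF A] _ d])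
      (simp_all add: poly_eval_gen polys_mult_gen monomial_value_add monomial_value_closed)
  then show "poly_eval (c \<otimes>\<^bsub>polys\<^esub> d) = poly_eval c \<otimes>\<^bsub>A\<^esub> poly_eval d"
    by (rule polys_eqI[OF lin_comp[OF L bilD(2)[OF b d]]
          lin_comp[OF bilD(2)[OF bA lin_closed[OF L d]] L] alg_mod[OF A] _ c])
qed

end

lemma polys_free:
  assumes "alg A" "\<And>x. v x \<in> carrier A"
  obtains f where "f \<in> alghom polys A" "\<And>x. f (free_gen K {#x#}) = v x"
  by (rule that[OF poly_eval_alghom[OF assms]])
    (simp add: poly_eval_gen[OF assms] monomial_value_single[OF assms])

lemma polys_alghom_eqI:
  assumes A: "alg A" and f: "f \<in> alghom polys A" and g: "g \<in> alghom polys A"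
    and eq: "\<And>x. f (free_gen K {#x#}) = g (free_gen K {#x#})" and c: "c \<in> carrier polys"
  shows "f c = g c"
proof (rule polys_eqI[OF alghom_lin[OF f] alghom_lin[OF g] alg_mod[OF A] _ c])
  fix m show "f (free_gen K m) = g (free_gen K m)"
  proof (induction m)
    case empty
    then show ?case using alghom_one[OF f] alghom_one[OF g] by (simp add: polys_simps)
  next
    case (add x m)
    have "f (free_gen K {#x#} \<otimes>\<^bsub>polys\<^esub> free_gen K m) = g (free_gen K {#x#} \<otimes>\<^bsub>polys\<^esub> free_gen K m)"
      by (simp add: alghom_mult[OF f] alghom_mult[OF g] polys_gen eq add)
    then show ?case by (simp add: polys_mult_gen)
  qed
qed

section \<open>Quotient algebras\<close>

text \<open>The parameter \<open>z\<close> leaves room for the Hopf operations in the record.\<close>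

definition quotient_algebra where
  "quotient_algebra R N z =
    \<lparr>carrier = carrier (quotient_module R N), mult = rcoset_mult R N, one = N +>\<^bsub>R\<^esub> \<one>\<^bsub>R\<^esub>,
     zero = zero (quotient_module R N), add = add (quotient_module R N),
     smult = smult (quotient_module R N), \<dots> = z\<rparr>"

text \<open>An ideal is closed under ring multiplication; a scalar \<open>a\<close> acts as
  multiplication by \<open>a\<close> times the unit of \<open>R\<close>.\<close>

lemma ideal_submodule:
  assumes R: "alg R" and N: "ideal N R"
  shows "submodule N K R"
proof -
  interpret R: algebra K R by (rule R)
  interpret N: ideal N R by (rule N)
  show ?thesis
  proof (rule R.submoduleI)
    show "N \<subseteq> carrier R" by (rule N.a_subset)
    fix a x assume a: "a \<in> carrier K" and x: "x \<in> N"
    then have "a \<odot>\<^bsub>R\<^esub> x = (a \<odot>\<^bsub>R\<^esub> \<one>\<^bsub>R\<^esub>) \<otimes>\<^bsub>R\<^esub> x"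
      by (simp add: R.smult_assoc2 N.Icarr)
    then show "a \<odot>\<^bsub>R\<^esub> x \<in> N" using a x by (simp add: N.I_l_closed)
  qed auto
qed

context
  fixes R :: "('a, 'y, 's) module_scheme" and N
  assumes R: "alg R" and N: "ideal N R"
begin

private lemmas mR = alg_mod[OF R]
private lemmas sub = ideal_submodule[OF R N]
private lemmas qmod = quotient_mod[OF mR sub]

abbreviation "Q z \<equiv> quotient_algebra R N z"

lemma qalg_simps:
  "carrier (Q z) = carrier (quotient_module R N)"
  "lin (Q z) U = lin (quotient_module R N) U" "lin U (Q z) = lin U (quotient_module R N)"
  "\<one>\<^bsub>Q z\<^esub> = N +>\<^bsub>R\<^esub> \<one>\<^bsub>R\<^esub>"
  by (simp_all add: quotient_algebra_def linear_maps_def)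

lemma qalg_mod: "module K (Q z)"
  by (rule module_cong[OF qmod]) (simp_all add: quotient_algebra_def)

lemma qalg_mult: "x \<in> carrier R \<Longrightarrow> y \<in> carrier R \<Longrightarrow>
    (N +>\<^bsub>R\<^esub> x) \<otimes>\<^bsub>Q z\<^esub> (N +>\<^bsub>R\<^esub> y) = N +>\<^bsub>R\<^esub> (x \<otimes>\<^bsub>R\<^esub> y)"
  using ideal.rcoset_mult_add[OF N] by (simp add: quotient_algebra_def)

lemma qproj_lin: "(\<lambda>x. N +>\<^bsub>R\<^esub> x) \<in> lin R (Q z)"
  unfolding qalg_simps by (rule quotient_proj[OF mR sub])

lemma qalg_cases:
  assumes "X \<in> carrier (Q z)"
  obtains x where "x \<in> carrier R" "X = N +>\<^bsub>R\<^esub> x"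
  using quotient_cases[OF mR sub, of X] assms unfolding qalg_simps by metis

lemma qalg_alg: "alg (Q z)"
proof (rule algI[OF qalg_mod])
  note cl = lin_closed[OF qproj_lin[of z]] and mb = alg_simps[OF R]
  show "\<one>\<^bsub>Q z\<^esub> \<in> carrier (Q z)" by (simp only: qalg_simps(4) cl mb)
  fix X assume "X \<in> carrier (Q z)"
  then obtain x where x: "x \<in> carrier R" "X = N +>\<^bsub>R\<^esub> x" by (rule qalg_cases)
  show "\<one>\<^bsub>Q z\<^esub> \<otimes>\<^bsub>Q z\<^esub> X = X" by (simp only: x qalg_simps(4) qalg_mult mb)
  fix Y assume "Y \<in> carrier (Q z)"
  then obtain y where y: "y \<in> carrier R" "Y = N +>\<^bsub>R\<^esub> y" by (rule qalg_cases)
  show "X \<otimes>\<^bsub>Q z\<^esub> Y = Y \<otimes>\<^bsub>Q z\<^esub> X" by (simp only: x y qalg_mult alg_comm[OF R, of x y])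
  fix Z assume "Z \<in> carrier (Q z)"
  then obtain w where w: "w \<in> carrier R" "Z = N +>\<^bsub>R\<^esub> w" by (rule qalg_cases)
  show "X \<otimes>\<^bsub>Q z\<^esub> Y \<otimes>\<^bsub>Q z\<^esub> Z = X \<otimes>\<^bsub>Q z\<^esub> (Y \<otimes>\<^bsub>Q z\<^esub> Z)"
    by (simp only: x y w qalg_mult mb)
next
  fix Y assume "Y \<in> carrier (Q z)"
  then obtain y where y: "y \<in> carrier R" "Y = N +>\<^bsub>R\<^esub> y" by (rule qalg_cases)
  note m = alg_simps(2)[OF R] module_closed[OF mR] and l = bilD(2)[OF alg_bil[OF R] y(1)]
  show "(\<lambda>X. X \<otimes>\<^bsub>Q z\<^esub> Y) \<in> lin (Q z) (Q z)"
  proof (rule linI)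
    fix X assume "X \<in> carrier (Q z)"
    then obtain x where x: "x \<in> carrier R" "X = N +>\<^bsub>R\<^esub> x" by (rule qalg_cases)
    show "X \<otimes>\<^bsub>Q z\<^esub> Y \<in> carrier (Q z)" by (simp only: x y qalg_mult lin_closed[OF qproj_lin] m)
    show "(a \<odot>\<^bsub>Q z\<^esub> X) \<otimes>\<^bsub>Q z\<^esub> Y = a \<odot>\<^bsub>Q z\<^esub> (X \<otimes>\<^bsub>Q z\<^esub> Y)" if "a \<in> carrier K" for a
      by (simp only: x y that qalg_mult lin_smult[OF qproj_lin, symmetric] m lin_smult[OF l])
    fix W assume "W \<in> carrier (Q z)"
    then obtain w where w: "w \<in> carrier R" "W = N +>\<^bsub>R\<^esub> w" by (rule qalg_cases)
    show "(X \<oplus>\<^bsub>Q z\<^esub> W) \<otimes>\<^bsub>Q z\<^esub> Y = X \<otimes>\<^bsub>Q z\<^esub> Y \<oplus>\<^bsub>Q z\<^esub> W \<otimes>\<^bsub>Q z\<^esub> Y"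
      by (simp only: x y w qalg_mult lin_add[OF qproj_lin, symmetric] m lin_add[OF l])
  qed
qed

lemma qproj_alghom: "(\<lambda>x. N +>\<^bsub>R\<^esub> x) \<in> alghom R (Q z)"
  by (rule alghomI[OF qproj_lin]) (simp_all only: qalg_mult qalg_simps(4))

lemma qproj_zero: "x \<in> N \<Longrightarrow> N +>\<^bsub>R\<^esub> x = \<zero>\<^bsub>Q z\<^esub>"
  using abelian_subgroup.a_rcos_const[OF submodule_abelian_subgroup[OF mR sub]]
  by (simp add: quotient_algebra_def quotient_module_def)

lemma qproj_eq: "x \<in> carrier R \<Longrightarrow> y \<in> carrier R \<Longrightarrow> x \<ominus>\<^bsub>R\<^esub> y \<in> N \<Longrightarrow> N +>\<^bsub>R\<^esub> x = N +>\<^bsub>R\<^esub> y"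
  by (simp add: coset_eq_iff[OF mR sub])

lemma qalg_lift:
  assumes A: "alg A" and f: "f \<in> alghom R A" and zero: "\<And>x. x \<in> N \<Longrightarrow> f x = \<zero>\<^bsub>A\<^esub>"
  obtains g where "g \<in> alghom (Q z) A" "\<And>x. x \<in> carrier R \<Longrightarrow> g (N +>\<^bsub>R\<^esub> x) = f x"
proof -
  let ?g = "\<lambda>X. the_elem (f ` X)"
  note eq = quotient_lift[OF mR sub alghom_lin[OF f] alg_mod[OF A] zero]
  have lin: "?g \<in> lin (Q z) A"
    unfolding qalg_simps by (rule quotient_lift_lin[OF mR sub alghom_lin[OF f] alg_mod[OF A] zero])
  have "?g \<in> alghom (Q z) A"
  proof (rule alghomI[OF lin])
    show "?g \<one>\<^bsub>Q z\<^esub> = \<one>\<^bsub>A\<^esub>" by (simp only: qalg_simps(4) eq alg_simps[OF R] alghom_one[OF f])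
    fix X Y assume "X \<in> carrier (Q z)" "Y \<in> carrier (Q z)"
    then obtain x y where x: "x \<in> carrier R" "X = N +>\<^bsub>R\<^esub> x" and y: "y \<in> carrier R" "Y = N +>\<^bsub>R\<^esub> y"
      by (metis qalg_cases)
    show "?g (X \<otimes>\<^bsub>Q z\<^esub> Y) = ?g X \<otimes>\<^bsub>A\<^esub> ?g Y"
      by (simp only: x y qalg_mult eq alg_simps(1,2)[OF R] alghom_mult[OF f])
  qed
  then show thesis by (rule that) (rule eq)
qed

end

text \<open>The kernel of \<open>f\<close> is an ideal containing \<open>S\<close>, hence contains
  the smallest such ideal.\<close>

lemma genideal_kernel:
  assumes R: "alg R" and A: "alg A" and f: "f \<in> alghom R A" and S: "S \<subseteq> carrier R"
    and zero: "\<And>x. x \<in> S \<Longrightarrow> f x = \<zero>\<^bsub>A\<^esub>" and x: "x \<in> genideal R S"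
  shows "f x = \<zero>\<^bsub>A\<^esub>"
proof -
  interpret R: algebra K R by (rule R)
  interpret A: algebra K A by (rule A)
  have "submodule {x \<in> carrier R. f x = \<zero>\<^bsub>A\<^esub>} K R"
    by (rule submodule_kernel[OF alghom_lin[OF f] alg_mod[OF R] alg_mod[OF A]])
  then have "ideal {x \<in> carrier R. f x = \<zero>\<^bsub>A\<^esub>} R"
    by (intro idealI) (auto simp: submodule.axioms alghom_mult[OF f] alghom_closed[OF f] R.ring_axioms)
  then have "genideal R S \<subseteq> {x \<in> carrier R. f x = \<zero>\<^bsub>A\<^esub>}"
    by (rule R.genideal_minimal) (use S zero in auto)
  then show ?thesis using x by auto
qed

end

section \<open>Dual bases and coordinates\<close>

text \<open>A spanning set of least cardinality is linearly independent, so forming linear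
  combinations is a bijection from the free module on it. The functionals are the coordinates of the
  inverse map.\<close>

lemma dual_basis:
  fixes K (structure) and V (structure)
  assumes "field K" and V: "module K V" and fd: "finite_dimensional K V"
  obtains B e where "finite B" "B \<subseteq> carrier V"
    "\<And>b. b \<in> B \<Longrightarrow> e b \<in> linear_maps K V (base_algebra K)"
    "\<And>v. v \<in> carrier V \<Longrightarrow> v = (\<Oplus>\<^bsub>V\<^esub>b\<in>B. e b v \<odot>\<^bsub>V\<^esub> b)"
proof -
  interpret K: field K by fact
  interpret base_ring K by unfold_locales
  interpret V: module K V by fact
  define L where "L = free_lift V (\<lambda>b. b)"
  define spans where "spans B \<longleftrightarrow> finite B \<and> B \<subseteq> carrier V \<and> carrier V \<subseteq> L ` carrier (FM B)" for B
  have L_lin: "L \<in> lin (FM B) V" if "B \<subseteq> carrier V" for B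
    unfolding L_def using that by (intro free_lift_lin[OF V]) auto
  have L_sum: "L c = (\<Oplus>\<^bsub>V\<^esub>b\<in>B. c b \<odot>\<^bsub>V\<^esub> b)" if "finite B" "B \<subseteq> carrier V" "c \<in> carrier (FM B)" for B c
    unfolding L_def using that by (intro free_lift_eq[OF V, where X = B]) (auto simp: free_carrier)
  obtain B0 where B0: "finite B0" "B0 \<subseteq> carrier V"
    and span0: "\<And>v. v \<in> carrier V \<Longrightarrow> \<exists>c\<in>B0 \<rightarrow> carrier K. v = (\<Oplus>\<^bsub>V\<^esub>b\<in>B0. c b \<odot>\<^bsub>V\<^esub> b)"
    using fd unfolding finite_dimensional_def by blast
  have "spans B0"
    unfolding spans_def
  proof (intro conjI B0 subsetI)
    fix v assume "v \<in> carrier V"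
    then obtain c where c: "c \<in> B0 \<rightarrow> carrier K" "v = (\<Oplus>\<^bsub>V\<^esub>b\<in>B0. c b \<odot>\<^bsub>V\<^esub> b)" using span0 by blast
    \<comment> \<open>Elements of \<open>FM B0\<close> must vanish off \<open>B0\<close>, so the
      given coefficients are extended by zero.\<close>
    let ?d = "\<lambda>b. if b \<in> B0 then c b else \<zero>\<^bsub>K\<^esub>"
    have d: "?d \<in> carrier (FM B0)" using c(1) B0(1) by (auto simp: free_carrier)
    have "L ?d = (\<Oplus>\<^bsub>V\<^esub>b\<in>B0. c b \<odot>\<^bsub>V\<^esub> b)"
      unfolding L_sum[OF B0 d] using c(1) B0(2) by (intro V.finsum_cong') auto
    then show "v \<in> L ` carrier (FM B0)" using d c(2) by force
  qed
  then obtain B where B: "spans B" and minimal: "\<And>B'. spans B' \<Longrightarrow> card B \<le> card B'"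
    using ex_has_least_nat[of spans B0 card] by blast
  then have fin: "finite B" and sub: "B \<subseteq> carrier V" and surj: "carrier V \<subseteq> L ` carrier (FM B)"
    by (auto simp: spans_def)
  note lin = L_lin[OF sub]
  interpret F: module K "FM B" by (rule free_mod)
  \<comment> \<open>Exchange argument: a relation \<open>c\<close> with \<open>c b\<close> nonzero
    can be subtracted, scaled by \<open>u b\<close> over \<open>c b\<close>, from any combination
    \<open>u\<close>. This removes \<open>b\<close> from it, so \<open>B - {b}\<close> would already
    span, against minimality. Division in the field is used here.\<close>
  have kernel: "c b = \<zero>\<^bsub>K\<^esub>" if c: "c \<in> carrier (FM B)" "L c = \<zero>\<^bsub>V\<^esub>" and b: "b \<in> B" for c b
  proof (rule ccontr)
    assume "c b \<noteq> \<zero>\<^bsub>K\<^esub>"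
    then have unit: "c b \<in> Units K" using c(1) K.field_Units by (auto simp: free_carrier)
    have "spans (B - {b})"
      unfolding spans_def
    proof (intro conjI subsetI)
      fix v assume v: "v \<in> carrier V"
      then obtain u where u: "u \<in> carrier (FM B)" "L u = v" using surj by auto
      define a where "a = u b \<otimes>\<^bsub>K\<^esub> inv\<^bsub>K\<^esub> (c b)"
      define w where "w = u \<oplus>\<^bsub>FM B\<^esub> ((\<ominus>\<^bsub>K\<^esub> a) \<odot>\<^bsub>FM B\<^esub> c)"
      have ub: "u b \<in> carrier K" "c b \<in> carrier K" using u c by (auto simp: free_carrier)
      have a: "a \<in> carrier K" using ub unit by (simp add: a_def)
      have w: "w \<in> carrier (FM B)" using u c a by (simp add: w_def)
      have "a \<otimes>\<^bsub>K\<^esub> c b = u b" using ub unit by (simp add: a_def K.m_assoc)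
      then have "w b = \<zero>\<^bsub>K\<^esub>" using ub a by (simp add: w_def free_simps K.l_minus K.r_neg)
      then have w': "w \<in> carrier (FM (B - {b}))" using w by (auto simp: free_carrier)
      have "L w = v" using u c a
        by (simp add: w_def lin_add[OF lin] lin_smult[OF lin] module_simps[OF V] v)
      then show "v \<in> L ` carrier (FM (B - {b}))" using w' by blast
    qed (use fin sub in auto)
    then have "card B \<le> card (B - {b})" by (rule minimal)
    then show False using card_Diff1_less[OF fin b] by linarith
  qed
  have inj: "inj_on L (carrier (FM B))"
  proof (rule inj_onI)
    fix c d assume cd: "c \<in> carrier (FM B)" "d \<in> carrier (FM B)" "L c = L d"
    then have "L (c \<ominus>\<^bsub>FM B\<^esub> d) = \<zero>\<^bsub>V\<^esub>"
      using lin_closed[OF lin cd(2)] by (simp add: lin_diff[OF lin free_mod V] V.r_neg a_minus_def[of V])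
    moreover have z: "c \<ominus>\<^bsub>FM B\<^esub> d \<in> carrier (FM B)" using cd by simp
    ultimately have "(c \<ominus>\<^bsub>FM B\<^esub> d) b = \<zero>\<^bsub>K\<^esub>" for b
      using kernel[of "c \<ominus>\<^bsub>FM B\<^esub> d" b] z by (cases "b \<in> B") (auto simp: free_carrier)
    then have "c \<ominus>\<^bsub>FM B\<^esub> d = \<zero>\<^bsub>FM B\<^esub>" by (auto simp: free_simps)
    then show "c = d" using cd by (metis F.a_inv_closed F.add.inv_equality F.minus_minus a_minus_def)
  qed
  define G where "G = inv_into (carrier (FM B)) L"
  have G: "G v \<in> carrier (FM B)" "L (G v) = v" if "v \<in> carrier V" for v
    using surj that by (auto simp: G_def inv_into_into f_inv_into_f)
  have G_lin: "G \<in> lin V (FM B)"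
  proof (rule linI)
    fix x assume x: "x \<in> carrier V"
    show "G x \<in> carrier (FM B)" by (rule G(1)[OF x])
    fix y assume y: "y \<in> carrier V"
    show "G (x \<oplus>\<^bsub>V\<^esub> y) = G x \<oplus>\<^bsub>FM B\<^esub> G y"
      by (rule inj_onD[OF inj]) (simp_all add: G x y lin_add[OF lin])
  next
    fix a x assume a: "a \<in> carrier K" and x: "x \<in> carrier V"
    show "G (a \<odot>\<^bsub>V\<^esub> x) = a \<odot>\<^bsub>FM B\<^esub> G x"
      by (rule inj_onD[OF inj]) (simp_all add: G x a lin_smult[OF lin])
  qed
  have ev: "(\<lambda>c. c b) \<in> lin (FM B) (base_algebra K)" for b
    by (rule linI) (auto simp: free_carrier free_simps base_algebra_def)
  show thesis
  proof (rule that[OF fin sub])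
    show "(\<lambda>v. G v b) \<in> lin V (base_algebra K)" for b by (rule lin_comp[OF ev G_lin])
    show "v = (\<Oplus>\<^bsub>V\<^esub>b\<in>B. G v b \<odot>\<^bsub>V\<^esub> b)" if "v \<in> carrier V" for v
      using G[OF that] L_sum[OF fin sub] by simp
  qed
qed

text \<open>The assumptions are those of a dual basis of a finitely generated projective module: an
  expansion of each vector through finitely many functionals. This form survives base change
  directly, see \<open>coord_expand\<close>.\<close>

locale dual_space = base_space K P Ops
  for K (structure) and P :: "('a, 'p, 'r) module_scheme" and Ops +
  fixes B :: "'p set" and e :: "'p \<Rightarrow> 'p \<Rightarrow> 'a"
  assumes B: "finite B" "B \<subseteq> carrier P"
    and e: "b \<in> B \<Longrightarrow> e b \<in> linear_maps K P (base_algebra K)"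
    and expand: "p \<in> carrier P \<Longrightarrow> p = (\<Oplus>\<^bsub>P\<^esub>b\<in>B. e b p \<odot>\<^bsub>P\<^esub> b)"
begin

lemma B_closed: "b \<in> B \<Longrightarrow> b \<in> carrier P" using B by auto

lemma e_closed: "b \<in> B \<Longrightarrow> p \<in> carrier P \<Longrightarrow> e b p \<in> carrier K"
  using lin_closed[OF e] by (simp add: base_algebra_def)

text \<open>The second index of \<open>h\<close> numbers the columns: column \<open>i\<close> lists
  the coefficients, in \<open>A\<close>, of the image attached to \<open>i\<close>.\<close>

definition matrix_map where
  "matrix_map A h p = (\<Oplus>\<^bsub>P \<boxtimes> A\<^esub>i\<in>B. e i p \<odot>\<^bsub>P \<boxtimes> A\<^esub> (\<Oplus>\<^bsub>P \<boxtimes> A\<^esub>b\<in>B. pt P A b (h b i)))"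

text \<open>The base change of the functional \<open>e b\<close> to \<open>A\<close>.\<close>

definition coord where "coord A b = tlift P A A (\<lambda>p x. e b p \<odot>\<^bsub>A\<^esub> x)"

context
  fixes A :: "('a, 'x, 's) module_scheme"
  assumes mA: "module K A"
begin

private lemmas T = tensor_mod[OF P mA]

lemma coord_bil: "b \<in> B \<Longrightarrow> bil P A A (\<lambda>p x. e b p \<odot>\<^bsub>A\<^esub> x)"
  by (rule bil_pre[OF bil_smult[OF mA] e lin_id(1)])

lemma coord_lin: "b \<in> B \<Longrightarrow> coord A b \<in> lin (P \<boxtimes> A) A"
  unfolding coord_def by (rule tlift_lin[OF P mA mA coord_bil])

lemma coord_pt: "b \<in> B \<Longrightarrow> p \<in> carrier P \<Longrightarrow> x \<in> carrier A \<Longrightarrow> coord A b (pt P A p x) = e b p \<odot>\<^bsub>A\<^esub> x"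
  unfolding coord_def by (rule tlift_pt[OF P mA mA coord_bil])

text \<open>The expansion in \<open>P\<close> tensored with \<open>A\<close>: on
  \<open>p \<otimes> x\<close> the scalars \<open>e b p\<close> move from the right factor to the
  left one, where they reassemble \<open>p\<close>.\<close>

lemma coord_expand:
  assumes t: "t \<in> carrier (P \<boxtimes> A)"
  shows "(\<Oplus>\<^bsub>P \<boxtimes> A\<^esub>b\<in>B. pt P A b (coord A b t)) = t"
proof (rule tensor_eqI[OF P mA lin_sum[OF lin_comp[OF bilD(1)[OF pt_bil[OF P mA]] coord_lin] T T] lin_id(1) T _ t])
  interpret T: module K "P \<boxtimes> A" by (rule T)
  fix p x assume p: "p \<in> carrier P" and x: "x \<in> carrier A"
  have "(\<Oplus>\<^bsub>P \<boxtimes> A\<^esub>b\<in>B. pt P A b (coord A b (pt P A p x))) = (\<Oplus>\<^bsub>P \<boxtimes> A\<^esub>b\<in>B. pt P A (e b p \<odot>\<^bsub>P\<^esub> b) x)"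
  proof (intro T.finsum_cong' refl funcsetI)
    fix b assume b: "b \<in> B"
    show "pt P A (e b p \<odot>\<^bsub>P\<^esub> b) x \<in> carrier (P \<boxtimes> A)"
      by (intro pt_closed[OF P mA] module_closed(4)[OF P] e_closed B_closed b p x)
    show "pt P A b (coord A b (pt P A p x)) = pt P A (e b p \<odot>\<^bsub>P\<^esub> b) x"
      using b p x by (simp add: coord_pt B_closed e_closed lin_smult[OF bilD(1)[OF pt_bil[OF P mA]]]
          lin_smult[OF bilD(2)[OF pt_bil[OF P mA]]])
  qed
  also have "\<dots> = pt P A (\<Oplus>\<^bsub>P\<^esub>b\<in>B. e b p \<odot>\<^bsub>P\<^esub> b) x"
    by (rule lin_finsum[OF bilD(2)[OF pt_bil[OF P mA] x] P T, symmetric])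
      (intro funcsetI module_closed(4)[OF P] e_closed B_closed p)
  also have "\<dots> = pt P A p x" using expand[OF p] by simp
  finally show "(\<Oplus>\<^bsub>P \<boxtimes> A\<^esub>b\<in>B. pt P A b (coord A b (pt P A p x))) = pt P A p x" .
qed (auto intro: B_closed)

lemma coord_eqI:
  assumes "s \<in> carrier (P \<boxtimes> A)" "t \<in> carrier (P \<boxtimes> A)" "\<And>b. b \<in> B \<Longrightarrow> coord A b s = coord A b t"
  shows "s = t"
proof -
  interpret T: module K "P \<boxtimes> A" by (rule T)
  have "(\<Oplus>\<^bsub>P \<boxtimes> A\<^esub>b\<in>B. pt P A b (coord A b s)) = (\<Oplus>\<^bsub>P \<boxtimes> A\<^esub>b\<in>B. pt P A b (coord A b t))"
    using assms by (intro T.finsum_cong') (auto intro!: pt_closed[OF P mA] B_closed lin_closed[OF coord_lin])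
  then show ?thesis by (simp add: coord_expand assms)
qed

lemma matrix_column_closed:
  assumes "\<And>b i. b \<in> B \<Longrightarrow> i \<in> B \<Longrightarrow> h b i \<in> carrier A" "i \<in> B"
  shows "(\<Oplus>\<^bsub>P \<boxtimes> A\<^esub>b\<in>B. pt P A b (h b i)) \<in> carrier (P \<boxtimes> A)"
proof -
  interpret T: module K "P \<boxtimes> A" by (rule T)
  show ?thesis by (rule T.finsum_closed) (auto intro!: pt_closed[OF P mA] B_closed assms)
qed

lemma matrix_map_lin:
  assumes "\<And>b i. b \<in> B \<Longrightarrow> i \<in> B \<Longrightarrow> h b i \<in> carrier A"
  shows "matrix_map A h \<in> lin P (P \<boxtimes> A)"
  unfolding matrix_map_def
  by (rule lin_sum[OF lin_scale_left[OF e matrix_column_closed[OF assms] T] P T])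

text \<open>Every linear map from \<open>P\<close> to \<open>P \<boxtimes> A\<close> is given by a
  finite matrix over \<open>A\<close>. This is where finite dimension makes the functor
  representable by a quotient of a polynomial ring.\<close>

lemma matrix_map_coord:
  assumes \<phi>: "\<phi> \<in> lin P (P \<boxtimes> A)" and p: "p \<in> carrier P"
  shows "matrix_map A (\<lambda>b i. coord A b (\<phi> i)) p = \<phi> p"
proof -
  interpret T: module K "P \<boxtimes> A" by (rule T)
  have "matrix_map A (\<lambda>b i. coord A b (\<phi> i)) p = (\<Oplus>\<^bsub>P \<boxtimes> A\<^esub>i\<in>B. \<phi> (e i p \<odot>\<^bsub>P\<^esub> i))"
    unfolding matrix_map_def
  proof (intro T.finsum_cong' refl funcsetI)
    fix i assume i: "i \<in> B"
    note cl = module_closed(4)[OF P e_closed[OF i p] B_closed[OF i]]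
    show "\<phi> (e i p \<odot>\<^bsub>P\<^esub> i) \<in> carrier (P \<boxtimes> A)" by (rule lin_closed[OF \<phi> cl])
    show "e i p \<odot>\<^bsub>P \<boxtimes> A\<^esub> (\<Oplus>\<^bsub>P \<boxtimes> A\<^esub>b\<in>B. pt P A b (coord A b (\<phi> i))) = \<phi> (e i p \<odot>\<^bsub>P\<^esub> i)"
      by (simp add: coord_expand lin_closed[OF \<phi>] B_closed i lin_smult[OF \<phi>] e_closed p)
  qed
  also have "\<dots> = \<phi> (\<Oplus>\<^bsub>P\<^esub>i\<in>B. e i p \<odot>\<^bsub>P\<^esub> i)"
    by (rule lin_finsum[OF \<phi> P T, symmetric])
      (intro funcsetI module_closed(4)[OF P] e_closed B_closed p)
  finally show ?thesis using expand[OF p] by simp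
qed

lemma matrix_map_cong:
  assumes "\<And>b i. b \<in> B \<Longrightarrow> i \<in> B \<Longrightarrow> h b i \<in> carrier A" 
    "\<And>b i. b \<in> B \<Longrightarrow> i \<in> B \<Longrightarrow> h b i = h' b i" and p: "p \<in> carrier P"
  shows "matrix_map A h p = matrix_map A h' p"
proof -
  interpret T: module K "P \<boxtimes> A" by (rule T)
  have *: "(\<Oplus>\<^bsub>P \<boxtimes> A\<^esub>b\<in>B. pt P A b (h b i)) = (\<Oplus>\<^bsub>P \<boxtimes> A\<^esub>b\<in>B. pt P A b (h' b i))" if "i \<in> B" for i
    using assms that by (intro T.finsum_cong') (auto intro!: pt_closed[OF P mA] B_closed)
  show ?thesis unfolding matrix_map_def
  proof (intro T.finsum_cong' refl funcsetI)
    fix i assume i: "i \<in> B"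
    show "e i p \<odot>\<^bsub>P \<boxtimes> A\<^esub> (\<Oplus>\<^bsub>P \<boxtimes> A\<^esub>b\<in>B. pt P A b (h b i)) =
       e i p \<odot>\<^bsub>P \<boxtimes> A\<^esub> (\<Oplus>\<^bsub>P \<boxtimes> A\<^esub>b\<in>B. pt P A b (h' b i))" by (simp only: * i)
    show "e i p \<odot>\<^bsub>P \<boxtimes> A\<^esub> (\<Oplus>\<^bsub>P \<boxtimes> A\<^esub>b\<in>B. pt P A b (h' b i)) \<in> carrier (P \<boxtimes> A)"
      using matrix_column_closed[of h, OF assms(1) i] by (simp add: * i e_closed p)
  qed
qed

end

lemma coord_push:
  assumes mA: "module K A" and mA': "module K A'" and f: "f \<in> lin A A'" and b: "b \<in> B"
    and t: "t \<in> carrier (P \<boxtimes> A)"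
  shows "coord A' b (push A A' f t) = f (coord A b t)"
  by (rule tensor_eqI[OF P mA lin_comp[OF coord_lin[OF mA' b] push_lin[OF mA mA' f]]
        lin_comp[OF f coord_lin[OF mA b]] mA' _ t])
    (simp add: coord_pt[OF mA b] coord_pt[OF mA' b] push_pt[OF mA mA' f] lin_smult[OF f] e_closed[OF b] lin_closed[OF f])

text \<open>Base change acts on a matrix entrywise; hence an algebra map out of \<open>polys\<close>
  turns the generic matrix into the matrix of the values of the variables.\<close>

lemma push_matrix_map:
  assumes mA: "module K A" and mA': "module K A'" and f: "f \<in> lin A A'"
    and h: "\<And>b i. b \<in> B \<Longrightarrow> i \<in> B \<Longrightarrow> h b i \<in> carrier A" and p: "p \<in> carrier P"
  shows "push A A' f (matrix_map A h p) = matrix_map A' (\<lambda>b i. f (h b i)) p"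
proof -
  note T = tensor_mod[OF P mA] and T' = tensor_mod[OF P mA'] and pl = push_lin[OF mA mA' f]
  interpret T': module K "P \<boxtimes> A'" by (rule T')
  have col: "push A A' f (\<Oplus>\<^bsub>P \<boxtimes> A\<^esub>b\<in>B. pt P A b (h b i)) = (\<Oplus>\<^bsub>P \<boxtimes> A'\<^esub>b\<in>B. pt P A' b (f (h b i)))"
    if i: "i \<in> B" for i
  proof -
    have "push A A' f (\<Oplus>\<^bsub>P \<boxtimes> A\<^esub>b\<in>B. pt P A b (h b i)) = (\<Oplus>\<^bsub>P \<boxtimes> A'\<^esub>b\<in>B. push A A' f (pt P A b (h b i)))"
      by (rule lin_finsum[OF pl T T']) (auto intro!: pt_closed[OF P mA] B_closed h i)
    also have "\<dots> = (\<Oplus>\<^bsub>P \<boxtimes> A'\<^esub>b\<in>B. pt P A' b (f (h b i)))"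
      by (intro T'.finsum_cong' refl funcsetI)
        (simp_all add: push_pt[OF mA mA' f] B_closed h i pt_closed[OF P mA'] lin_closed[OF f])
    finally show ?thesis .
  qed
  note cc = matrix_column_closed[of A h, OF mA h]
  have "push A A' f (matrix_map A h p) =
      (\<Oplus>\<^bsub>P \<boxtimes> A'\<^esub>i\<in>B. push A A' f (e i p \<odot>\<^bsub>P \<boxtimes> A\<^esub> (\<Oplus>\<^bsub>P \<boxtimes> A\<^esub>b\<in>B. pt P A b (h b i))))"
    unfolding matrix_map_def
    by (rule lin_finsum[OF pl T T']) (auto intro!: module_closed(4)[OF T] cc e_closed p)
  also have "\<dots> = matrix_map A' (\<lambda>b i. f (h b i)) p"
    unfolding matrix_map_def
    by (intro T'.finsum_cong' refl funcsetI)
      (simp_all add: lin_smult[OF pl] e_closed p cc col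
        matrix_column_closed[of A' "\<lambda>b i. f (h b i)", OF mA' lin_closed[OF f h]])
  finally show ?thesis .
qed

end

section \<open>The coordinate algebra of the automorphism group scheme\<close>

text \<open>\<open>code\<close> numbers the finitely many matrix entries, so that indeterminates can
  be natural numbers whatever the type of \<open>P\<close> is.\<close>

locale coordinate_ring = dual_space K P Ops B e
  for K (structure) and P :: "('a, 'p, 'r) module_scheme" and Ops B e +
  fixes code :: "bool \<times> 'p \<times> 'p \<Rightarrow> nat"
  assumes code: "inj_on code (UNIV \<times> B \<times> B)"
begin

text \<open>
  The variables \<open>var True b i\<close> are the entries of a generic matrix, \<open>var False b i\<close> those of its
  inverse.
\<close>

definition var where "var s b i = free_gen K {#code (s, b, i)#}"
definition generic where "generic s = matrix_map polys (var s)"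

text \<open>The equations in \<open>P \<boxtimes> polys\<close> that make the generic pair a point
  of \<open>autos\<close>: compatibility of the matrix with the operations, and both inverse laws,
  one for each value of \<open>s\<close>. \<open>relations\<close> imposes them one coordinate at a
  time.\<close>

definition pairs where "pairs =
  {(generic True (\<beta> x y), op P polys \<beta> (mult polys) (generic True x) (generic True y)) | \<beta> x y.
     \<beta> \<in> Ops \<and> x \<in> carrier P \<and> y \<in> carrier P} \<union>
  {(ext polys (generic s) (generic (\<not> s) p), iota polys p) | s p. p \<in> carrier P}"

text \<open>
  The second set of relations is needed because the functionals \<open>e b\<close> are not assumed to be dual to
  linearly independent elements. The last one kills the variables that are not matrix entries.
\<close>

definition relations where "relations =
  {coord polys b s \<ominus>\<^bsub>polys\<^esub> coord polys b t | b s t. b \<in> B \<and> (s, t) \<in> pairs} \<union>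
  {var s b i \<ominus>\<^bsub>polys\<^esub> coord polys b (generic s i) | s b i. b \<in> B \<and> i \<in> B} \<union>
  {free_gen K {#k#} | k. k \<notin> code ` (UNIV \<times> B \<times> B)}"

definition relation_ideal where "relation_ideal = genideal polys relations"
definition coord_alg where "coord_alg z = quotient_algebra polys relation_ideal z"
definition proj where "proj x = relation_ideal +>\<^bsub>polys\<^esub> x"
definition universal where "universal z s p = push polys (coord_alg z) proj (generic s p)"

lemma var_closed: "var s b i \<in> carrier polys"
  unfolding var_def by (rule polys_gen)

lemma generic_lin: "generic s \<in> lin P (P \<boxtimes> polys)"
  unfolding generic_def by (rule matrix_map_lin[OF polys_mod var_closed])

lemma pairs_cases:
  assumes "(s, t) \<in> pairs"
  obtains (op) \<beta> x y where "s = generic True (\<beta> x y)"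
      "t = op P polys \<beta> (mult polys) (generic True x) (generic True y)"
      "\<beta> \<in> Ops" "x \<in> carrier P" "y \<in> carrier P"
    | (inverse) u p where "s = ext polys (generic u) (generic (\<not> u) p)" "t = iota polys p" "p \<in> carrier P"
  using assms unfolding pairs_def by auto

lemma relationsI:
  "b \<in> B \<Longrightarrow> (s, t) \<in> pairs \<Longrightarrow> coord polys b s \<ominus>\<^bsub>polys\<^esub> coord polys b t \<in> relations"
  "b \<in> B \<Longrightarrow> i \<in> B \<Longrightarrow> var u b i \<ominus>\<^bsub>polys\<^esub> coord polys b (generic u i) \<in> relations"
  "k \<notin> code ` (UNIV \<times> B \<times> B) \<Longrightarrow> free_gen K {#k#} \<in> relations"
  unfolding relations_def by (rule UnI1, rule UnI1, blast) (rule UnI1, rule UnI2, blast, rule UnI2, blast)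

lemma relations_cases:
  assumes "x \<in> relations"
  obtains (pair) b s t where "x = coord polys b s \<ominus>\<^bsub>polys\<^esub> coord polys b t" "b \<in> B" "(s, t) \<in> pairs"
    | (entry) s b i where "x = var s b i \<ominus>\<^bsub>polys\<^esub> coord polys b (generic s i)" "b \<in> B" "i \<in> B"
    | (unused) k where "x = free_gen K {#k#}" "k \<notin> code ` (UNIV \<times> B \<times> B)"
  using assms unfolding relations_def by auto

lemma pairs_closed:
  assumes "(s, t) \<in> pairs"
  shows "s \<in> carrier (P \<boxtimes> polys)" "t \<in> carrier (P \<boxtimes> polys)"
proof -
  note gc = lin_closed[OF generic_lin]
  from assms have "s \<in> carrier (P \<boxtimes> polys) \<and> t \<in> carrier (P \<boxtimes> polys)"
  proof (cases rule: pairs_cases)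
    case (op \<beta> x y)
    then show ?thesis
      by (simp add: gc bil_closed[OF Ops] bil_closed[OF op_bil[OF P polys_mod Ops polys_bil]])
  next
    case (inverse u p)
    then show ?thesis
      by (simp add: gc lin_closed[OF ext_lin[OF polys_alg generic_lin]] lin_closed[OF iota_lin[OF polys_alg]])
  qed
  then show "s \<in> carrier (P \<boxtimes> polys)" "t \<in> carrier (P \<boxtimes> polys)" by auto
qed

lemma relations_closed: "relations \<subseteq> carrier polys"
proof
  fix x assume "x \<in> relations"
  then show "x \<in> carrier polys"
    by (cases rule: relations_cases)
      (simp_all add: module_closed(3)[OF polys_mod] var_closed polys_gen pairs_closed
        lin_closed[OF coord_lin[OF polys_mod]] lin_closed[OF generic_lin] B_closed)
qed

lemma relation_ideal: "ideal relation_ideal polys"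
proof -
  interpret R: algebra K "polys :: ('a, nat multiset \<Rightarrow> 'a) module" by (rule polys_alg)
  show ?thesis unfolding relation_ideal_def by (rule R.genideal_ideal[OF relations_closed])
qed

lemma relation_mem: "x \<in> relations \<Longrightarrow> x \<in> relation_ideal"
proof -
  interpret R: algebra K "polys :: ('a, nat multiset \<Rightarrow> 'a) module" by (rule polys_alg)
  show "x \<in> relations \<Longrightarrow> x \<in> relation_ideal"
    unfolding relation_ideal_def using R.genideal_self[OF relations_closed] by blast
qed

lemma coord_alg_alg: "alg (coord_alg z)"
  unfolding coord_alg_def by (rule qalg_alg[OF polys_alg relation_ideal])

lemma proj_alghom: "proj \<in> alghom polys (coord_alg z)"
  unfolding coord_alg_def proj_def[abs_def] by (rule qproj_alghom[OF polys_alg relation_ideal])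

lemma proj_eq: "x \<in> carrier polys \<Longrightarrow> y \<in> carrier polys \<Longrightarrow> x \<ominus>\<^bsub>polys\<^esub> y \<in> relations \<Longrightarrow> proj x = proj y"
  unfolding proj_def by (rule qproj_eq[OF polys_alg relation_ideal _ _ relation_mem])

lemma proj_surj:
  assumes "X \<in> carrier (coord_alg z)" obtains x where "x \<in> carrier polys" "X = proj x"
  using qalg_cases[OF polys_alg relation_ideal, of X] assms unfolding coord_alg_def proj_def by metis

text \<open>Coordinates determine a tensor and commute with base change, and the coordinates of
  \<open>s\<close> and \<open>t\<close> are congruent modulo the ideal.\<close>

lemma push_proj_pairs:
  assumes st: "(s, t) \<in> pairs"
  shows "push polys (coord_alg z) proj s = push polys (coord_alg z) proj t"
proof (rule coord_eqI[OF alg_mod[OF coord_alg_alg]])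
  note cl = pairs_closed[OF st] and pl = push_alghom_lin[OF polys_alg coord_alg_alg proj_alghom]
  show "push polys (coord_alg z) proj s \<in> carrier (P \<boxtimes> coord_alg z)"
    "push polys (coord_alg z) proj t \<in> carrier (P \<boxtimes> coord_alg z)"
    by (rule lin_closed[OF pl] cl)+
  fix b assume b: "b \<in> B"
  have "proj (coord polys b s) = proj (coord polys b t)"
    by (intro proj_eq lin_closed[OF coord_lin[OF polys_mod]] cl relationsI b st)
  then show "coord (coord_alg z) b (push polys (coord_alg z) proj s) =
      coord (coord_alg z) b (push polys (coord_alg z) proj t)"
    by (simp add: coord_push[OF polys_mod alg_mod[OF coord_alg_alg] alghom_lin[OF proj_alghom] b] cl)
qed

section \<open>The universal point and its universal property\<close>

lemma universal_lin: "universal z s \<in> lin P (P \<boxtimes> coord_alg z)"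
  unfolding universal_def[abs_def]
  by (rule lin_comp[OF push_alghom_lin[OF polys_alg coord_alg_alg proj_alghom] generic_lin])

text \<open>\<open>push_ext\<close>, \<open>push_op\<close> and \<open>push_iota\<close> rewrite
  each condition as the image under \<open>proj\<close> of an equation in
  \<open>pairs\<close>.\<close>

lemma universal_autos: "(universal z True, universal z False) \<in> autos (coord_alg z)"
proof (rule autosI[OF universal_lin universal_lin])
  note H = polys_alg coord_alg_alg[of z] proj_alghom[of z]
  note gc = lin_closed[OF generic_lin]
  have inv: "ext (coord_alg z) (universal z s) (universal z (\<not> s) p) = iota (coord_alg z) p"
    if p: "p \<in> carrier P" for s p
  proof -
    have "ext (coord_alg z) (universal z s) (universal z (\<not> s) p) =
        push polys (coord_alg z) proj (ext polys (generic s) (generic (\<not> s) p))"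
      unfolding universal_def[abs_def] by (rule push_ext[OF H generic_lin gc[OF p], symmetric])
    also have "\<dots> = push polys (coord_alg z) proj (iota polys p)"
      by (rule push_proj_pairs) (use p in \<open>auto simp: pairs_def\<close>)
    also have "\<dots> = iota (coord_alg z) p" by (rule push_iota[OF H p])
    finally show ?thesis .
  qed
  show "ext (coord_alg z) (universal z True) (universal z False p) = iota (coord_alg z) p"
    "ext (coord_alg z) (universal z False) (universal z True p) = iota (coord_alg z) p"
    if "p \<in> carrier P" for p
    using inv[OF that, of True] inv[OF that, of False] by simp_all
  fix \<beta> x y assume *: "\<beta> \<in> Ops" "x \<in> carrier P" "y \<in> carrier P"
  have "universal z True (\<beta> x y) =
      push polys (coord_alg z) proj (op P polys \<beta> (mult polys) (generic True x) (generic True y))"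
    unfolding universal_def by (rule push_proj_pairs) (use * in \<open>auto simp: pairs_def\<close>)
  also have "\<dots> = op P (coord_alg z) \<beta> (mult (coord_alg z)) (universal z True x) (universal z True y)"
    unfolding universal_def by (rule push_op[OF H *(1) gc[OF *(2)] gc[OF *(3)]])
  finally show "universal z True (\<beta> x y) =
      op P (coord_alg z) \<beta> (mult (coord_alg z)) (universal z True x) (universal z True y)" .
qed

text \<open>Existence: the variables are evaluated at the coordinates of \<open>\<phi>\<close> and
  \<open>\<psi>\<close>. The generic matrices then specialise to these two maps, so the conditions
  in \<open>autos\<close> are exactly what kills the relations.\<close>

lemma classify:
  fixes A :: "('a, 'x, 's) module_scheme" and z :: 'z
  assumes A: "alg A" and au: "(\<phi>, \<psi>) \<in> autos A"
  obtains f where "f \<in> alghom (coord_alg z) A"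
    "\<And>p. p \<in> carrier P \<Longrightarrow> push (coord_alg z) A f (universal z True p) = \<phi> p"
    "\<And>p. p \<in> carrier P \<Longrightarrow> push (coord_alg z) A f (universal z False p) = \<psi> p"
proof -
  note mA = alg_mod[OF A]
  interpret A: module K A by (rule mA)
  \<comment> \<open>Indexed by the same Boolean as the variables, so that the matrix and its inverse
    are handled together.\<close>
  define \<chi> where "\<chi> s = (if s then \<phi> else \<psi>)" for s
  have \<chi>: "\<chi> s \<in> lin P (P \<boxtimes> A)" for s using autosD(1,2)[OF au] by (simp add: \<chi>_def)
  define w where "w = (\<lambda>(s, b, i). coord A b (\<chi> s i))"
  \<comment> \<open>Numbers that code no matrix entry must go to zero, as demanded by the last
    family of relations.\<close>
  define v where "v k = (if k \<in> code ` (UNIV \<times> B \<times> B) then w (inv_into (UNIV \<times> B \<times> B) code k) else \<zero>\<^bsub>A\<^esub>)" for k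
  have cl: "coord A b (\<chi> s i) \<in> carrier A" if "b \<in> B" "i \<in> B" for s b i
    using that by (intro lin_closed[OF coord_lin[OF mA]] lin_closed[OF \<chi>] B_closed)
  have "v k \<in> carrier A" for k
  proof (cases "k \<in> code ` (UNIV \<times> B \<times> B)")
    case True
    then have "inv_into (UNIV \<times> B \<times> B) code k \<in> UNIV \<times> B \<times> B" by (rule inv_into_into)
    then show ?thesis using True by (auto simp: v_def w_def intro: cl)
  qed (simp add: v_def)
  then obtain f where f: "f \<in> alghom polys A" and fv: "\<And>k. f (free_gen K {#k#}) = v k"
    by (rule polys_free[OF A, of v]) auto
  have f_var: "f (var s b i) = coord A b (\<chi> s i)" if "b \<in> B" "i \<in> B" for s b i
    using that code by (simp add: var_def fv v_def w_def)
  have f_generic: "push polys A f (generic s p) = \<chi> s p" if p: "p \<in> carrier P" for s p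
  proof -
    have "push polys A f (generic s p) = matrix_map A (\<lambda>b i. f (var s b i)) p"
      unfolding generic_def by (rule push_matrix_map[OF polys_mod mA alghom_lin[OF f] var_closed p])
    also have "\<dots> = matrix_map A (\<lambda>b i. coord A b (\<chi> s i)) p"
      by (rule matrix_map_cong[OF mA _ f_var p]) (simp_all add: f_var cl)
    also have "\<dots> = \<chi> s p" by (rule matrix_map_coord[OF mA \<chi> p])
    finally show ?thesis .
  qed
  have f_pairs: "push polys A f s = push polys A f t" if st: "(s, t) \<in> pairs" for s t
  proof -
    note gc = lin_closed[OF generic_lin]
    from st show ?thesis
    proof (cases rule: pairs_cases)
      case (op \<beta> x y)
      then show ?thesis
        by (simp add: push_op[OF polys_alg A f] gc f_generic bil_closed[OF Ops])
          (simp add: \<chi>_def autosD(3)[OF au])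
    next
      case (inverse u p)
      have "push polys A f s = ext A (\<lambda>p. push polys A f (generic u p)) (push polys A f (generic (\<not> u) p))"
        unfolding inverse(1) by (rule push_ext[OF polys_alg A f generic_lin gc[OF inverse(3)]])
      also have "\<dots> = ext A (\<chi> u) (\<chi> (\<not> u) p)"
        unfolding f_generic[OF inverse(3)]
        by (rule ext_cong[OF A lin_comp[OF push_alghom_lin[OF polys_alg A f] generic_lin] f_generic
              lin_closed[OF \<chi> inverse(3)]])
      also have "\<dots> = iota A p" by (cases u) (simp_all add: \<chi>_def autosD(4,5)[OF au] inverse(3))
      also have "\<dots> = push polys A f t"
        unfolding inverse(2) by (rule push_iota[OF polys_alg A f inverse(3), symmetric])
      finally show ?thesis .
    qed
  qed
  note cp = coord_push[OF polys_mod mA alghom_lin[OF f]]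
  have diff: "f (x \<ominus>\<^bsub>polys\<^esub> y) = \<zero>\<^bsub>A\<^esub>" if "x \<in> carrier polys" "y \<in> carrier polys" "f x = f y" for x y
    using that alghom_closed[OF f] lin_diff[OF alghom_lin[OF f] polys_mod mA that(1,2)]
    by (simp only: a_minus_def[of A] A.r_neg)
  have "f x = \<zero>\<^bsub>A\<^esub>" if "x \<in> relations" for x
  proof -
    note cc = lin_closed[OF coord_lin[OF polys_mod]]
    from that show ?thesis
    proof (cases rule: relations_cases)
      case (pair b s t)
      have "f (coord polys b s) = f (coord polys b t)"
        by (simp add: cp[OF pair(2), symmetric] pairs_closed[OF pair(3)] f_pairs[OF pair(3)])
      then show ?thesis
        unfolding pair(1) by (intro diff cc[OF pair(2)] pairs_closed[OF pair(3)])
    next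
      case (entry s b i)
      have gi: "generic s i \<in> carrier (P \<boxtimes> polys)" by (rule lin_closed[OF generic_lin B_closed[OF entry(3)]])
      \<comment> \<open>Both sides are the coordinate of \<open>\<chi> s i\<close> at
        \<open>b\<close>: the left by the choice of \<open>f\<close>, the right because base change
        along \<open>f\<close> sends \<open>generic s\<close> to \<open>\<chi> s\<close>.\<close>
      have "f (var s b i) = f (coord polys b (generic s i))"
        by (simp add: cp[OF entry(2) gi, symmetric] f_generic B_closed entry f_var)
      then show ?thesis unfolding entry(1) by (intro diff var_closed cc[OF entry(2) gi])
    next
      case (unused k)
      then show ?thesis by (simp add: fv v_def)
    qed
  qed
  then have kernel: "x \<in> relation_ideal \<Longrightarrow> f x = \<zero>\<^bsub>A\<^esub>" for x
    unfolding relation_ideal_def by (rule genideal_kernel[OF polys_alg A f relations_closed])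
  obtain g where g: "g \<in> alghom (coord_alg z) A" "\<And>x. x \<in> carrier polys \<Longrightarrow> g (proj x) = f x"
    by (rule qalg_lift[OF polys_alg relation_ideal A f kernel, of z]) (auto simp: coord_alg_def proj_def)
  have push_g: "push (coord_alg z) A g (universal z s p) = \<chi> s p" if p: "p \<in> carrier P" for s p
  proof -
    note gc = lin_closed[OF generic_lin p]
    have "push (coord_alg z) A g (universal z s p) = push polys A (\<lambda>x. g (proj x)) (generic s p)"
      unfolding universal_def
      by (rule push_push[OF polys_mod alg_mod[OF coord_alg_alg] mA alghom_lin[OF proj_alghom] alghom_lin[OF g(1)] gc])
    also have "\<dots> = push polys A f (generic s p)"
      by (rule push_cong[OF polys_mod mA lin_comp[OF alghom_lin[OF g(1)] alghom_lin[OF proj_alghom]] g(2) gc])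
    also have "\<dots> = \<chi> s p" by (rule f_generic[OF p])
    finally show ?thesis .
  qed
  then show thesis by (intro that[OF g(1)]) (simp_all add: \<chi>_def)
qed

text \<open>Agreement is assumed for the universal automorphism only. It passes to the inverse,
  hence to the images of all variables, which generate the algebra.\<close>

lemma classify_unique:
  assumes A: "alg A" and f: "f \<in> alghom (coord_alg z) A" and g: "g \<in> alghom (coord_alg z) A"
    and eq: "\<And>p. p \<in> carrier P \<Longrightarrow>
      push (coord_alg z) A f (universal z True p) = push (coord_alg z) A g (universal z True p)"
    and X: "X \<in> carrier (coord_alg z)"
  shows "f X = g X"
proof -
  let ?H = "coord_alg z"
  note mA = alg_mod[OF A] and mH = alg_mod[OF coord_alg_alg[of z]]
  \<comment> \<open>For \<open>s = False\<close> this is uniqueness of the inverse of a point over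
    \<open>A\<close>.\<close>
  have eqs: "push ?H A f (universal z s p) = push ?H A g (universal z s p)" if p: "p \<in> carrier P" for s p
    using eq[OF p] autos_inverse_unique[OF A autos_push[OF coord_alg_alg A f universal_autos]
        autos_push[OF coord_alg_alg A g universal_autos] eq p]
    by (cases s) simp_all
  have gv: "k (proj (var s b i)) = coord A b (push ?H A k (universal z s i))"
    if k: "k \<in> alghom ?H A" and bi: "b \<in> B" "i \<in> B" for k s b i
  proof -
    have gi: "generic s i \<in> carrier (P \<boxtimes> polys)" by (rule lin_closed[OF generic_lin B_closed[OF bi(2)]])
    \<comment> \<open>The second family of relations: in the quotient a variable equals the
      corresponding coordinate of the universal map and so is controlled by it.\<close>
    have "proj (var s b i) = proj (coord polys b (generic s i))"
      by (intro proj_eq var_closed lin_closed[OF coord_lin[OF polys_mod] gi] relationsI bi)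
    also have "\<dots> = coord ?H b (universal z s i)"
      unfolding universal_def
      by (rule coord_push[OF polys_mod mH alghom_lin[OF proj_alghom] bi(1) gi, symmetric])
    finally show ?thesis
      by (simp add: coord_push[OF mH mA alghom_lin[OF k] bi(1)] lin_closed[OF universal_lin] B_closed[OF bi(2)])
  qed
  obtain x where x: "x \<in> carrier polys" "X = proj x" using proj_surj[OF X] .
  have "f (proj x) = g (proj x)"
  proof (rule polys_alghom_eqI[OF A alghom_comp[OF f proj_alghom] alghom_comp[OF g proj_alghom] _ x(1)])
    fix k show "f (proj (free_gen K {#k#})) = g (proj (free_gen K {#k#}))"
    proof (cases "k \<in> code ` (UNIV \<times> B \<times> B)")
      case True
      then obtain s b i where k: "k = code (s, b, i)" "b \<in> B" "i \<in> B" by auto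
      show ?thesis
        using gv[OF f k(2,3), of s] gv[OF g k(2,3), of s] eqs[OF B_closed[OF k(3)], of s]
        by (simp add: k(1) var_def)
    next
      case False
      then have "free_gen K {#k#} \<in> relation_ideal" by (intro relation_mem relationsI)
      then have "proj (free_gen K {#k#}) = \<zero>\<^bsub>?H\<^esub>"
        unfolding proj_def coord_alg_def by (rule qproj_zero[OF polys_alg relation_ideal])
      then show ?thesis by (simp add: lin_zero[OF alghom_lin[OF f] mH mA] lin_zero[OF alghom_lin[OF g] mH mA])
    qed
  qed
  then show ?thesis using x by simp
qed

end

section \<open>The Hopf algebra structure\<close>

text \<open>\<open>H\<close> and \<open>H0\<close> differ only in their record extension. The tensor
  constructions read just the fields listed here, so those of \<open>H\<close> and of
  \<open>H0\<close> are equal and no isomorphism has to be carried along.\<close>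

lemma tensor_space_cong:
  fixes K :: "('k, 'm) ring_scheme"
  assumes "carrier V = carrier V'" "add V = add V'" "smult V = smult V'"
    and "carrier W = carrier W'" "add W = add W'" "smult W = smult W'"
  shows "pure_tensor K V W = pure_tensor K V' W'" "tensor_space K V W = tensor_space K V' W'"
  using assms
  by (simp_all add: pure_tensor_def[abs_def] tensor_space_def tensor_kernel_def tensor_relators_def)

lemma tensor_cong:
  fixes K :: "('k, 'm) ring_scheme"
  assumes "carrier V = carrier V'" "add V = add V'" "smult V = smult V'" "mult V = mult V'" "one V = one V'"
    and "carrier W = carrier W'" "add W = add W'" "smult W = smult W'" "mult W = mult W'" "one W = one W'"
  shows "tensor K V W = tensor K V' W'"
  using assms tensor_space_cong[OF assms(1-3,6-8), of K]
  by (simp add: tensor_def tensor_op_def[abs_def] tensor_lift_def[abs_def])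

text \<open>The body of \<open>tensor_lift\<close> does not mention the source modules, so these may
  differ altogether.\<close>

lemma tensor_map_cong:
  fixes K :: "('k, 'm) ring_scheme"
  assumes "pure_tensor K V' W' = pure_tensor K V'' W''" "tensor K V' W' = tensor K V'' W''"
  shows "tensor_map K V W V' W' f g = tensor_map K X Y V'' W'' f g"
  using assms by (simp add: tensor_map_def tensor_lift_def[abs_def])

context coordinate_ring
begin

text \<open>The algebra with an empty extension. It breaks a circularity: the Hopf operations are
  fields of \<open>H\<close>, yet they are obtained by classifying points with the algebra
  underlying \<open>H\<close>.\<close>

abbreviation H0 where "H0 \<equiv> coord_alg ()"
abbreviation HH0 where "HH0 \<equiv> H0 \<boxtimes> H0"
abbreviation left where "left A \<equiv> (\<lambda>h. pt A A h \<one>\<^bsub>A\<^esub>)"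
abbreviation right where "right A \<equiv> (\<lambda>h. pt A A \<one>\<^bsub>A\<^esub> h)"

text \<open>A choice that \<open>classify_unique\<close> makes unambiguous on the carrier. The
  inverse of the point is left implicit, since it is determined.\<close>

definition classifier where
  "classifier A \<phi> = (SOME f. f \<in> alghom H0 A \<and> (\<forall>p\<in>carrier P. push H0 A f (universal () True p) = \<phi> p))"

lemma classifier:
  assumes "alg A" "(\<phi>, \<psi>) \<in> autos A"
  shows "classifier A \<phi> \<in> alghom H0 A"
    and "p \<in> carrier P \<Longrightarrow> push H0 A (classifier A \<phi>) (universal () True p) = \<phi> p"
proof -
  have "\<exists>f. f \<in> alghom H0 A \<and> (\<forall>p\<in>carrier P. push H0 A f (universal () True p) = \<phi> p)"
    by (rule classify[OF assms, of "()"]) blast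
  from someI_ex[OF this, folded classifier_def]
  show "classifier A \<phi> \<in> alghom H0 A"
    and "p \<in> carrier P \<Longrightarrow> push H0 A (classifier A \<phi>) (universal () True p) = \<phi> p" by auto
qed

text \<open>Yoneda: the comultiplication classifies the product of the two universal points over
  \<open>H0 \<boxtimes> H0\<close>, the counit the neutral point, the antipode the inverse of the
  universal point. With the left factor applied last, the product is the one in
  \<open>tassoc_ext\<close>.\<close>

definition "comult0 = classifier HH0
  (\<lambda>p. ext HH0 (\<lambda>p. push H0 HH0 (left H0) (universal () True p))
    (push H0 HH0 (right H0) (universal () True p)))"
definition "counit0 = classifier (base_algebra K) (iota (base_algebra K))"
definition "antipode0 = classifier H0 (universal () False)"

definition H where "H = coord_alg (hopf.fields comult0 counit0 antipode0)"
definition lam where "lam = universal (hopf.fields comult0 counit0 antipode0) True"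
definition lam_inv where "lam_inv = universal (hopf.fields comult0 counit0 antipode0) False"

abbreviation HH where "HH \<equiv> H \<boxtimes> H"

lemma H_ops: "comult H = comult0" "counit H = counit0" "antipode H = antipode0"
  by (simp_all add: H_def coord_alg_def quotient_algebra_def hopf.defs)

lemma H_eq: "carrier H = carrier H0" "add H = add H0" "smult H = smult H0" "mult H = mult H0"
  "one H = one H0" "zero H = zero H0"
  by (simp_all add: H_def coord_alg_def quotient_algebra_def hopf.defs)

lemma tensor_H: "H \<boxtimes> H = H0 \<boxtimes> H0" "P \<boxtimes> H = P \<boxtimes> H0" "pt H H = pt H0 H0" "pt P H = pt P H0"
  by (rule tensor_cong tensor_space_cong; simp only: H_eq)+

lemma alghom_H: "alghom H A = alghom H0 A" "alghom A H = alghom A H0"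
  by (simp_all add: algebra_hom_def ring_hom_def linear_maps_def H_eq)

lemma push_from_H: "push H A f = push H0 A f"
  unfolding push_def by (rule tensor_map_cong[OF refl refl])

lemma push_to_H: "push A H f = push A H0 f"
  unfolding push_def by (rule tensor_map_cong) (rule tensor_H)+

lemmas push_H = push_from_H push_to_H

lemma lam_eq: "lam = universal () True" "lam_inv = universal () False"
  unfolding lam_def lam_inv_def universal_def[abs_def]
  by (simp_all only: push_to_H[unfolded H_def])

lemma H_alg: "alg H" unfolding H_def by (rule coord_alg_alg)

lemma lam_autos: "(lam, lam_inv) \<in> autos H"
  unfolding lam_def lam_inv_def H_def by (rule universal_autos)

lemma lam_lin: "lam \<in> lin P (P \<boxtimes> H)" by (rule autosD(1)[OF lam_autos])
lemma lam_closed: "p \<in> carrier P \<Longrightarrow> lam p \<in> carrier (P \<boxtimes> H)" by (rule lin_closed[OF lam_lin])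

lemma H_unique:
  assumes "alg A" "f \<in> alghom H A" "g \<in> alghom H A"
    "\<And>p. p \<in> carrier P \<Longrightarrow> push H A f (lam p) = push H A g (lam p)" "h \<in> carrier H"
  shows "f h = g h"
  by (rule classify_unique[OF assms(1) assms(2,3)[unfolded H_def] assms(4)[unfolded H_def lam_def]
        assms(5)[unfolded H_def]])

lemma H_classify:
  assumes "alg A" "(\<phi>, \<psi>) \<in> autos A"
  obtains f where "f \<in> alghom H A" "\<And>p. p \<in> carrier P \<Longrightarrow> push H A f (lam p) = \<phi> p"
  by (rule classify[OF assms]) (rule that[unfolded H_def lam_def])

lemma comult_alghom: "comult H \<in> alghom H HH"
  and comult_lam: "p \<in> carrier P \<Longrightarrow> push H HH (comult H) (lam p) =
    ext HH (\<lambda>p. push H HH (left H) (lam p)) (push H HH (right H) (lam p))"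
proof -
  note H = coord_alg_alg[of "()"]
  note HH0 = tensor_alg[OF H H]
  note cl = classifier[OF HH0 autos_mult[OF HH0 autos_push[OF H HH0 incl_left_alghom[OF H H] universal_autos]
        autos_push[OF H HH0 incl_right_alghom[OF H H] universal_autos]], folded comult0_def]
  show "comult H \<in> alghom H HH"
    and "p \<in> carrier P \<Longrightarrow> push H HH (comult H) (lam p) =
      ext HH (\<lambda>p. push H HH (left H) (lam p)) (push H HH (right H) (lam p))"
    unfolding alghom_H push_H tensor_H lam_eq H_ops H_eq by (rule cl, assumption?)+
qed

lemma counit_alghom: "counit H \<in> alghom H (base_algebra K)"
  and counit_lam: "p \<in> carrier P \<Longrightarrow> push H (base_algebra K) (counit H) (lam p) = iota (base_algebra K) p"
  using classifier[OF base_algebra_alg autos_iota[OF base_algebra_alg]]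
  unfolding alghom_H push_H lam_eq H_ops counit0_def by blast+

lemma antipode_alghom: "antipode H \<in> alghom H H"
  and antipode_lam: "p \<in> carrier P \<Longrightarrow> push H H (antipode H) (lam p) = lam_inv p"
  using classifier[OF coord_alg_alg autos_sym[OF coord_alg_alg universal_autos[of "()"]]]
  unfolding alghom_H push_H lam_eq H_ops antipode0_def by blast+

section \<open>The Hopf axioms as group laws\<close>

lemma HH_alg: "alg HH" by (rule tensor_alg[OF H_alg H_alg])
lemma left_alghom: "left H \<in> alghom H HH" by (rule incl_left_alghom[OF H_alg H_alg])
lemma right_alghom: "right H \<in> alghom H HH" by (rule incl_right_alghom[OF H_alg H_alg])

lemma push_alghom_comp:
  assumes "alg A" "alg A'" "alg A''" "f \<in> alghom A A'" "g \<in> alghom A' A''" "t \<in> carrier (P \<boxtimes> A)"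
  shows "push A A'' (\<lambda>x. g (f x)) t = push A' A'' g (push A A' f t)"
  by (rule push_push[OF alg_mod alg_mod alg_mod alghom_lin alghom_lin, symmetric]) fact+

text \<open>If an algebra map \<open>g\<close> on \<open>HH\<close> restricts to \<open>u\<close>
  and \<open>v\<close> on the two factors, then \<open>g\<close> after \<open>comult\<close>
  classifies the product of the points classified by \<open>u\<close> and \<open>v\<close>. It
  follows by transporting \<open>comult_lam\<close> along \<open>g\<close> and translates every Hopf
  axiom into a group law.\<close>

lemma push_comult:
  assumes A: "alg A" and g: "g \<in> alghom HH A"
    and u: "\<And>h. h \<in> carrier H \<Longrightarrow> g (pt H H h \<one>\<^bsub>H\<^esub>) = u h" and v: "\<And>h. h \<in> carrier H \<Longrightarrow> g (pt H H \<one>\<^bsub>H\<^esub> h) = v h"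
    and p: "p \<in> carrier P"
  shows "push H A (\<lambda>h. g (comult H h)) (lam p) = ext A (\<lambda>p. push H A u (lam p)) (push H A v (lam p))"
proof -
  note lc = lam_closed and mH = alg_mod[OF H_alg] and mA = alg_mod[OF A]
  note gl = alghom_comp[OF g left_alghom] and gr = alghom_comp[OF g right_alghom]
  have "push H A (\<lambda>h. g (comult H h)) (lam p) = push HH A g (push H HH (comult H) (lam p))"
    by (rule push_alghom_comp[OF H_alg HH_alg A comult_alghom g lc[OF p]])
  also have "\<dots> = ext A (\<lambda>p. push HH A g (push H HH (left H) (lam p)))
      (push HH A g (push H HH (right H) (lam p)))"
    unfolding comult_lam[OF p]
    by (rule push_ext[OF HH_alg A g lin_comp[OF push_alghom_lin[OF H_alg HH_alg left_alghom] lam_lin]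
          lin_closed[OF push_alghom_lin[OF H_alg HH_alg right_alghom] lc[OF p]]])
  also have "push HH A g (push H HH (right H) (lam p)) = push H A v (lam p)"
    unfolding push_alghom_comp[OF H_alg HH_alg A right_alghom g lc[OF p], symmetric]
    by (rule push_cong[OF mH mA alghom_lin[OF gr] v lc[OF p]])
  also have "ext A (\<lambda>p. push HH A g (push H HH (left H) (lam p))) (push H A v (lam p)) =
      ext A (\<lambda>p. push H A u (lam p)) (push H A v (lam p))"
  proof (rule ext_cong[OF A])
    show "(\<lambda>p. push HH A g (push H HH (left H) (lam p))) \<in> lin P (P \<boxtimes> A)"
      by (rule lin_comp[OF push_alghom_lin[OF HH_alg A g] lin_comp[OF push_alghom_lin[OF H_alg HH_alg left_alghom] lam_lin]])
    show "push HH A g (push H HH (left H) (lam p)) = push H A u (lam p)" if p: "p \<in> carrier P" for p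
      unfolding push_alghom_comp[OF H_alg HH_alg A left_alghom g lc[OF p], symmetric]
      by (rule push_cong[OF mH mA alghom_lin[OF gl] u lc[OF p]])
    have "v \<in> alghom H A" by (rule alghom_cong[OF gr H_alg v])
    then show "push H A v (lam p) \<in> carrier (P \<boxtimes> A)"
      by (rule lin_closed[OF push_alghom_lin[OF H_alg A] lc[OF p]])
  qed
  finally show ?thesis .
qed

text \<open>Both sides classify the product of the three base changes of \<open>lam\<close> along
  the inclusions \<open>?j1\<close>, \<open>?j2\<close>, \<open>?j3\<close> of the tensor factors,
  bracketed in the two possible ways.\<close>

lemma H_coassoc:
  assumes h: "h \<in> carrier H"
  shows "tassoc H H H (tmap H H HH H (comult H) id (comult H h)) =
    tmap H H H HH id (comult H) (comult H h)"
proof -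
  let ?A = "H \<boxtimes> HH" and ?o = "\<one>\<^bsub>H\<^esub>"
  let ?j1 = "\<lambda>h. pt H HH h (pt H H ?o ?o)" and ?j2 = "\<lambda>h. pt H HH ?o (pt H H h ?o)"
    and ?j3 = "\<lambda>h. pt H HH ?o (pt H H ?o h)"
  let ?J = "\<lambda>j p. push H ?A j (lam p)"
  note A = tensor_alg[OF H_alg HH_alg]
  note mH = alg_mod[OF H_alg] and mHH = alg_mod[OF HH_alg]
  have id: "id \<in> alghom H H" using alghom_id by (simp add: id_def)
  note ta = tassoc_alghom[OF H_alg H_alg H_alg]
  \<comment> \<open>The inclusion of \<open>HH\<close> as the first two factors; \<open>k2\<close>
    is the inclusion as the last two.\<close>
  note k = alghom_comp[OF ta incl_left_alghom[OF HH_alg H_alg]]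
  note k2 = incl_right_alghom[OF H_alg HH_alg]
  note g1 = alghom_comp[OF ta tmap_alghom[OF H_alg H_alg HH_alg H_alg comult_alghom id]]
  note g2 = tmap_alghom[OF H_alg H_alg H_alg HH_alg id comult_alghom]
  note one = alg_simps(1)[OF H_alg]
  note tp1 = tmap_pt[OF mH mH mHH mH alghom_lin[OF comult_alghom] lin_id(2)]
    and tp2 = tmap_pt[OF mH mH mH mHH lin_id(2) alghom_lin[OF comult_alghom]]
    and ap = tassoc_pt[OF mH mH mH]
  have c1: "comult H ?o = pt H H ?o ?o" using alghom_one[OF comult_alghom] by (simp add: tensor_mult)
  have j: "?j1 \<in> alghom H ?A" "?j2 \<in> alghom H ?A" "?j3 \<in> alghom H ?A"
    using incl_left_alghom[OF H_alg HH_alg] alghom_comp[OF k2 left_alghom] alghom_comp[OF k2 right_alghom]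
    by (simp_all add: tensor_mult)
  have Jlin: "?J f \<in> lin P (P \<boxtimes> ?A)" if "f \<in> alghom H ?A" for f
    by (rule lin_comp[OF push_alghom_lin[OF H_alg A that] lam_lin])
  show ?thesis
  proof (rule H_unique[OF A alghom_comp[OF g1 comult_alghom] alghom_comp[OF g2 comult_alghom] _ h])
    fix p assume p: "p \<in> carrier P"
    have "push H ?A (\<lambda>h. tassoc H H H (tmap H H HH H (comult H) id (comult H h))) (lam p) =
        ext ?A (\<lambda>p. push H ?A (\<lambda>h. tassoc H H H (pt HH H (comult H h) ?o)) (lam p)) (?J ?j3 p)"
      by (rule push_comult[OF A g1 _ _ p]) (simp_all add: tp1 one ap c1)
    also have "\<dots> = ext ?A (\<lambda>p. ext ?A (?J ?j1) (?J ?j2 p)) (?J ?j3 p)"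
    proof (rule ext_cong[OF A])
      show "(\<lambda>p. push H ?A (\<lambda>h. tassoc H H H (pt HH H (comult H h) ?o)) (lam p)) \<in> lin P (P \<boxtimes> ?A)"
        by (rule Jlin[OF alghom_comp[OF k comult_alghom]])
      show "push H ?A (\<lambda>h. tassoc H H H (pt HH H (comult H h) ?o)) (lam p) = ext ?A (?J ?j1) (?J ?j2 p)"
        if "p \<in> carrier P" for p
        by (rule push_comult[OF A k _ _ that]) (simp_all add: ap one)
      show "?J ?j3 p \<in> carrier (P \<boxtimes> ?A)" by (rule lin_closed[OF Jlin[OF j(3)] p])
    qed
    \<comment> \<open>Associativity of composition; the remaining steps fold the right-bracketed
      product back with \<open>push_comult\<close>.\<close>
    also have "\<dots> = ext ?A (?J ?j1) (ext ?A (?J ?j2) (?J ?j3 p))"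
      by (rule ext_ext[OF A Jlin[OF j(1)] Jlin[OF j(2)] lin_closed[OF Jlin[OF j(3)] p]])
    also have "ext ?A (?J ?j2) (?J ?j3 p) = push H ?A (\<lambda>h. pt H HH ?o (comult H h)) (lam p)"
      by (rule push_comult[OF A k2 refl refl p, symmetric])
    also have "ext ?A (?J ?j1) \<dots> = push H ?A (\<lambda>h. tmap H H H HH id (comult H) (comult H h)) (lam p)"
      by (rule push_comult[OF A g2 _ _ p, symmetric]) (simp_all add: tp2 one c1)
    finally show "push H ?A (\<lambda>h. tassoc H H H (tmap H H HH H (comult H) id (comult H h))) (lam p) =
      push H ?A (\<lambda>h. tmap H H H HH id (comult H) (comult H h)) (lam p)" .
  qed
qed

text \<open>Multiplicativity amounts to interchanging the two middle factors of a product in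
  \<open>H\<close>, which is where commutativity of \<open>H\<close> enters.\<close>

lemma convolution_alghom:
  assumes u: "u \<in> alghom H H" and v: "v \<in> alghom H H"
  shows "tlift H H H (\<lambda>x y. u x \<otimes>\<^bsub>H\<^esub> v y) \<in> alghom HH H"
  by (rule tlift_alghom[OF H_alg H_alg H_alg convolution_bil[OF H_alg alghom_lin[OF u] alghom_lin[OF v]]])
    (simp_all add: alghom_mult[OF u] alghom_mult[OF v] alghom_one[OF u] alghom_one[OF v]
      alghom_closed[OF u] alghom_closed[OF v] alg_simps[OF H_alg])

text \<open>The convolution of \<open>u\<close> and \<open>v\<close> classifies the product of their
  points. Two counit and two antipode axioms thus become equations between points, compared by
  \<open>H_unique\<close>.\<close>

lemma convolution_eq:
  assumes u: "u \<in> alghom H H" and v: "v \<in> alghom H H" and w: "w \<in> alghom H H"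
    and eq: "\<And>p. p \<in> carrier P \<Longrightarrow> ext H (\<lambda>p. push H H u (lam p)) (push H H v (lam p)) = push H H w (lam p)"
    and h: "h \<in> carrier H"
  shows "tlift H H H (\<lambda>x y. u x \<otimes>\<^bsub>H\<^esub> v y) (comult H h) = w h"
proof (rule H_unique[OF H_alg alghom_comp[OF convolution_alghom[OF u v] comult_alghom] w _ h])
  note mH = alg_mod[OF H_alg]
  fix p assume p: "p \<in> carrier P"
  show "push H H (\<lambda>h. tlift H H H (\<lambda>x y. u x \<otimes>\<^bsub>H\<^esub> v y) (comult H h)) (lam p) = push H H w (lam p)"
    unfolding eq[OF p, symmetric]
    by (rule push_comult[OF H_alg convolution_alghom[OF u v] _ _ p])
      (simp_all add: tlift_pt[OF mH mH mH convolution_bil[OF H_alg alghom_lin[OF u] alghom_lin[OF v]]]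
        alg_simps[OF H_alg] alghom_one[OF u] alghom_one[OF v] alghom_closed[OF u] alghom_closed[OF v])
qed

lemma unit_counit_alghom: "(\<lambda>h. counit H h \<odot>\<^bsub>H\<^esub> \<one>\<^bsub>H\<^esub>) \<in> alghom H H"
  by (rule alghom_comp[OF unit_alghom[OF H_alg] counit_alghom])

lemma push_unit_counit:
  assumes p: "p \<in> carrier P"
  shows "push H H (\<lambda>h. counit H h \<odot>\<^bsub>H\<^esub> \<one>\<^bsub>H\<^esub>) (lam p) = iota H p"
  by (simp add: push_alghom_comp[OF H_alg base_algebra_alg H_alg counit_alghom unit_alghom[OF H_alg]]
      lam_closed p counit_lam push_iota[OF base_algebra_alg H_alg unit_alghom[OF H_alg]])

lemma H_hopf:
  assumes "field K"
  shows "comm_hopf_algebra K H"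
proof (intro comm_hopf_algebra.intro comm_hopf_algebra_axioms.intro)
  note mH = alg_mod[OF H_alg]
  note cc = alghom_closed[OF counit_alghom, unfolded base_algebra_def, simplified]
  note id = alghom_id[of H]
  have push_id': "push H H (\<lambda>x. x) (lam p) = lam p" if "p \<in> carrier P" for p
    by (rule push_id[OF mH lam_closed[OF that]])
  show "field K" by fact
  show "alg H" by (rule H_alg)
  show "comult H \<in> alghom H HH" by (rule comult_alghom)
  show "counit H \<in> alghom H (base_algebra K)" by (rule counit_alghom)
  show "antipode H \<in> lin H H" by (rule alghom_lin[OF antipode_alghom])
  fix h assume h: "h \<in> carrier H"
  note ch = alghom_closed[OF comult_alghom h]
  show "tassoc H H H (tmap H H HH H (comult H) id (comult H h)) =
    tmap H H H HH id (comult H) (comult H h)" by (rule H_coassoc[OF h])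
  have "tlift H H H (\<lambda>x y. (counit H x \<odot>\<^bsub>H\<^esub> \<one>\<^bsub>H\<^esub>) \<otimes>\<^bsub>H\<^esub> y) (comult H h) = h"
  proof (rule convolution_eq[OF unit_counit_alghom id id _ h])
    fix p assume p: "p \<in> carrier P"
    have "ext H (\<lambda>p. push H H (\<lambda>h. counit H h \<odot>\<^bsub>H\<^esub> \<one>\<^bsub>H\<^esub>) (lam p)) (lam p) = ext H (iota H) (lam p)"
      by (rule ext_cong[OF H_alg lin_comp[OF push_alghom_lin[OF H_alg H_alg unit_counit_alghom] lam_lin]
            push_unit_counit lam_closed[OF p]])
    then show "ext H (\<lambda>p. push H H (\<lambda>h. counit H h \<odot>\<^bsub>H\<^esub> \<one>\<^bsub>H\<^esub>) (lam p)) (push H H (\<lambda>x. x) (lam p)) =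
      push H H (\<lambda>x. x) (lam p)"
      by (simp add: push_id' p ext_iota_id[OF H_alg] lam_closed)
  qed
  \<comment> \<open>The axiom uses the scalar action, the convolution the product with a scalar
    multiple of the unit; \<open>tlift_cong\<close> exchanges the two.\<close>
  moreover have "tlift H H H (\<lambda>x y. (counit H x \<odot>\<^bsub>H\<^esub> \<one>\<^bsub>H\<^esub>) \<otimes>\<^bsub>H\<^esub> y) (comult H h) =
      tlift H H H (\<lambda>x y. counit H x \<odot>\<^bsub>H\<^esub> y) (comult H h)"
    by (rule tlift_cong[OF mH mH mH convolution_bil[OF H_alg alghom_lin[OF unit_counit_alghom] lin_id(1)] _ ch])
      (simp add: algebra.smult_assoc2[OF H_alg] cc alg_simps[OF H_alg])
  ultimately show "tlift H H H (\<lambda>x y. counit H x \<odot>\<^bsub>H\<^esub> y) (comult H h) = h" by simp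
  have "tlift H H H (\<lambda>x y. x \<otimes>\<^bsub>H\<^esub> (counit H y \<odot>\<^bsub>H\<^esub> \<one>\<^bsub>H\<^esub>)) (comult H h) = h"
  proof (rule convolution_eq[OF id unit_counit_alghom id _ h])
    fix p assume p: "p \<in> carrier P"
    have "ext H (\<lambda>p. push H H (\<lambda>x. x) (lam p)) (iota H p) = push H H (\<lambda>x. x) (lam p)"
      by (rule ext_iota[OF H_alg lin_comp[OF push_alghom_lin[OF H_alg H_alg id] lam_lin] p])
    then show "ext H (\<lambda>p. push H H (\<lambda>x. x) (lam p)) (push H H (\<lambda>h. counit H h \<odot>\<^bsub>H\<^esub> \<one>\<^bsub>H\<^esub>) (lam p)) =
      push H H (\<lambda>x. x) (lam p)"
      by (simp only: push_unit_counit[OF p])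
  qed
  moreover have "tlift H H H (\<lambda>x y. x \<otimes>\<^bsub>H\<^esub> (counit H y \<odot>\<^bsub>H\<^esub> \<one>\<^bsub>H\<^esub>)) (comult H h) =
      tlift H H H (\<lambda>x y. counit H y \<odot>\<^bsub>H\<^esub> x) (comult H h)"
    by (rule tlift_cong[OF mH mH mH convolution_bil[OF H_alg lin_id(1) alghom_lin[OF unit_counit_alghom]] _ ch])
      (simp add: alg_comm[OF H_alg _ alghom_closed[OF unit_counit_alghom]]
        algebra.smult_assoc2[OF H_alg] cc alg_simps[OF H_alg])
  ultimately show "tlift H H H (\<lambda>x y. counit H y \<odot>\<^bsub>H\<^esub> x) (comult H h) = h" by simp
  show "tlift H H H (\<lambda>x y. antipode H x \<otimes>\<^bsub>H\<^esub> y) (comult H h) = counit H h \<odot>\<^bsub>H\<^esub> \<one>\<^bsub>H\<^esub>"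
  proof (rule convolution_eq[OF antipode_alghom id unit_counit_alghom _ h])
    fix p assume p: "p \<in> carrier P"
    have "ext H (\<lambda>p. push H H (antipode H) (lam p)) (lam p) = ext H lam_inv (lam p)"
      by (rule ext_cong[OF H_alg lin_comp[OF push_alghom_lin[OF H_alg H_alg antipode_alghom] lam_lin]
            antipode_lam lam_closed[OF p]])
    then show "ext H (\<lambda>p. push H H (antipode H) (lam p)) (push H H (\<lambda>x. x) (lam p)) =
      push H H (\<lambda>h. counit H h \<odot>\<^bsub>H\<^esub> \<one>\<^bsub>H\<^esub>) (lam p)"
      by (simp add: push_id' p push_unit_counit autosD(5)[OF lam_autos])
  qed
  show "tlift H H H (\<lambda>x y. x \<otimes>\<^bsub>H\<^esub> antipode H y) (comult H h) = counit H h \<odot>\<^bsub>H\<^esub> \<one>\<^bsub>H\<^esub>"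
  proof (rule convolution_eq[OF id antipode_alghom unit_counit_alghom _ h])
    fix p assume p: "p \<in> carrier P"
    have "ext H (\<lambda>p. push H H (\<lambda>x. x) (lam p)) (lam_inv p) = ext H lam (lam_inv p)"
      by (rule ext_cong[OF H_alg lin_comp[OF push_alghom_lin[OF H_alg H_alg id] lam_lin] push_id'
            lin_closed[OF autosD(2)[OF lam_autos] p]])
    then show "ext H (\<lambda>p. push H H (\<lambda>x. x) (lam p)) (push H H (antipode H) (lam p)) =
      push H H (\<lambda>h. counit H h \<odot>\<^bsub>H\<^esub> \<one>\<^bsub>H\<^esub>) (lam p)"
      by (simp add: p antipode_lam push_unit_counit autosD(4)[OF lam_autos])
  qed
qed

end

section \<open>Initiality\<close>

lemma hopf_alg: "comm_hopf_algebra K G \<Longrightarrow> algebra K G"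
  by (rule comm_hopf_algebra.axioms(2))

lemma hopf_comult: "comm_hopf_algebra K G \<Longrightarrow> comult G \<in> algebra_hom K G (tensor K G G)"
  and hopf_counit: "comm_hopf_algebra K G \<Longrightarrow> counit G \<in> algebra_hom K G (base_algebra K)"
  and hopf_antipode: "comm_hopf_algebra K G \<Longrightarrow> antipode G \<in> linear_maps K G G"
  by (simp_all add: comm_hopf_algebra_def comm_hopf_algebra_axioms_def)

context base_space
begin

text \<open>Under the identification of \<open>P \<boxtimes> base_algebra K\<close> with
  \<open>P\<close>, base change along a functional is contraction with it. With
  \<open>iota_base_inj\<close> this translates between the counit axiom of a coaction and triviality
  of a point over the base, in both directions.\<close>

lemma push_functional:
  assumes mA: "module K A" and f: "f \<in> lin A (base_algebra K)" and t: "t \<in> carrier (P \<boxtimes> A)"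
  shows "push A (base_algebra K) f t = iota (base_algebra K) (tlift P A P (\<lambda>q h. f h \<odot>\<^bsub>P\<^esub> q) t)"
proof -
  let ?k = "base_algebra K"
  note mk = alg_mod[OF base_algebra_alg]
  have b: "bil P A P (\<lambda>q h. f h \<odot>\<^bsub>P\<^esub> q)"
    by (rule bil_flip[OF bil_pre[OF bil_smult[OF P] f lin_id(1)]])
  have fk: "f a \<in> carrier K" if "a \<in> carrier A" for a
    using lin_closed[OF f that] by (simp add: base_algebra_def)
  show ?thesis
  proof (rule tensor_eqI[OF P mA push_lin[OF mA mk f] lin_comp[OF iota_lin[OF base_algebra_alg] tlift_lin[OF P mA P b]]
        tensor_mod[OF P mk] _ t])
    fix q h assume q: "q \<in> carrier P" and h: "h \<in> carrier A"
    have "pt P ?k (f h \<odot>\<^bsub>P\<^esub> q) \<one>\<^bsub>?k\<^esub> = pt P ?k q (f h \<odot>\<^bsub>?k\<^esub> \<one>\<^bsub>?k\<^esub>)"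
      using q fk[OF h] alg_simps(1)[OF base_algebra_alg]
      by (simp add: lin_smult[OF bilD(1)[OF pt_bil[OF P mk]]] lin_smult[OF bilD(2)[OF pt_bil[OF P mk]]])
    also have "f h \<odot>\<^bsub>?k\<^esub> \<one>\<^bsub>?k\<^esub> = f h" using fk[OF h] by (simp add: base_algebra_def)
    finally show "push A ?k f (pt P A q h) = iota ?k (tlift P A P (\<lambda>q h. f h \<odot>\<^bsub>P\<^esub> q) (pt P A q h))"
      using q h by (simp add: push_pt[OF mA mk f] tlift_pt[OF P mA P b] iota_def)
  qed
qed

text \<open>The contraction \<open>q \<otimes> a \<mapsto> a q\<close> is a left inverse.\<close>

lemma iota_base_inj:
  assumes p: "p \<in> carrier P" "q \<in> carrier P" and eq: "iota (base_algebra K) p = iota (base_algebra K) q"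
  shows "p = q"
proof -
  let ?k = "base_algebra K"
  note mk = alg_mod[OF base_algebra_alg]
  have b: "bil P ?k P (\<lambda>q a. a \<odot>\<^bsub>P\<^esub> q)" by (rule bil_flip[OF bil_smult[OF P]])
  have r: "tlift P ?k P (\<lambda>q a. a \<odot>\<^bsub>P\<^esub> q) (iota ?k p) = p" if "p \<in> carrier P" for p
    using that alg_simps(1)[OF base_algebra_alg]
    by (simp add: iota_def tlift_pt[OF P mk P b], simp add: base_algebra_def module_simps[OF P])
  show ?thesis by (rule trans[OF r[OF p(1), symmetric, unfolded eq] r[OF p(2)]])
qed

section \<open>Coactions of a Hopf algebra as automorphisms\<close>

context
  fixes G :: "('a, 'g, 's) hopf_scheme" and \<rho>
  assumes G: "comm_hopf_algebra K G" and \<rho>: "\<rho> \<in> lin P (P \<boxtimes> G)"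
    and op: "\<And>\<beta> x y. \<beta> \<in> Ops \<Longrightarrow> x \<in> carrier P \<Longrightarrow> y \<in> carrier P \<Longrightarrow> \<rho> (\<beta> x y) = op P G \<beta> (mult G) (\<rho> x) (\<rho> y)"
    and coassoc: "\<And>p. p \<in> carrier P \<Longrightarrow> tassoc P G G (tmap P G (P \<boxtimes> G) G \<rho> id (\<rho> p)) =
        tmap P G P (G \<boxtimes> G) id (comult G) (\<rho> p)"
    and counit: "\<And>p. p \<in> carrier P \<Longrightarrow> tlift P G P (\<lambda>q h. counit G h \<odot>\<^bsub>P\<^esub> q) (\<rho> p) = p"
begin

interpretation G: comm_hopf_algebra K G by (rule G)

private lemmas A = hopf_alg[OF G]
private lemmas mG = alg_mod[OF A]
private lemmas AA = tensor_alg[OF A A]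
private lemmas \<Delta> = hopf_comult[OF G]
private lemmas \<epsilon> = hopf_counit[OF G]
private lemmas S = hopf_antipode[OF G]

lemma coaction_comult:
  assumes p: "p \<in> carrier P"
  shows "push G (G \<boxtimes> G) (comult G) (\<rho> p) =
    ext (G \<boxtimes> G) (\<lambda>p. push G (G \<boxtimes> G) (\<lambda>h. pt G G h \<one>\<^bsub>G\<^esub>) (\<rho> p)) (push G (G \<boxtimes> G) (\<lambda>h. pt G G \<one>\<^bsub>G\<^esub> h) (\<rho> p))"
  unfolding push_def[of G "G \<boxtimes> G" "comult G"] coassoc[OF p, symmetric]
  by (rule tassoc_ext[OF A \<rho> lin_closed[OF \<rho> p]])

lemma coaction_counit_push:
  assumes p: "p \<in> carrier P"
  shows "push G (base_algebra K) (counit G) (\<rho> p) = iota (base_algebra K) p"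
  by (simp add: push_functional[OF mG alghom_lin[OF \<epsilon>]] lin_closed[OF \<rho>] p counit)

text \<open>By coassociativity the product of the two base changes is the base change along the
  convolution after \<open>comult\<close>. That map is the counit followed by the unit, and the
  counit axiom of the coaction turns it into the identity.\<close>

lemma coaction_convolution:
  assumes u: "u \<in> lin G G" and v: "v \<in> lin G G" and p: "p \<in> carrier P"
    and uv: "\<And>h. h \<in> carrier G \<Longrightarrow> tlift G G G (\<lambda>x y. u x \<otimes>\<^bsub>G\<^esub> v y) (comult G h) = counit G h \<odot>\<^bsub>G\<^esub> \<one>\<^bsub>G\<^esub>"
  shows "ext G (\<lambda>p. push G G u (\<rho> p)) (push G G v (\<rho> p)) = iota G p"
proof -
  note rc = lin_closed[OF \<rho> p]
  note L = tlift_lin[OF mG mG mG convolution_bil[OF A u v]]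
  have "ext G (\<lambda>p. push G G u (\<rho> p)) (push G G v (\<rho> p)) =
      push (G \<boxtimes> G) G (tlift G G G (\<lambda>x y. u x \<otimes>\<^bsub>G\<^esub> v y)) (push G (G \<boxtimes> G) (comult G) (\<rho> p))"
    unfolding push_def[of G "G \<boxtimes> G" "comult G"] coassoc[OF p, symmetric]
    by (rule ext_convolution[OF A u v \<rho> rc])
  also have "\<dots> = push G G (\<lambda>h. tlift G G G (\<lambda>x y. u x \<otimes>\<^bsub>G\<^esub> v y) (comult G h)) (\<rho> p)"
    by (rule push_push[OF mG alg_mod[OF AA] mG alghom_lin[OF \<Delta>] L rc])
  also have "\<dots> = push G G (\<lambda>h. counit G h \<odot>\<^bsub>G\<^esub> \<one>\<^bsub>G\<^esub>) (\<rho> p)"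
    by (rule push_cong[OF mG mG lin_comp[OF L alghom_lin[OF \<Delta>]] uv rc])
  also have "\<dots> = push (base_algebra K) G (\<lambda>a. a \<odot>\<^bsub>G\<^esub> \<one>\<^bsub>G\<^esub>) (push G (base_algebra K) (counit G) (\<rho> p))"
    by (rule push_push[OF mG alg_mod[OF base_algebra_alg] mG alghom_lin[OF \<epsilon>] alghom_lin[OF unit_alghom[OF A]] rc, symmetric])
  also have "\<dots> = iota G p"
    by (simp add: coaction_counit_push p push_iota[OF base_algebra_alg A unit_alghom[OF A]])
  finally show ?thesis .
qed

text \<open>The antipode of \<open>G\<close> is assumed to be linear only. That suffices, since
  \<open>autos\<close> asks of the second component nothing but linearity and the inverse
  laws.\<close>

lemma coaction_autos: "(\<rho>, \<lambda>p. push G G (antipode G) (\<rho> p)) \<in> autos G"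
proof (rule autosI[OF \<rho> lin_comp[OF push_lin[OF mG mG S] \<rho>] op])
  note lid = lin_id(1)
  have pid: "push G G (\<lambda>x. x) (\<rho> p) = \<rho> p" if "p \<in> carrier P" for p
    by (rule push_id[OF mG lin_closed[OF \<rho> that]])
  fix p assume p: "p \<in> carrier P"
  have "ext G (\<lambda>p. push G G (\<lambda>x. x) (\<rho> p)) (push G G (antipode G) (\<rho> p)) = iota G p"
    by (rule coaction_convolution[OF lid S p]) (rule G.antipode_right)
  moreover have "ext G (\<lambda>p. push G G (\<lambda>x. x) (\<rho> p)) (push G G (antipode G) (\<rho> p)) =
      ext G \<rho> (push G G (antipode G) (\<rho> p))"
    by (rule ext_cong[OF A lin_comp[OF push_lin[OF mG mG lid] \<rho>] pid
          lin_closed[OF push_lin[OF mG mG S] lin_closed[OF \<rho> p]]])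
  ultimately show "ext G \<rho> (push G G (antipode G) (\<rho> p)) = iota G p" by simp
  have "ext G (\<lambda>p. push G G (antipode G) (\<rho> p)) (push G G (\<lambda>x. x) (\<rho> p)) = iota G p"
    by (rule coaction_convolution[OF S lid p]) (rule G.antipode_left)
  then show "ext G (\<lambda>p. push G G (antipode G) (\<rho> p)) (\<rho> p) = iota G p" by (simp only: pid[OF p])
qed

end

end

section \<open>Poisson algebras and the initial object\<close>

lemma poisson_base_space:
  assumes "poisson_algebra K P"
  shows "base_space K P {mult P, bracket P}"
proof -
  interpret poisson_algebra K P by fact
  interpret base_ring K by unfold_locales
  note cl = mult_closed bracket_closed
  have "bil P P P (mult P)"
    by (intro bilI linI)
      (simp_all add: cl mult_add_left mult_smult_left mult_comm[of _ "_ \<oplus>\<^bsub>P\<^esub> _"] mult_comm[of _ "_ \<odot>\<^bsub>P\<^esub> _"]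
        M.a_closed smult_closed, simp_all add: mult_comm)
  moreover have "bil P P P (bracket P)"
    by (intro bilI linI)
      (simp_all add: cl bracket_add_left bracket_smult_left bracket_add_right bracket_smult_right)
  ultimately show ?thesis by unfold_locales auto
qed

lemma poisson_tensor_hom_iff:
  "f \<in> poisson_hom K P (poisson_tensor K P A) \<longleftrightarrow>
    f \<in> linear_maps K P (tensor K P A) \<and>
    (\<forall>\<beta>\<in>{mult P, bracket P}. \<forall>x\<in>carrier P. \<forall>y\<in>carrier P.
      f (\<beta> x y) = tensor_op K P A \<beta> (mult A) (f x) (f y))"
proof -
  have "carrier (poisson_tensor K P A) = carrier (tensor K P A)" "add (poisson_tensor K P A) = add (tensor K P A)"
    "smult (poisson_tensor K P A) = smult (tensor K P A)"
    "mult (poisson_tensor K P A) = tensor_op K P A (mult P) (mult A)"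
    "bracket (poisson_tensor K P A) = tensor_op K P A (bracket P) (mult A)"
    by (simp_all add: poisson_tensor_def poisson.defs module.defs tensor_def)
  then show ?thesis by (auto simp: poisson_hom_def linear_maps_def)
qed

lemma CoactHopf_objD:
  assumes "(G, \<rho>) \<in> CoactHopf_obj K P"
  shows "poisson_algebra K P" "comm_hopf_algebra K G" "\<rho> \<in> linear_maps K P (tensor K P G)"
    "\<beta> \<in> {mult P, bracket P} \<Longrightarrow> x \<in> carrier P \<Longrightarrow> y \<in> carrier P \<Longrightarrow>
      \<rho> (\<beta> x y) = tensor_op K P G \<beta> (mult G) (\<rho> x) (\<rho> y)"
    "p \<in> carrier P \<Longrightarrow> tensor_assoc K P G G (tensor_map K P G (tensor K P G) G \<rho> id (\<rho> p)) =
        tensor_map K P G P (tensor K G G) id (comult G) (\<rho> p)"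
    "p \<in> carrier P \<Longrightarrow> tensor_lift K P G P (\<lambda>q h. counit G h \<odot>\<^bsub>P\<^esub> q) (\<rho> p) = p"
proof -
  have "poisson_comodule_algebra K P G \<rho>" using assms by (simp add: CoactHopf_obj_def)
  then interpret poisson_comodule_algebra K P G \<rho> .
  show "poisson_algebra K P" "comm_hopf_algebra K G" by unfold_locales
  from coaction_hom show "\<rho> \<in> linear_maps K P (tensor K P G)"
    "\<beta> \<in> {mult P, bracket P} \<Longrightarrow> x \<in> carrier P \<Longrightarrow> y \<in> carrier P \<Longrightarrow>
      \<rho> (\<beta> x y) = tensor_op K P G \<beta> (mult G) (\<rho> x) (\<rho> y)"
    unfolding poisson_tensor_hom_iff by blast+
  show "p \<in> carrier P \<Longrightarrow> tensor_assoc K P G G (tensor_map K P G (tensor K P G) G \<rho> id (\<rho> p)) =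
        tensor_map K P G P (tensor K G G) id (comult G) (\<rho> p)"
    "p \<in> carrier P \<Longrightarrow> tensor_lift K P G P (\<lambda>q h. counit G h \<odot>\<^bsub>P\<^esub> q) (\<rho> p) = p"
    by (rule coaction_coassoc coaction_counit; assumption)+
qed

locale poisson_coordinate_ring = poisson_algebra K P + coordinate_ring K P "{mult P, bracket P}" B e code
  for K (structure) and P :: "('a, 'p, 'r) poisson_scheme" and B e code
begin

lemma initial_obj: "(H, lam) \<in> CoactHopf_obj K P"
proof -
  have hopf: "comm_hopf_algebra K H" by (rule H_hopf) unfold_locales
  have "poisson_comodule_algebra K P H lam"
  proof (intro poisson_comodule_algebra.intro poisson_comodule_algebra_axioms.intro)
    show "poisson_algebra K P" by unfold_locales
    show "comm_hopf_algebra K H" by (rule hopf)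
    show "lam \<in> poisson_hom K P (poisson_tensor K P H)"
      unfolding poisson_tensor_hom_iff using autosD(1,3)[OF lam_autos] by blast
    fix p assume p: "p \<in> carrier P"
    show "tassoc P H H (tmap P H (P \<boxtimes> H) H lam id (lam p)) = tmap P H P HH id (comult H) (lam p)"
      \<comment> \<open>Coassociativity of the coaction is the defining property of
        \<open>comult\<close>, read through the dictionary.\<close>
      unfolding tassoc_ext[OF H_alg lam_lin lam_closed[OF p]] comult_lam[OF p, symmetric] by (simp add: push_def)
    have b: "bil P H P (\<lambda>q h. counit H h \<odot>\<^bsub>P\<^esub> q)"
      by (rule bil_flip[OF bil_pre[OF bil_smult[OF P] alghom_lin[OF counit_alghom] lin_id(1)]])
    show "tlift P H P (\<lambda>q h. counit H h \<odot>\<^bsub>P\<^esub> q) (lam p) = p"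
      \<comment> \<open>The equation is compared inside \<open>P \<boxtimes> base_algebra K\<close>,
        where it says that the counit classifies the identity.\<close>
      by (rule iota_base_inj[OF lin_closed[OF tlift_lin[OF P alg_mod[OF H_alg] P b] lam_closed[OF p]] p])
        (simp add: push_functional[OF alg_mod[OF H_alg] alghom_lin[OF counit_alghom], symmetric] lam_closed p counit_lam)
  qed
  then show ?thesis by (simp add: CoactHopf_obj_def)
qed

text \<open>A morphism carries \<open>lam\<close> to \<open>\<rho>\<close>, and at most one algebra
  map does so on the carrier; extensionality fixes the values elsewhere.\<close>

lemma initial_unique:
  assumes X: "(G, \<rho>) \<in> CoactHopf_obj K P"
    and f: "f \<in> CoactHopf_hom K P (H, lam) (G, \<rho>)" and g: "g \<in> CoactHopf_hom K P (H, lam) (G, \<rho>)"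
  shows "f = g"
proof (rule extensionalityI)
  show "f \<in> extensional (carrier H)" "g \<in> extensional (carrier H)"
    using f g by (simp_all add: CoactHopf_hom_def)
  have fg: "f \<in> alghom H G" "g \<in> alghom H G"
    using f g by (simp_all add: CoactHopf_hom_def bialgebra_hom_def)
  show "f h = g h" if "h \<in> carrier H" for h
    by (rule H_unique[OF hopf_alg[OF CoactHopf_objD(2)[OF X]] fg _ that])
      (use f g in \<open>simp add: CoactHopf_hom_def push_def\<close>)
qed

text \<open>The algebra map is the one classifying \<open>\<rho>\<close>. Compatibility with the
  coalgebra structures is again an equality of classifying maps, so it is enough to compare the
  points that they classify.\<close>

lemma initial_exists:
  assumes X: "(G, \<rho>) \<in> CoactHopf_obj K P"
  shows "\<exists>f. f \<in> CoactHopf_hom K P (H, lam) (G, \<rho>)"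
proof -
  note X = CoactHopf_objD[OF X]
  note A = hopf_alg[OF X(2)]
  note AA = tensor_alg[OF A A]
  note mH = alg_mod[OF H_alg] and mG = alg_mod[OF A]
  obtain f where f: "f \<in> alghom H G" and push_f: "\<And>p. p \<in> carrier P \<Longrightarrow> push H G f (lam p) = \<rho> p"
    using H_classify[OF A coaction_autos[OF X(2-6)]] by blast
  note fl = alghom_lin[OF f]
  let ?GG = "G \<boxtimes> G"
  let ?ff = "tmap H H G G f f"
  note ff = tmap_alghom[OF H_alg H_alg A A f f]
  note ffp = tmap_pt[OF mH mH mG mG fl fl]
  note \<Delta> = hopf_comult[OF X(2)] and \<epsilon> = hopf_counit[OF X(2)]
  \<comment> \<open>Both maps classify the product of the two base changes of \<open>\<rho>\<close>
    over \<open>?GG\<close>: one by coassociativity of \<open>\<rho>\<close>, the other by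
    \<open>push_comult\<close>.\<close>
  have comult: "comult G (f h) = ?ff (comult H h)" if h: "h \<in> carrier H" for h
  proof (rule H_unique[OF AA alghom_comp[OF \<Delta> f] alghom_comp[OF ff comult_alghom] _ h])
    fix p assume p: "p \<in> carrier P"
    note i1 = incl_left_alghom[OF A A] and i2 = incl_right_alghom[OF A A]
    note rc = lin_closed[OF X(3)]
    have "push H ?GG (\<lambda>h. comult G (f h)) (lam p) = push G ?GG (comult G) (\<rho> p)"
      by (simp add: push_alghom_comp[OF H_alg A AA f \<Delta>] lam_closed p push_f)
    also have "\<dots> = ext ?GG (\<lambda>p. push G ?GG (left G) (\<rho> p)) (push G ?GG (right G) (\<rho> p))"
      by (rule coaction_comult[OF X(2-6) p])
    also have "\<dots> = ext ?GG (\<lambda>p. push H ?GG (\<lambda>h. pt G G (f h) \<one>\<^bsub>G\<^esub>) (lam p))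
        (push G ?GG (right G) (\<rho> p))"
      by (rule ext_cong[OF AA lin_comp[OF push_alghom_lin[OF A AA i1] X(3)] _
            lin_closed[OF push_alghom_lin[OF A AA i2] rc[OF p]]])
        (simp add: push_alghom_comp[OF H_alg A AA f i1] lam_closed push_f)
    also have "push G ?GG (right G) (\<rho> p) = push H ?GG (\<lambda>h. pt G G \<one>\<^bsub>G\<^esub> (f h)) (lam p)"
      by (simp add: push_alghom_comp[OF H_alg A AA f i2] lam_closed push_f p)
    also have "ext ?GG (\<lambda>p. push H ?GG (\<lambda>h. pt G G (f h) \<one>\<^bsub>G\<^esub>) (lam p)) \<dots> =
        push H ?GG (\<lambda>h. ?ff (comult H h)) (lam p)"
      by (rule push_comult[OF AA ff _ _ p, symmetric])
        (simp_all add: ffp alg_simps[OF H_alg] alghom_one[OF f])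
    finally show "push H ?GG (\<lambda>h. comult G (f h)) (lam p) = push H ?GG (\<lambda>h. ?ff (comult H h)) (lam p)" .
  qed
  have counit: "counit G (f h) = counit H h" if h: "h \<in> carrier H" for h
  proof (rule H_unique[OF base_algebra_alg alghom_comp[OF \<epsilon> f] counit_alghom _ h])
    fix p assume p: "p \<in> carrier P"
    show "push H (base_algebra K) (\<lambda>h. counit G (f h)) (lam p) = push H (base_algebra K) (counit H) (lam p)"
      unfolding push_alghom_comp[OF H_alg A base_algebra_alg f \<epsilon> lam_closed[OF p]] push_f[OF p] counit_lam[OF p]
      by (rule coaction_counit_push[OF X(2-6) p])
  qed
  \<comment> \<open>Morphisms are extensional, so \<open>f\<close> is cut down to the carrier;
    tensor maps and base changes do not notice.\<close>
  let ?r = "restrict f (carrier H)"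
  have r: "?r \<in> alghom H G" by (rule alghom_cong[OF f H_alg]) simp
  have "?r \<in> bialgebra_hom K H G"
    unfolding bialgebra_hom_def
  proof (intro CollectI conjI ballI r)
    fix h assume h: "h \<in> carrier H"
    have "?ff (comult H h) = tmap H H G G ?r ?r (comult H h)"
      by (rule tmap_cong[OF mH mH mG mG fl fl _ _ alghom_closed[OF comult_alghom h]]) simp_all
    then show "comult G (?r h) = tmap H H G G ?r ?r (comult H h)" "counit G (?r h) = counit H h"
      using h by (simp_all add: comult counit)
  qed
  moreover have "tmap P H P G id ?r (lam p) = \<rho> p" if p: "p \<in> carrier P" for p
  proof -
    have "push H G f (lam p) = push H G ?r (lam p)"
      by (rule push_cong[OF mH mG fl _ lam_closed[OF p]]) simp
    then show ?thesis using push_f[OF p] by (simp add: push_def)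
  qed
  ultimately show ?thesis by (auto simp: CoactHopf_hom_def)
qed

text \<open>The type of the test objects is free here, while \<open>H\<close> stays in the type of
  polynomial cosets.\<close>

lemma initial: "CoactHopf_initial TYPE('h) K P (H, lam)"
  unfolding CoactHopf_initial_def using initial_obj initial_exists initial_unique by fast

end

section \<open>Identities, composition and change of test type\<close>

lemma CoactHopf_hom_id:
  assumes X: "(G, \<rho>) \<in> CoactHopf_obj K P"
  shows "restrict (\<lambda>x. x) (carrier G) \<in> CoactHopf_hom K P (G, \<rho>) (G, \<rho>)"
proof -
  note X = CoactHopf_objD[OF X]
  interpret base_space K P "{mult P, bracket P}" by (rule poisson_base_space[OF X(1)])
  note A = hopf_alg[OF X(2)]
  note mG = alg_mod[OF A]
  let ?r = "restrict (\<lambda>x. x) (carrier G)"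
  have r: "?r \<in> alghom G G" by (rule alghom_cong[OF alghom_id A]) simp
  have "tmap G G G G ?r ?r (comult G h) = comult G h" if h: "h \<in> carrier G" for h
  proof -
    note ch = alghom_closed[OF hopf_comult[OF X(2)] h]
    have "tmap G G G G (\<lambda>x. x) (\<lambda>x. x) (comult G h) = tmap G G G G ?r ?r (comult G h)"
      by (rule tmap_cong[OF mG mG mG mG lin_id(1) lin_id(1) _ _ ch]) simp_all
    then show ?thesis by (simp add: tmap_id[OF mG mG ch])
  qed
  moreover have "push G G ?r (\<rho> p) = \<rho> p" if p: "p \<in> carrier P" for p
  proof -
    note rc = lin_closed[OF X(3) p]
    have "push G G (\<lambda>x. x) (\<rho> p) = push G G ?r (\<rho> p)"
      by (rule push_cong[OF mG mG lin_id(1) _ rc]) simp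
    then show ?thesis by (simp add: push_id[OF mG rc])
  qed
  ultimately show ?thesis using r by (simp add: CoactHopf_hom_def bialgebra_hom_def push_def)
qed

lemma CoactHopf_hom_comp:
  assumes X: "(G, \<rho>) \<in> CoactHopf_obj K P" and Y: "(G', \<rho>') \<in> CoactHopf_obj K P"
    and Z: "(G'', \<rho>'') \<in> CoactHopf_obj K P"
    and f: "f \<in> CoactHopf_hom K P (G, \<rho>) (G', \<rho>')" and g: "g \<in> CoactHopf_hom K P (G', \<rho>') (G'', \<rho>'')"
  shows "restrict (\<lambda>x. g (f x)) (carrier G) \<in> CoactHopf_hom K P (G, \<rho>) (G'', \<rho>'')"
proof -
  note X = CoactHopf_objD[OF X] and Y = CoactHopf_objD[OF Y] and Z = CoactHopf_objD[OF Z]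
  interpret base_space K P "{mult P, bracket P}" by (rule poisson_base_space[OF X(1)])
  note A = hopf_alg[OF X(2)] and A' = hopf_alg[OF Y(2)] and A'' = hopf_alg[OF Z(2)]
  note m = alg_mod[OF A] and m' = alg_mod[OF A'] and m'' = alg_mod[OF A'']
  have f': "f \<in> alghom G G'" "\<And>h. h \<in> carrier G \<Longrightarrow> comult G' (f h) = tmap G G G' G' f f (comult G h)"
    "\<And>h. h \<in> carrier G \<Longrightarrow> counit G' (f h) = counit G h" "\<And>p. p \<in> carrier P \<Longrightarrow> push G G' f (\<rho> p) = \<rho>' p"
    using f by (simp_all add: CoactHopf_hom_def bialgebra_hom_def push_def)
  have g': "g \<in> alghom G' G''" "\<And>h. h \<in> carrier G' \<Longrightarrow> comult G'' (g h) = tmap G' G' G'' G'' g g (comult G' h)"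
    "\<And>h. h \<in> carrier G' \<Longrightarrow> counit G'' (g h) = counit G' h" "\<And>p. p \<in> carrier P \<Longrightarrow> push G' G'' g (\<rho>' p) = \<rho>'' p"
    using g by (simp_all add: CoactHopf_hom_def bialgebra_hom_def push_def)
  note fl = alghom_lin[OF f'(1)] and gl = alghom_lin[OF g'(1)]
  let ?c = "\<lambda>x. g (f x)" and ?r = "restrict (\<lambda>x. g (f x)) (carrier G)"
  note c = alghom_comp[OF g'(1) f'(1)]
  have r: "?r \<in> alghom G G''" by (rule alghom_cong[OF c A]) simp
  have "comult G'' (g (f h)) = tmap G G G'' G'' ?r ?r (comult G h)" if h: "h \<in> carrier G" for h
  proof -
    note ch = alghom_closed[OF hopf_comult[OF X(2)] h]
    have "comult G'' (g (f h)) = tmap G' G' G'' G'' g g (tmap G G G' G' f f (comult G h))"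
      by (simp add: g'(2) f'(2) alghom_closed[OF f'(1)] h)
    also have "\<dots> = tmap G G G'' G'' ?c ?c (comult G h)"
      by (rule tmap_comp[OF m m m' m' m'' m'' fl fl gl gl ch])
    also have "\<dots> = tmap G G G'' G'' ?r ?r (comult G h)"
      by (rule tmap_cong[OF m m m'' m'' alghom_lin[OF c] alghom_lin[OF c] _ _ ch]) simp_all
    finally show ?thesis .
  qed
  moreover have "push G G'' ?r (\<rho> p) = \<rho>'' p" if p: "p \<in> carrier P" for p
  proof -
    note rc = lin_closed[OF X(3) p]
    have "push G G'' ?c (\<rho> p) = push G G'' ?r (\<rho> p)"
      by (rule push_cong[OF m m'' alghom_lin[OF c] _ rc]) simp
    moreover have "push G G'' ?c (\<rho> p) = \<rho>'' p"
      by (simp add: push_push[OF m m' m'' fl gl rc, symmetric] f'(4) g'(4) p)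
    ultimately show ?thesis by simp
  qed
  moreover have "counit G'' (g (f h)) = counit G h" if "h \<in> carrier G" for h
    using that by (simp add: f'(3) g'(3) alghom_closed[OF f'(1)])
  ultimately show ?thesis using r by (simp add: CoactHopf_hom_def bialgebra_hom_def push_def)
qed

text \<open>\<open>I\<close> and \<open>J\<close> are isomorphic, being both initial among the test objects in \<open>'i\<close>.\<close>

lemma CoactHopf_initial_transfer:
  fixes I J :: "('k, 'p, 'i) coaction"
  assumes J: "CoactHopf_initial TYPE('i) K P J" "CoactHopf_initial TYPE('h) K P J"
    and I: "CoactHopf_initial TYPE('i) K P I"
  shows "CoactHopf_initial TYPE('h) K P I"
proof -
  obtain G \<rho> where I_eq: "I = (G, \<rho>)" by (cases I)
  obtain H \<mu> where J_eq: "J = (H, \<mu>)" by (cases J)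
  have Io: "(G, \<rho>) \<in> CoactHopf_obj K P" and Jo: "(H, \<mu>) \<in> CoactHopf_obj K P"
    using I J(1) by (simp_all add: CoactHopf_initial_def I_eq J_eq)
  obtain f where f: "f \<in> CoactHopf_hom K P (G, \<rho>) (H, \<mu>)"
    using I Jo unfolding CoactHopf_initial_def I_eq by blast
  obtain g where g: "g \<in> CoactHopf_hom K P (H, \<mu>) (G, \<rho>)"
    using J(1) Io unfolding CoactHopf_initial_def J_eq by blast
  \<comment> \<open>Both are endomorphisms of \<open>I\<close>, which is initial among objects of
    its own type.\<close>
  have "restrict (\<lambda>x. g (f x)) (carrier G) = restrict (\<lambda>x. x) (carrier G)"
    using I Io CoactHopf_hom_comp[OF Io Jo Io f g] CoactHopf_hom_id[OF Io]
    unfolding CoactHopf_initial_def I_eq by blast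
  then have gf: "g (f x) = x" if "x \<in> carrier G" for x
    using that by (metis restrict_apply')
  have "\<exists>!u. u \<in> CoactHopf_hom K P (G, \<rho>) (A, \<alpha>)" if X: "(A, \<alpha>) \<in> CoactHopf_obj K P"
    for A :: "('k, 'h) hopf" and \<alpha>
  proof -
    have ex: "\<exists>!u. u \<in> CoactHopf_hom K P (H, \<mu>) (A, \<alpha>)"
      using J(2) X unfolding CoactHopf_initial_def J_eq by blast
    then obtain u where u: "u \<in> CoactHopf_hom K P (H, \<mu>) (A, \<alpha>)" by blast
    show ?thesis
    proof (rule ex1I)
      show "restrict (\<lambda>x. u (f x)) (carrier G) \<in> CoactHopf_hom K P (G, \<rho>) (A, \<alpha>)"
        by (rule CoactHopf_hom_comp[OF Io Jo X f u])
      fix v assume v: "v \<in> CoactHopf_hom K P (G, \<rho>) (A, \<alpha>)"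
      \<comment> \<open>Any \<open>v\<close> out of \<open>I\<close> gives a morphism out of
        \<open>J\<close> by composing with \<open>g\<close>; initiality of \<open>J\<close>
        identifies it with \<open>u\<close>. Precomposing with \<open>f\<close> then recovers
        \<open>v\<close>, as \<open>g\<close> after \<open>f\<close> is the identity.\<close>
      have vg: "restrict (\<lambda>x. v (g x)) (carrier H) = u"
        using ex u CoactHopf_hom_comp[OF Jo Io X g v] by blast
      have fc: "f x \<in> carrier H" if "x \<in> carrier G" for x
        using f that by (auto simp: CoactHopf_hom_def bialgebra_hom_def algebra_hom_def linear_maps_def)
      show "v = restrict (\<lambda>x. u (f x)) (carrier G)"
      proof (rule extensionalityI)
        show "v \<in> extensional (carrier G)" using v by (simp add: CoactHopf_hom_def)
        fix x assume x: "x \<in> carrier G"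
        have "u (f x) = v (g (f x))" using vg fc[OF x] by (metis restrict_apply')
        then show "v x = restrict (\<lambda>x. u (f x)) (carrier G) x" using x by (simp add: gf)
      qed simp
    qed
  qed
  then show ?thesis using Io by (auto simp: CoactHopf_initial_def I_eq)
qed

(* HOL cannot quantify over types inside a formula, so the existence of the initial object is
   stated without mentioning the type 'h of the test objects, and initiality is then asserted
   against test objects with carrier in an arbitrary type 'h. *)
theorem corollary3p4:
  fixes K :: "'k ring" and P :: "('k, 'p) poisson"
  assumes "poisson_algebra K P" and "finite_dimensional K P"
  shows "(\<exists>I :: ('k, 'p, 'k poly_cosets) coaction.
            CoactHopf_initial TYPE('k poly_cosets) K P I) \<and>
         (\<forall>I :: ('k, 'p, 'k poly_cosets) coaction.
            CoactHopf_initial TYPE('k poly_cosets) K P I \<longrightarrow> CoactHopf_initial TYPE('h) K P I)"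
proof -
  interpret PA: poisson_algebra K P by fact
  interpret base_space K P "{mult P, bracket P}" by (rule poisson_base_space[OF assms(1)])
  obtain B e where B: "finite B" "B \<subseteq> carrier P" "\<And>b. b \<in> B \<Longrightarrow> e b \<in> linear_maps K P (base_algebra K)"
    "\<And>p. p \<in> carrier P \<Longrightarrow> p = (\<Oplus>\<^bsub>P\<^esub>b\<in>B. e b p \<odot>\<^bsub>P\<^esub> b)"
    by (rule dual_basis[OF PA.field_axioms P assms(2)]) blast
  have "finite (UNIV \<times> B \<times> B :: (bool \<times> 'p \<times> 'p) set)" using B(1) by simp
  then obtain code :: "bool \<times> 'p \<times> 'p \<Rightarrow> nat" where code: "inj_on code (UNIV \<times> B \<times> B)"
    using finite_imp_inj_to_nat_seg by metis
  interpret poisson_coordinate_ring K P B e code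
    by unfold_locales (fact B code)+
  show ?thesis
    \<comment> \<open>The constructed object is taken as \<open>J\<close>, with
      \<open>initial\<close> instantiated at its own type and at \<open>'h\<close>.\<close>
    using initial CoactHopf_initial_transfer[OF initial initial] by blast
qed

end
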